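(* Let $m\ge 1$, $N=1+m$, $\lambda\ge 1$, $Q=(m+1)+\lambda m$, let $\Omega\subset\mathbb{R}^{N}$ be a $\Lambda$-connected bounded open set, and let $f\in L^r(\Omega)$, $r\ge 1$, be a nonnegative function which is not identically zero. Let $u$ be the unique weak solution of $$-\Delta_\lambda u=\frac{f}{u}\ \text{ in }\Omega,\qquad u>0\ \text{ in }\Omega,\qquad u=0\ \text{ on }\partial\Omega.$$ Then: (i) if $r>\frac{Q}{2}$, then $u\in L^\infty(\Omega)$; (ii) if $1\le r<\frac{Q}{2}$, then $u\in L^s(\Omega)$ with $s=\frac{2Qr}{Q-2r}$.
   Context: Points of $\mathbb{R}^N=\mathbb{R}^{1+m}$ are written $X=(x,y)$ with $x\in\mathbb{R}$, $y\in\mathbb{R}^m$. The Grushin operator is $\Delta_\lambda u=u_{xx}+|x|^{2\lambda}\Delta_y u=\operatorname{div}(A\nabla u)$, where $A(X)=\operatorname{diag}(1,|x|^{2\lambda}I_m)$. An open set $\Omega$ is $\Lambda$-connected if any two points of $\Omega$ can be joined by a continuous curve lying in $\Omega$ which is piecewise an integral curve of the vector fields $\pm\partial_x,\pm|x|^\lambda\partial_{y_1},\dots,\pm|x|^\lambda\partial_{y_m}$. $\Omega'\Subset\Omega$ means that $\overline{\Omega'}$ is a compact subset of $\Omega$. $C^1_0(\Omega)$ is the space of $C^1$ functions with compact support in $\Omega$. Function spaces: let $V_A(\Omega)$ be the set of $u\in C^1(\Omega)$ with $\|u\|^2:=\int_\Omega|u|^2dX+\int_\Omega\langle A\nabla u,\nabla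 u\rangle dX<\infty$. $H^{1,\lambda}(\Omega)$ is the completion of $(V_A(\Omega),\|\cdot\|)$, and $H^{1,\lambda}_0(\Omega)$ is the completion of $C^1_0(\Omega)$ under $\|u\|_0:=(\int_\Omega\langle A\nabla u,\nabla u\rangle dX)^{1/2}$ (equivalent to $\|\cdot\|$ on $C^1_0(\Omega)$ by a Poincaré inequality). An element represented by a Cauchy sequence $\{u_n\}$ is identified with $u=\lim u_n$ in $L^2(\Omega)$; setting $U=\lim\sqrt{A}\nabla u_n$ in $L^2(\Omega)^N$ (which is uniquely determined by $u$), the weak quasi-gradient is $\nabla^*u:=(\sqrt{A})^{-1}U$, defined a.e. in $\Omega$. Weak solution: $u\in H^{1,\lambda}_0(\Omega)$ such that for every $\Omega'\Subset\Omega$ there is $C(\Omega')>0$ with $u\ge C(\Omega')$ a.e. in $\Omega'$, and $\int_\Omega\langle A\nabla^*u,\nabla v\rangle dX=\int_\Omega\frac{fv}{u}dX$ for all $v\in C^1_0(\Omega)$. It is known (for nonnegative, not identically zero $f\in L^1(\Omega)$) that exactly one weak solution exists. *)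

theory Defs
  imports "HOL-Analysis.Analysis"
begin

text \<open>
  A point of \<open>\<real>\<^sup>N\<close>, \<open>N = 1 + m\<close>, is a pair \<open>X = (x, y)\<close> in \<open>real \<times> (real ^ 'm)\<close>, with \<open>m = CARD('m)\<close>.
  Functions on \<open>\<Omega>\<close> are total functions whose values outside \<open>\<Omega>\<close> play no role; elements
  of Lebesgue and Sobolev spaces are represented by functions (determined up to null sets).
\<close>

subsection \<open>Lebesgue spaces\<close>

definition Lp_on :: "real \<Rightarrow> 'a::euclidean_space set \<Rightarrow> ('a \<Rightarrow> 'b::euclidean_space) \<Rightarrow> bool" where
  "Lp_on p \<Omega> g \<longleftrightarrow> g \<in> borel_measurable (lebesgue_on \<Omega>) \<and>
     integrable (lebesgue_on \<Omega>) (\<lambda>X. norm (g X) powr p)"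

definition Linfty_on :: "'a::euclidean_space set \<Rightarrow> ('a \<Rightarrow> 'b::euclidean_space) \<Rightarrow> bool" where
  "Linfty_on \<Omega> g \<longleftrightarrow> g \<in> borel_measurable (lebesgue_on \<Omega>) \<and>
     (\<exists>C. AE X in lebesgue_on \<Omega>. norm (g X) \<le> C)"

definition L2_lim_on ::
  "'a::euclidean_space set \<Rightarrow> (nat \<Rightarrow> 'a \<Rightarrow> 'b::euclidean_space) \<Rightarrow> ('a \<Rightarrow> 'b) \<Rightarrow> bool" where
  "L2_lim_on \<Omega> gs g \<longleftrightarrow> (\<forall>n. Lp_on 2 \<Omega> (gs n)) \<and> Lp_on 2 \<Omega> g \<and>
     (\<lambda>n. LINT X|lebesgue_on \<Omega>. (norm (gs n X - g X))\<^sup>2) \<longlonglongrightarrow> 0"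

subsection \<open>Spaces of continuously differentiable functions\<close>

definition grad :: "('a::euclidean_space \<Rightarrow> real) \<Rightarrow> 'a \<Rightarrow> 'a" where
  "grad u X = (\<Sum>b\<in>Basis. frechet_derivative u (at X) b *\<^sub>R b)"

definition C1_on :: "'a::euclidean_space set \<Rightarrow> ('a \<Rightarrow> real) \<Rightarrow> bool" where
  "C1_on \<Omega> u \<longleftrightarrow> (\<forall>X\<in>\<Omega>. u differentiable (at X)) \<and> continuous_on \<Omega> (grad u)"

definition compactly_inside :: "'a::euclidean_space set \<Rightarrow> 'a set \<Rightarrow> bool" where
  "compactly_inside \<Omega>' \<Omega> \<longleftrightarrow> compact (closure \<Omega>') \<and> closure \<Omega>' \<subseteq> \<Omega>"

definition C1_0 :: "'a::euclidean_space set \<Rightarrow> ('a \<Rightarrow> real) set" where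
  "C1_0 \<Omega> = {u. C1_on \<Omega> u \<and> compactly_inside {X \<in> \<Omega>. u X \<noteq> 0} \<Omega>}"

subsection \<open>The Grushin structure\<close>

text \<open>\<open>A(X) = diag(1, |x|\<^sup>2\<^sup>\<lambda> I\<^sub>m)\<close>, its square root, and the inverse of the latter, as linear maps.
  The inverse is meaningful only for \<open>x \<noteq> 0\<close>, that is, almost everywhere.\<close>

definition grushin_A :: "real \<Rightarrow> real \<times> (real ^ 'm) \<Rightarrow> real \<times> (real ^ 'm) \<Rightarrow> real \<times> (real ^ 'm)" where
  "grushin_A lam X Z = (fst Z, (\<bar>fst X\<bar> powr (2 * lam)) *\<^sub>R snd Z)"

definition grushin_sqrtA :: "real \<Rightarrow> real \<times> (real ^ 'm) \<Rightarrow> real \<times> (real ^ 'm) \<Rightarrow> real \<times> (real ^ 'm)" where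
  "grushin_sqrtA lam X Z = (fst Z, (\<bar>fst X\<bar> powr lam) *\<^sub>R snd Z)"

definition grushin_sqrtA_inv ::
  "real \<Rightarrow> real \<times> (real ^ 'm) \<Rightarrow> real \<times> (real ^ 'm) \<Rightarrow> real \<times> (real ^ 'm)" where
  "grushin_sqrtA_inv lam X Z = (fst Z, inverse (\<bar>fst X\<bar> powr lam) *\<^sub>R snd Z)"

definition grushin_fields :: "real \<Rightarrow> (real \<times> (real ^ 'm) \<Rightarrow> real \<times> (real ^ 'm)) set" where
  "grushin_fields lam =
     {V. \<exists>\<sigma>\<in>{1, -1}. V = (\<lambda>X. (\<sigma>, 0)) \<or>
           (\<exists>j. V = (\<lambda>X. (0, (\<sigma> * \<bar>fst X\<bar> powr lam) *\<^sub>R axis j 1)))}"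

definition integral_curve_on ::
  "('a::real_normed_vector \<Rightarrow> 'a) \<Rightarrow> (real \<Rightarrow> 'a) \<Rightarrow> real set \<Rightarrow> bool" where
  "integral_curve_on V \<gamma> I \<longleftrightarrow> (\<forall>s\<in>I. (\<gamma> has_vector_derivative V (\<gamma> s)) (at s within I))"

definition Lambda_connected :: "real \<Rightarrow> (real \<times> (real ^ 'm)) set \<Rightarrow> bool" where
  "Lambda_connected lam \<Omega> \<longleftrightarrow>
     (\<forall>P\<in>\<Omega>. \<forall>R\<in>\<Omega>. \<exists>\<gamma> T (t :: nat \<Rightarrow> real) k.
        continuous_on {0..T} \<gamma> \<and> \<gamma> ` {0..T} \<subseteq> \<Omega> \<and> \<gamma> 0 = P \<and> \<gamma> T = R \<and>
        t 0 = 0 \<and> t k = T \<and>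
        (\<forall>i<k. t i < t (Suc i) \<and>
           (\<exists>V\<in>grushin_fields lam. integral_curve_on V \<gamma> {t i..t (Suc i)})))"

subsection \<open>The energy space and weak solutions\<close>

definition grushin_norm0 :: "real \<Rightarrow> (real \<times> (real ^ 'm)) set \<Rightarrow> (real \<times> (real ^ 'm) \<Rightarrow> real) \<Rightarrow> real" where
  "grushin_norm0 lam \<Omega> u =
     sqrt (LINT X|lebesgue_on \<Omega>. grushin_A lam X (grad u X) \<bullet> grad u X)"

text \<open>The Cauchy sequence \<open>us\<close> of \<open>C\<^sup>1\<^sub>0(\<Omega>)\<close> represents the element \<open>u\<close> of the completion.\<close>

definition H10_represents ::
  "real \<Rightarrow> (real \<times> (real ^ 'm)) set \<Rightarrow> (nat \<Rightarrow> real \<times> (real ^ 'm) \<Rightarrow> real) \<Rightarrow>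
     (real \<times> (real ^ 'm) \<Rightarrow> real) \<Rightarrow> bool" where
  "H10_represents lam \<Omega> us u \<longleftrightarrow> (\<forall>n. us n \<in> C1_0 \<Omega>) \<and>
     (\<forall>e>0. \<exists>M. \<forall>i\<ge>M. \<forall>j\<ge>M. grushin_norm0 lam \<Omega> (\<lambda>X. us i X - us j X) < e) \<and>
     L2_lim_on \<Omega> us u"

definition H10 :: "real \<Rightarrow> (real \<times> (real ^ 'm)) set \<Rightarrow> (real \<times> (real ^ 'm) \<Rightarrow> real) set" where
  "H10 lam \<Omega> = {u. \<exists>us. H10_represents lam \<Omega> us u}"

text \<open>\<open>G\<close> is a version of the weak quasi-gradient \<open>\<nabla>\<^sup>*u\<close>. Since the limit \<open>U\<close> depends only on \<open>u\<close>
  up to null sets, so does \<open>G\<close>.\<close>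

definition quasi_gradient ::
  "real \<Rightarrow> (real \<times> (real ^ 'm)) set \<Rightarrow> (real \<times> (real ^ 'm) \<Rightarrow> real) \<Rightarrow>
     (real \<times> (real ^ 'm) \<Rightarrow> real \<times> (real ^ 'm)) \<Rightarrow> bool" where
  "quasi_gradient lam \<Omega> u G \<longleftrightarrow>
     (\<exists>us U. H10_represents lam \<Omega> us u \<and>
        L2_lim_on \<Omega> (\<lambda>n X. grushin_sqrtA lam X (grad (us n) X)) U \<and>
        (AE X in lebesgue_on \<Omega>. G X = grushin_sqrtA_inv lam X (U X)))"

definition weak_solution ::
  "real \<Rightarrow> (real \<times> (real ^ 'm)) set \<Rightarrow> (real \<times> (real ^ 'm) \<Rightarrow> real) \<Rightarrow>
     (real \<times> (real ^ 'm) \<Rightarrow> real) \<Rightarrow> bool" where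
  "weak_solution lam \<Omega> f u \<longleftrightarrow> u \<in> H10 lam \<Omega> \<and>
     (\<forall>\<Omega>'. compactly_inside \<Omega>' \<Omega> \<longrightarrow>
        (\<exists>C>0. AE X in lebesgue_on \<Omega>. X \<in> \<Omega>' \<longrightarrow> C \<le> u X)) \<and>
     (\<exists>G. quasi_gradient lam \<Omega> u G \<and>
        (\<forall>v\<in>C1_0 \<Omega>. (LINT X|lebesgue_on \<Omega>. grushin_A lam X (G X) \<bullet> grad v X) =
                     (LINT X|lebesgue_on \<Omega>. f X * v X / u X)))"

end

theory Submission
  imports Defs
begin

text \<open>
  The Sobolev inequality \<open>\<parallel>v\<parallel>\<^sub>2\<^sub>*\<^sup>2 \<le> C \<integral> \<langle>A\<nabla>v, \<nabla>v\<rangle>\<close> with \<open>2\<^sup>* = 2Q / (Q - 2)\<close> comes from an isoperimetric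
  inequality. For a set \<open>E\<close> let \<open>P\<close> be the sum of the measure \<open>p\<close> of its projection along \<open>x\<close> and of
  the measures, weighted by \<open>\<bar>x\<bar>\<^sup>\<lambda>\<close>, of its projections along the \<open>y\<^sub>j\<close>. The slice \<open>E\<^sub>x\<close> has measure at
  most \<open>p\<close>, and the \<open>m\<close>-dimensional isoperimetric inequality bounds it by \<open>p\<^sup>1\<^sup>/\<^sup>m\<close> times the sum of
  its projections. The first bound for \<open>\<bar>x\<bar> \<le> R\<close> and the second one for \<open>\<bar>x\<bar> > R\<close> give
  \<open>\<bar>E\<bar> \<le> 2 R P + R\<^sup>-\<^sup>\<lambda> P\<^sup>1\<^sup>+\<^sup>1\<^sup>/\<^sup>m\<close>, and the optimal \<open>R\<close> yields \<open>\<bar>E\<bar> \<le> 3 P\<^sup>Q\<^sup>/\<^sup>(\<^sup>Q\<^sup>-\<^sup>1\<^sup>)\<close>. The layer cake formula turns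
  this into an \<open>L\<^sup>1\<close> Sobolev inequality, which is applied to a power of \<open>\<bar>v\<bar>\<close>.

  The function \<open>\<phi>(u)\<close> is an admissible test function if \<open>\<phi>\<close> is \<open>C\<^sup>1\<close> with bounded derivative and
  \<open>\<phi>(0) = 0\<close>. For \<open>\<phi>' = \<psi>'\<^sup>2\<close> this gives \<open>\<parallel>\<psi>(u)\<parallel>\<^sub>2\<^sub>*\<^sup>2 \<le> C \<integral> f \<phi>(u) / u\<close>. If \<open>r > Q/2\<close>, choose for \<open>\<psi>\<close> a
  smoothed \<open>(s - k)\<^sup>+\<close> and apply Stampacchia's iteration lemma to the level sets of \<open>u\<close>. If \<open>r < Q/2\<close>,
  choose for \<open>\<psi>\<close> a truncated power \<open>s\<^sup>\<gamma>\<close>, \<open>\<gamma> = r (Q - 2) / (Q - 2r)\<close>, for which Hoelder's inequality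
  reproduces the \<open>L\<^sup>s\<close> norm on the right-hand side with a smaller power.
\<close>


section \<open>Marginals and the isoperimetric inequality\<close>

text \<open>The integral of \<open>f\<close> over the affine plane through \<open>X\<close> spanned
  by \<open>B\<close>. It stays a function on the whole space, so that sections of every dimension
  live in one type and induction on \<open>B\<close> is possible. For a cylinder along
  \<open>b\<close>, removing \<open>b\<close> from \<open>B\<close> gives the measure of a
  projection.\<close>

definition marginal :: "'a::euclidean_space set \<Rightarrow> ('a \<Rightarrow> ennreal) \<Rightarrow> 'a \<Rightarrow> ennreal" where
  "marginal B f X = (\<integral>\<^sup>+y. f (X + (\<Sum>b\<in>B. y b *\<^sub>R b)) \<partial>Pi\<^sub>M B (\<lambda>_. lborel))"

lemma product_sigma_finite_lborel: "product_sigma_finite (\<lambda>_::'a. lborel :: 'b::euclidean_space measure)"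
  by (simp add: product_sigma_finite_def sigma_finite_lborel)

lemma borel_measurable_marginal [measurable]:
  fixes f :: "'a::euclidean_space \<Rightarrow> ennreal"
  assumes [measurable]: "f \<in> borel_measurable borel" and "finite B"
  shows "marginal B f \<in> borel_measurable borel"
proof -
  interpret product_sigma_finite "\<lambda>_::'a. lborel :: real measure"
    by (rule product_sigma_finite_lborel)
  interpret sigma_finite_measure "Pi\<^sub>M B (\<lambda>_::'a. lborel :: real measure)"
    using \<open>finite B\<close> by (rule sigma_finite)
  show ?thesis
    unfolding marginal_def by measurable
qed

lemma marginal_empty:
  fixes f :: "'a::euclidean_space \<Rightarrow> ennreal"
  shows "marginal {} f X = f X"
proof -
  interpret product_sigma_finite "\<lambda>_::'a. lborel :: real measure"
    by (rule product_sigma_finite_lborel)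
  show ?thesis
    unfolding marginal_def by (simp add: space_PiM)
qed

text \<open>Fubini's theorem in both orders. The outer form cuts the plane into slices orthogonal to
  \<open>c\<close>; the inner form integrates along \<open>c\<close> first and serves for functions
  that are themselves integrals along a line.\<close>

lemma
  fixes f :: "'a::euclidean_space \<Rightarrow> ennreal"
  assumes f [measurable]: "f \<in> borel_measurable borel" and B: "finite B" "c \<notin> B"
  shows marginal_insert_outer:
      "marginal (insert c B) f X = (\<integral>\<^sup>+t. marginal B f (X + t *\<^sub>R c) \<partial>lborel)"
    and marginal_insert_inner:
      "marginal (insert c B) f X = marginal B (\<lambda>Y. \<integral>\<^sup>+t. f (Y + t *\<^sub>R c) \<partial>lborel) X"
proof -
  interpret product_sigma_finite "\<lambda>_::'a. lborel :: real measure"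
    by (rule product_sigma_finite_lborel)
  have sum: "(\<Sum>b\<in>B. (y(c := t)) b *\<^sub>R b) = (\<Sum>b\<in>B. y b *\<^sub>R b)" for y and t :: real
    using B by (intro sum.cong) auto
  show "marginal (insert c B) f X = (\<integral>\<^sup>+t. marginal B f (X + t *\<^sub>R c) \<partial>lborel)"
    unfolding marginal_def using B
    by (subst product_nn_integral_insert_rev) (simp_all add: sum add.assoc del: fun_upd_apply, simp)
  show "marginal (insert c B) f X = marginal B (\<lambda>Y. \<integral>\<^sup>+t. f (Y + t *\<^sub>R c) \<partial>lborel) X"
    unfolding marginal_def using B
    by (subst product_nn_integral_insert) (simp_all add: sum ac_simps del: fun_upd_apply, simp add: ac_simps)
qed

lemma marginal_Basis:
  fixes f :: "'a::euclidean_space \<Rightarrow> ennreal"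
  assumes [measurable]: "f \<in> borel_measurable borel"
  shows "marginal Basis f 0 = (\<integral>\<^sup>+X. f X \<partial>lborel)"
  unfolding marginal_def by (subst (2) lborel_eq) (simp add: nn_integral_distr)

lemma marginal_mono: "(\<And>Y. f Y \<le> g Y) \<Longrightarrow> marginal B f X \<le> marginal B g X"
  unfolding marginal_def by (rule nn_integral_mono)

text \<open>Used for indicators of cylinders: sections of a cylinder do not change along its
  axis.\<close>

lemma marginal_translate:
  assumes "\<And>Y. f (Y + Z) = f Y"
  shows "marginal B f (X + Z) = marginal B f X"
proof -
  have "f (X + Z + W) = f (X + W)" for W
    using assms[of "X + W"] by (simp add: ac_simps)
  then show ?thesis
    unfolding marginal_def by simp
qed

text \<open>The exponent-free form of the isoperimetric inequality
  \<open>|E|\<^sup>n\<^sup>-\<^sup>1 \<le> (sum of the measures of the projections)\<^sup>n\<close>, taking \<open>\<kappa> = |E|\<^sup>1\<^sup>/\<^sup>n\<close>.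
  The sets \<open>F b\<close> are cylinders over the projections of \<open>E\<close>.\<close>

lemma marginal_isoperimetric:
  fixes E :: "'a::euclidean_space set" and F :: "'a \<Rightarrow> 'a set" and \<kappa> :: ennreal
  assumes "finite B" "B \<noteq> {}"
    and E [measurable]: "E \<in> sets borel" and F [measurable]: "\<And>b. b \<in> B \<Longrightarrow> F b \<in> sets borel"
    and sub: "\<And>b. b \<in> B \<Longrightarrow> E \<subseteq> F b"
    and inv: "\<And>b X t. b \<in> B \<Longrightarrow> X + t *\<^sub>R b \<in> F b \<longleftrightarrow> X \<in> F b"
    and le: "marginal B (indicator E) X \<le> \<kappa> ^ card B"
  shows "marginal B (indicator E) X \<le> \<kappa> * (\<Sum>b\<in>B. marginal (B - {b}) (indicator (F b)) X)"
  using assms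
proof (induction B arbitrary: X rule: finite_ne_induct)
  case (singleton b)
  have [measurable]: "E \<in> sets borel" "F b \<in> sets borel" using singleton by auto
  show ?case
  \<comment> \<open>In dimension one the projection is a single point. If the line through
    \<open>X\<close> lies in \<open>F b\<close>, the sum equals 1 and the claim is the hypothesis on
    \<open>\<kappa>\<close>; otherwise the line misses \<open>E\<close>.\<close>
  proof (cases "X \<in> F b")
    case True
    then show ?thesis
      using singleton by (simp add: marginal_empty)
  next
    case False
    then have "X + t *\<^sub>R b \<notin> E" for t
      using singleton by blast
    then have "marginal {b} (indicator E) X = 0"
      by (subst marginal_insert_outer) (simp_all add: marginal_empty)
    then show ?thesis by simp
  qed
next
  case (insert c B)
  note fin = \<open>finite B\<close> and c = \<open>c \<notin> B\<close>
  have [measurable]: "E \<in> sets borel" "F c \<in> sets borel"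
    and [measurable]: "\<And>b. b \<in> B \<Longrightarrow> F b \<in> sets borel"
    using insert.prems by auto
  define p where "p = marginal B (indicator (F c)) X"
  \<comment> \<open>Each slice of \<open>E\<close> lies in the section of the cylinder
    \<open>F c\<close>, and all these sections have the same measure \<open>p\<close>.\<close>
  have line: "marginal B (indicator E) (X + t *\<^sub>R c) \<le> p" for t
  proof -
    have "marginal B (indicator E) (X + t *\<^sub>R c) \<le> marginal B (indicator (F c)) (X + t *\<^sub>R c)"
      using insert.prems(3)[of c] by (intro marginal_mono) (auto split: split_indicator)
    also have "\<dots> = p"
      unfolding p_def using insert.prems(4)[of c]
      by (intro marginal_translate) (auto split: split_indicator)
    finally show ?thesis .
  qed
  have diff: "insert c B - {b} = insert c (B - {b})" if "b \<in> B" for b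
    using that c by auto
  have S: "(\<Sum>b\<in>insert c B. marginal (insert c B - {b}) (indicator (F b)) X) =
    p + (\<Sum>b\<in>B. marginal (insert c (B - {b})) (indicator (F b)) X)"
    using fin c by (simp add: p_def diff cong: sum.cong)
  show ?case
  \<comment> \<open>If \<open>p\<close> is small, every slice satisfies the volume bound of the
    induction hypothesis, and integrating over \<open>t\<close> adds the direction \<open>c\<close>
    to the remaining projections. If \<open>p\<close> is large, this one projection suffices,
    because \<open>\<kappa> * p\<close> already exceeds the assumed bound
    \<open>\<kappa> * \<kappa> ^ card B\<close>.\<close>
  proof (cases "p \<le> \<kappa> ^ card B")
    case True
    have "marginal (insert c B) (indicator E) X = (\<integral>\<^sup>+t. marginal B (indicator E) (X + t *\<^sub>R c) \<partial>lborel)"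
      using fin c by (intro marginal_insert_outer) auto
    also have "\<dots> \<le> (\<integral>\<^sup>+t. \<kappa> * (\<Sum>b\<in>B. marginal (B - {b}) (indicator (F b)) (X + t *\<^sub>R c)) \<partial>lborel)"
      using insert.prems by (intro nn_integral_mono insert.IH order_trans[OF line True]) auto
    also have "\<dots> = \<kappa> * (\<Sum>b\<in>B. \<integral>\<^sup>+t. marginal (B - {b}) (indicator (F b)) (X + t *\<^sub>R c) \<partial>lborel)"
      using fin by (simp add: nn_integral_cmult nn_integral_sum)
    also have "\<dots> = \<kappa> * (\<Sum>b\<in>B. marginal (insert c (B - {b})) (indicator (F b)) X)"
      using fin c by (intro arg_cong2[where f="(*)"] sum.cong refl marginal_insert_outer[symmetric]) auto
    also have "\<dots> \<le> \<kappa> * (\<Sum>b\<in>insert c B. marginal (insert c B - {b}) (indicator (F b)) X)"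
      unfolding S by (intro mult_left_mono) auto
    finally show ?thesis .
  next
    case False
    have "marginal (insert c B) (indicator E) X \<le> \<kappa> * \<kappa> ^ card B"
      using insert.prems(5) fin c by simp
    also have "\<dots> \<le> \<kappa> * (\<Sum>b\<in>insert c B. marginal (insert c B - {b}) (indicator (F b)) X)"
      unfolding S using False by (intro mult_left_mono) (auto intro: add_increasing2)
    finally show ?thesis .
  qed
qed

text \<open>On \<open>\<bar>X \<bullet> e\<bar> \<le> R\<close> the slices of \<open>E\<close> are bounded by \<open>\<kappa>\<^sup>m\<close>, beyond they are controlled by the
  weight.\<close>

lemma weighted_isoperimetric:
  fixes E :: "'a::euclidean_space set" and F :: "'a \<Rightarrow> 'a set" and \<kappa> lam R :: real
  assumes e: "e \<in> Basis" and dim: "DIM('a) = Suc m" "m \<ge> 1"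
    and E [measurable]: "E \<in> sets borel" and F [measurable]: "\<And>b. b \<in> Basis \<Longrightarrow> F b \<in> sets borel"
    and sub: "\<And>b. b \<in> Basis \<Longrightarrow> E \<subseteq> F b"
    and inv: "\<And>b X t. b \<in> Basis \<Longrightarrow> X + t *\<^sub>R b \<in> F b \<longleftrightarrow> X \<in> F b"
    and "lam \<ge> 0" "R > 0" "\<kappa> \<ge> 0"
    and p: "marginal (Basis - {e}) (indicator (F e)) 0 \<le> ennreal \<kappa> ^ m"
  shows "emeasure lborel E \<le> ennreal (2 * R * \<kappa> ^ m) + ennreal (\<kappa> * R powr (- lam)) *
    (\<Sum>b\<in>Basis - {e}. \<integral>\<^sup>+x. ennreal (\<bar>x\<bar> powr lam) *
        marginal (Basis - {e} - {b}) (indicator (F b)) (x *\<^sub>R e) \<partial>lborel)"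
proof -
  define B where "B = Basis - {e}"
  have B: "finite B" "e \<notin> B" "insert e B = Basis" "card B = m"
    using e dim by (auto simp: B_def)
  then have "B \<noteq> {}"
    using dim by auto
  have [measurable]: "\<And>b. b \<in> B \<Longrightarrow> F b \<in> sets borel" "F e \<in> sets borel"
    using e by (auto simp: B_def)
  define S where "S x = (\<Sum>b\<in>B. marginal (B - {b}) (indicator (F b)) (x *\<^sub>R e))" for x
  have [measurable]: "S \<in> borel_measurable borel"
    unfolding S_def using B by (intro borel_measurable_sum) (auto intro!: measurable_compose[OF _ borel_measurable_marginal])
  have slice: "marginal B (indicator E) (x *\<^sub>R e) \<le> ennreal \<kappa> ^ m" for x
  proof -
    have "marginal B (indicator E) (x *\<^sub>R e) \<le> marginal B (indicator (F e)) (x *\<^sub>R e)"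
      using sub[OF e] by (intro marginal_mono) (auto split: split_indicator)
    also have "\<dots> = marginal B (indicator (F e)) (0 + x *\<^sub>R e)" by simp
    also have "\<dots> = marginal B (indicator (F e)) 0"
      using inv[OF e] by (intro marginal_translate) (auto split: split_indicator)
    finally show ?thesis using p unfolding B_def by simp
  qed
  have split: "marginal B (indicator E) (x *\<^sub>R e) \<le>
      ennreal (\<kappa> ^ m) * indicator {-R..R} x + ennreal (\<kappa> * R powr (- lam)) * (ennreal (\<bar>x\<bar> powr lam) * S x)" for x
  proof (cases "x \<in> {-R..R}")
    case True
    then show ?thesis
      using slice[of x] \<open>\<kappa> \<ge> 0\<close> by (simp add: ennreal_power add_increasing2)
  next
    case False
    then have "R \<le> \<bar>x\<bar>" by auto
    then have "1 \<le> R powr (- lam) * \<bar>x\<bar> powr lam"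
      using \<open>R > 0\<close> \<open>lam \<ge> 0\<close> by (simp add: powr_minus field_simps powr_mono2)
    then have *: "1 \<le> ennreal (R powr (- lam) * \<bar>x\<bar> powr lam)"
      by simp
    \<comment> \<open>The bound \<open>slice\<close> is the volume hypothesis of the isoperimetric
      inequality in dimension \<open>m\<close>. The factor inserted afterwards is at least 1 beyond
      \<open>R\<close> and brings in the weight.\<close>
    have "marginal B (indicator E) (x *\<^sub>R e) \<le> ennreal \<kappa> * S x"
      unfolding S_def using slice[of x] B \<open>B \<noteq> {}\<close> sub inv
      by (intro marginal_isoperimetric) (auto simp: B_def)
    also have "\<dots> \<le> ennreal \<kappa> * S x * ennreal (R powr (- lam) * \<bar>x\<bar> powr lam)"
      using mult_left_mono[OF *, of "ennreal \<kappa> * S x"] by simp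
    also have "\<dots> = ennreal (\<kappa> * R powr (- lam)) * (ennreal (\<bar>x\<bar> powr lam) * S x)"
      using \<open>\<kappa> \<ge> 0\<close> by (simp add: ennreal_mult ac_simps)
    finally show ?thesis by (simp add: add_increasing)
  qed
  have "emeasure lborel E = marginal (insert e B) (indicator E) 0"
    using B by (simp add: marginal_Basis)
  also have "\<dots> = (\<integral>\<^sup>+x. marginal B (indicator E) (x *\<^sub>R e) \<partial>lborel)"
    using B by (subst marginal_insert_outer) simp_all
  also have "\<dots> \<le> (\<integral>\<^sup>+x. ennreal (\<kappa> ^ m) * indicator {-R..R} x +
      ennreal (\<kappa> * R powr (- lam)) * (ennreal (\<bar>x\<bar> powr lam) * S x) \<partial>lborel)"
    by (intro nn_integral_mono split)
  also have "\<dots> = ennreal (2 * R * \<kappa> ^ m) +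
      ennreal (\<kappa> * R powr (- lam)) * (\<integral>\<^sup>+x. ennreal (\<bar>x\<bar> powr lam) * S x \<partial>lborel)"
    using \<open>R > 0\<close> \<open>\<kappa> \<ge> 0\<close>
    by (simp add: nn_integral_add nn_integral_cmult flip: ennreal_mult)
  also have "(\<integral>\<^sup>+x. ennreal (\<bar>x\<bar> powr lam) * S x \<partial>lborel) =
      (\<Sum>b\<in>B. \<integral>\<^sup>+x. ennreal (\<bar>x\<bar> powr lam) * marginal (B - {b}) (indicator (F b)) (x *\<^sub>R e) \<partial>lborel)"
    unfolding S_def sum_distrib_left using B by (intro nn_integral_sum) auto
  finally show ?thesis unfolding B_def .
qed

text \<open>Optimisation of the previous inequality over \<open>R\<close>. For \<open>P\<close>
  above the weighted perimeter, \<open>\<kappa> = P powr (1 / m)\<close> is admissible, and both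
  terms become multiples of \<open>P powr (Q / (Q - 1))\<close>.\<close>

lemma weighted_isoperimetric_powr:
  fixes E :: "'a::euclidean_space set" and F :: "'a \<Rightarrow> 'a set" and lam Q :: real
  assumes e: "e \<in> Basis" and dim: "DIM('a) = Suc m" "m \<ge> 1"
    and E [measurable]: "E \<in> sets borel" and F [measurable]: "\<And>b. b \<in> Basis \<Longrightarrow> F b \<in> sets borel"
    and sub: "\<And>b. b \<in> Basis \<Longrightarrow> E \<subseteq> F b"
    and inv: "\<And>b X t. b \<in> Basis \<Longrightarrow> X + t *\<^sub>R b \<in> F b \<longleftrightarrow> X \<in> F b"
    and lam: "lam \<ge> 0" and Q: "Q = real m + 1 + lam * real m" and fin: "emeasure lborel E < \<infinity>"
  shows "ennreal (measure lborel E powr ((Q - 1) / Q)) \<le> 3 *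
    (marginal (Basis - {e}) (indicator (F e)) 0 +
     (\<Sum>b\<in>Basis - {e}. \<integral>\<^sup>+x. ennreal (\<bar>x\<bar> powr lam) *
        marginal (Basis - {e} - {b}) (indicator (F b)) (x *\<^sub>R e) \<partial>lborel))" (is "_ \<le> 3 * (?p + ?q)")
proof (cases "?p + ?q = \<infinity>")
  case True
  show ?thesis unfolding True by (simp add: ennreal_mult_top)
next
  case False
  then have "?p \<noteq> top" "?q \<noteq> top"
    by (auto simp only: infinity_ennreal_def ennreal_add_eq_top)
  then obtain p q where pq: "?p = ennreal p" "?q = ennreal q" "p \<ge> 0" "q \<ge> 0"
    by (meson ennreal_cases)
  define M where "M = measure lborel E"
  have M: "emeasure lborel E = ennreal M" "M \<ge> 0"
    using fin by (auto simp: M_def emeasure_eq_ennreal_measure)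
  have Q1: "Q > 1" using lam dim Q by (simp add: add_pos_nonneg)
  \<comment> \<open>The exponent for which \<open>R = P powr \<delta>\<close> balances
    \<open>R * P\<close> against \<open>R powr (- lam) * P powr (1 + 1 / m)\<close>.\<close>
  define \<delta> where "\<delta> = 1 / (real m * (1 + lam))"
  have Qd: "Q / (Q - 1) = 1 + \<delta>" "Q - 1 = real m * (1 + lam)"
    using Q1 Q lam dim by (auto simp: \<delta>_def field_simps)
  \<comment> \<open>The strict inequality keeps \<open>P\<close> positive even when the perimeter
    vanishes, so that all powers of \<open>P\<close> may be combined; the excess is removed at the
    end by letting it tend to zero.\<close>
  have main: "M powr ((Q - 1) / Q) \<le> 3 * P" if "P > p + q" for P
  proof -
    have P: "P > 0" using that pq by simp
    define \<kappa> R where "\<kappa> = P powr (1 / m)" and "R = P powr \<delta>"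
    have pos: "\<kappa> > 0" "R > 0" and km: "\<kappa> ^ m = P"
      using P dim by (auto simp: \<kappa>_def R_def powr_powr simp flip: powr_realpow)
    have "ennreal M \<le> ennreal (2 * R * \<kappa> ^ m) + ennreal (\<kappa> * R powr (- lam)) * ?q"
      unfolding M(1)[symmetric]
    proof (rule weighted_isoperimetric[OF e dim E F sub inv lam])
      show "marginal (Basis - {e}) (indicator (F e)) 0 \<le> ennreal \<kappa> ^ m"
        using that pq pos km by (simp add: ennreal_power)
    qed (use pos in auto)
    also have "\<dots> = ennreal (2 * R * P + \<kappa> * R powr (- lam) * q)"
      using pos pq P by (simp add: km ennreal_mult ennreal_plus)
    finally have "M \<le> 2 * R * P + \<kappa> * R powr (- lam) * q"
      using pos pq P by (subst (asm) ennreal_le_iff) auto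
    also have "\<dots> \<le> 2 * R * P + \<kappa> * R powr (- lam) * P"
      using that pq pos by (intro add_left_mono mult_left_mono) auto
    also have "\<kappa> * R powr (- lam) = P powr (1 / m - lam * \<delta>)"
      using P by (simp add: \<kappa>_def R_def powr_powr powr_add[symmetric]) (simp add: mult.commute)
    also have "1 / m - lam * \<delta> = \<delta>"
    proof -
      have "1 / real m = (1 + lam) * \<delta>"
        using lam dim by (simp add: \<delta>_def)
      then show ?thesis by (simp add: distrib_right)
    qed
    finally have "M \<le> 3 * (P powr \<delta> * P powr 1)" using P by (simp add: R_def mult_ac)
    also have "P powr \<delta> * P powr 1 = P powr (Q / (Q - 1))"
      unfolding Qd(1) by (simp add: powr_add mult_ac)
    finally have "M powr ((Q - 1) / Q) \<le> (3 * P powr (Q / (Q - 1))) powr ((Q - 1) / Q)"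
      using M Q1 by (intro powr_mono2) auto
    also have "\<dots> = 3 powr ((Q - 1) / Q) * P"
      using Q1 P by (simp add: powr_mult powr_powr)
    also have "\<dots> \<le> 3 powr 1 * P"
      using Q1 P by (intro mult_right_mono powr_mono) auto
    finally show ?thesis by simp
  qed
  have "M powr ((Q - 1) / Q) \<le> 3 * (p + q)"
  proof (rule field_le_epsilon)
    fix \<epsilon> :: real assume "\<epsilon> > 0"
    then show "M powr ((Q - 1) / Q) \<le> 3 * (p + q) + \<epsilon>"
      using main[of "p + q + \<epsilon> / 3"] by (simp add: algebra_simps)
  qed
  then have "ennreal (M powr ((Q - 1) / Q)) \<le> ennreal (3 * (p + q))"
    by (rule ennreal_leI)
  also have "\<dots> = 3 * (?p + ?q)"
    using pq by (simp add: ennreal_mult ennreal_plus)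
  finally show ?thesis unfolding M_def .
qed

section \<open>The Sobolev inequality\<close>

lemma borel_measurable_marginal_pair:
  fixes f :: "real \<Rightarrow> 'a::euclidean_space \<Rightarrow> ennreal"
  assumes [measurable]: "(\<lambda>z. f (fst z) (snd z)) \<in> borel_measurable (borel \<Otimes>\<^sub>M borel)" and "finite B"
  shows "(\<lambda>z. marginal B (f (fst z)) (snd z)) \<in> borel_measurable (borel \<Otimes>\<^sub>M borel)"
proof -
  interpret product_sigma_finite "\<lambda>_::'a. lborel :: real measure"
    by (rule product_sigma_finite_lborel)
  interpret sigma_finite_measure "Pi\<^sub>M B (\<lambda>_::'a. lborel :: real measure)"
    using \<open>finite B\<close> by (rule sigma_finite)
  have "(\<lambda>(z, y). f (fst z) (snd z + (\<Sum>b\<in>B. y b *\<^sub>R b)))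
      \<in> borel_measurable ((borel \<Otimes>\<^sub>M borel) \<Otimes>\<^sub>M Pi\<^sub>M B (\<lambda>_. lborel))"
    unfolding case_prod_beta'
    by (rule measurable_compose[OF _ assms(1), where f="\<lambda>x. (fst (fst x), snd (fst x) + (\<Sum>b\<in>B. snd x b *\<^sub>R b))", simplified])
       measurable
  then show ?thesis
    unfolding marginal_def by measurable
qed

text \<open>Tonelli's theorem; the additional parameter will be the level \<open>t\<close> of a
  superlevel set.\<close>

lemma nn_integral_marginal:
  fixes f :: "real \<Rightarrow> 'a::euclidean_space \<Rightarrow> ennreal"
  assumes [measurable]: "(\<lambda>z. f (fst z) (snd z)) \<in> borel_measurable (borel \<Otimes>\<^sub>M borel)" and "finite B"
  shows "(\<integral>\<^sup>+t. marginal B (f t) X \<partial>lborel) = marginal B (\<lambda>Y. \<integral>\<^sup>+t. f t Y \<partial>lborel) X"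
proof -
  interpret product_sigma_finite "\<lambda>_::'a. lborel :: real measure"
    by (rule product_sigma_finite_lborel)
  interpret I: sigma_finite_measure "Pi\<^sub>M B (\<lambda>_::'a. lborel :: real measure)"
    using \<open>finite B\<close> by (rule sigma_finite)
  interpret pair_sigma_finite "Pi\<^sub>M B (\<lambda>_::'a. lborel :: real measure)" "lborel :: real measure" ..
  have "(\<lambda>(y, t). f t (X + (\<Sum>b\<in>B. y b *\<^sub>R b)))
      \<in> borel_measurable (Pi\<^sub>M B (\<lambda>_. lborel) \<Otimes>\<^sub>M lborel)"
    unfolding case_prod_beta'
    by (rule measurable_compose[OF _ assms(1), where f="\<lambda>x. (snd x, X + (\<Sum>b\<in>B. fst x b *\<^sub>R b))", simplified])
       measurable
  then show ?thesis
    unfolding marginal_def by (rule Fubini')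
qed

text \<open>The planes spanned by \<open>B\<close> are orthogonal to \<open>e\<close>, so a weight
  depending only on the coordinate along \<open>e\<close> is constant on them.\<close>

lemma marginal_weight:
  fixes f :: "'a::euclidean_space \<Rightarrow> ennreal"
  assumes [measurable]: "f \<in> borel_measurable borel" and B: "B \<subseteq> Basis - {e}" and e: "e \<in> Basis"
  shows "marginal B (\<lambda>Y. g (Y \<bullet> e) * f Y) (x *\<^sub>R e) = g x * marginal B f (x *\<^sub>R e)"
proof -
  have "(\<Sum>b\<in>B. y b *\<^sub>R b) \<bullet> e = 0" for y
    unfolding inner_sum_left using B e by (intro sum.neutral) (auto simp: inner_not_same_Basis subset_iff)
  then have "(x *\<^sub>R e + (\<Sum>b\<in>B. y b *\<^sub>R b)) \<bullet> e = x" for y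
    using e by (simp add: inner_add_left)
  then show ?thesis
    unfolding marginal_def by (simp add: nn_integral_cmult)
qed

text \<open>Layer cake formula at a single point: the nonnegative levels below \<open>H\<close> form
  an interval of length \<open>H\<close>, possibly infinite.\<close>

lemma nn_integral_indicator_less_le:
  "(\<integral>\<^sup>+t. indicator {0..} t * indicator {t. ennreal t < H} t \<partial>lborel) \<le> H"
proof (cases H)
  case (real r)
  have "(\<integral>\<^sup>+t. indicator {0..} t * indicator {t. ennreal t < H} t \<partial>lborel) = (\<integral>\<^sup>+t. indicator {0..<r} t \<partial>lborel)"
    using real by (intro nn_integral_cong) (auto split: split_indicator simp: ennreal_less_iff)
  then show ?thesis using real by simp
qed simp

text \<open>The superlevel sets \<open>E t\<close> of \<open>w\<close> project into the superlevel sets of the integrals of the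
  \<open>h b\<close>, whose measures integrate in \<open>t\<close> to the right-hand side.\<close>

lemma weighted_Sobolev_L1_superlevel:
  fixes w :: "'a::euclidean_space \<Rightarrow> real" and h :: "'a \<Rightarrow> 'a \<Rightarrow> ennreal" and lam Q :: real
  assumes e: "e \<in> Basis" and dim: "DIM('a) = Suc m" "m \<ge> 1"
    and lam: "lam \<ge> 0" and Q: "Q = real m + 1 + lam * real m"
    and [measurable]: "w \<in> borel_measurable borel"
    and h: "\<And>b. b \<in> Basis \<Longrightarrow> h b \<in> borel_measurable borel"
    and le: "\<And>b X. b \<in> Basis \<Longrightarrow> ennreal (w X) \<le> (\<integral>\<^sup>+t. h b (X + t *\<^sub>R b) \<partial>lborel)"
    and fin: "emeasure lborel {X. w X > 0} < \<infinity>"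
  shows "(\<integral>\<^sup>+t. ennreal (measure lborel {X. w X > t} powr ((Q - 1) / Q)) * indicator {0..} t \<partial>lborel) \<le>
    3 * ((\<integral>\<^sup>+X. h e X \<partial>lborel) + (\<Sum>b\<in>Basis - {e}. \<integral>\<^sup>+X. ennreal (\<bar>X \<bullet> e\<bar> powr lam) * h b X \<partial>lborel))"
proof -
  define B where "B = Basis - {e}"
  have B: "finite B" "e \<notin> B" "insert e B = Basis" "card B = m"
    using e dim by (auto simp: B_def)
  have hB [measurable]: "\<And>b. b \<in> B \<Longrightarrow> h b \<in> borel_measurable borel" "h e \<in> borel_measurable borel"
    using e h by (auto simp: B_def)
  define H where "H b X = (\<integral>\<^sup>+t. h b (X + t *\<^sub>R b) \<partial>lborel)" for b X
  have Hm [measurable]: "H b \<in> borel_measurable borel" if "b \<in> Basis" for b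
    using h[OF that] unfolding H_def by measurable
  \<comment> \<open>An integral over a whole line does not depend on the base point of the line.
    Hence the superlevel sets \<open>F t b\<close> of \<open>H b\<close> are cylinders along
    \<open>b\<close>.\<close>
  have Hinv: "H b (X + s *\<^sub>R b) = H b X" if "b \<in> Basis" for b X s
  proof -
    note h[OF that, measurable]
    have "H b X = (\<integral>\<^sup>+t. h b (X + (s + 1 * t) *\<^sub>R b) \<partial>lborel)"
      unfolding H_def using nn_integral_real_affine[of "\<lambda>t. h b (X + t *\<^sub>R b)" 1 s] by simp
    then show ?thesis by (simp add: H_def algebra_simps)
  qed
  define F where "F t b = {X. ennreal t < H b X}" for t b
  have Fm [measurable]: "F t b \<in> sets borel" if "b \<in> Basis" for t b
    using Hm[OF that] unfolding F_def by measurable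
  have ind_F: "(\<lambda>z. indicator {0..} (fst z) * indicator (F (fst z) b) (snd z) :: ennreal)
      \<in> borel_measurable (borel \<Otimes>\<^sub>M borel)" if "b \<in> Basis" for b
    using Hm[OF that] unfolding F_def indicator_def by measurable
  have ind_F_le: "(\<integral>\<^sup>+t. indicator {0..} t * indicator (F t b) Y \<partial>lborel) \<le> H b Y" for b Y
    using nn_integral_indicator_less_le[of "H b Y"] by (simp add: F_def indicator_def)
  \<comment> \<open>\<open>p\<close> and \<open>q b\<close> are the projection terms of the
    isoperimetric inequality at level \<open>t\<close>. The factor \<open>indicator {0..} t\<close>
    sits inside the marginal so that the integration over \<open>t\<close> can be carried out
    there.\<close>
  define p where "p t = marginal B (\<lambda>Y. indicator {0..} t * indicator (F t e) Y) 0" for t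
  define q where "q b t x = ennreal (\<bar>x\<bar> powr lam) *
    marginal (B - {b}) (\<lambda>Y. indicator {0..} t * indicator (F t b) Y) (x *\<^sub>R e)" for b t x
  have pm [measurable]: "p \<in> borel_measurable borel"
    unfolding p_def using measurable_compose[OF _ borel_measurable_marginal_pair[OF ind_F[OF e] B(1)], of "\<lambda>t. (t, 0)" borel]
    by simp
  have qm [measurable]: "(\<lambda>(t, x). q b t x) \<in> borel_measurable (borel \<Otimes>\<^sub>M borel)" if "b \<in> B" for b
  proof -
    have "(\<lambda>z. marginal (B - {b}) (\<lambda>Y. indicator {0..} (fst z) * indicator (F (fst z) b) Y) (snd z *\<^sub>R e))
      \<in> borel_measurable (borel \<Otimes>\<^sub>M borel)"
      using that B measurable_compose[OF _ borel_measurable_marginal_pair[OF ind_F[of b], of "B - {b}"],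
          of "\<lambda>z. (fst z, snd z *\<^sub>R e)" "borel \<Otimes>\<^sub>M borel"] by (simp add: B_def)
    then show ?thesis
      unfolding q_def case_prod_beta' by measurable
  qed
  have "(\<integral>\<^sup>+t. ennreal (measure lborel {X. w X > t} powr ((Q - 1) / Q)) * indicator {0..} t \<partial>lborel) \<le>
      (\<integral>\<^sup>+t. 3 * (p t + (\<Sum>b\<in>B. \<integral>\<^sup>+x. q b t x \<partial>lborel)) \<partial>lborel)"
  proof (rule nn_integral_mono)
    fix t :: real
    show "ennreal (measure lborel {X. w X > t} powr ((Q - 1) / Q)) * indicator {0..} t \<le>
      3 * (p t + (\<Sum>b\<in>B. \<integral>\<^sup>+x. q b t x \<partial>lborel))"
    proof (cases "t \<ge> 0")
      case True
      have "emeasure lborel {X. w X > t} \<le> emeasure lborel {X. w X > 0}"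
        using True by (intro emeasure_mono) auto
      then have "emeasure lborel {X. w X > t} < \<infinity>" using fin by simp
      moreover have "{X. w X > t} \<subseteq> F t b" if "b \<in> Basis" for b
      proof
        fix X assume "X \<in> {X. w X > t}"
        then have "ennreal t < ennreal (w X)"
          using True by (simp add: ennreal_less_iff)
        also have "\<dots> \<le> H b X"
          unfolding H_def by (rule le[OF that])
        finally show "X \<in> F t b" by (simp add: F_def)
      qed
      moreover have "X + s *\<^sub>R b \<in> F t b \<longleftrightarrow> X \<in> F t b" if "b \<in> Basis" for b X s
        using Hinv[OF that] by (simp add: F_def)
      ultimately have "ennreal (measure lborel {X. w X > t} powr ((Q - 1) / Q)) \<le> 3 *
        (marginal (Basis - {e}) (indicator (F t e)) 0 +
         (\<Sum>b\<in>Basis - {e}. \<integral>\<^sup>+x. ennreal (\<bar>x\<bar> powr lam) *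
            marginal (Basis - {e} - {b}) (indicator (F t b)) (x *\<^sub>R e) \<partial>lborel))"
        by (intro weighted_isoperimetric_powr[OF e dim _ _ _ _ lam Q]) auto
      then show ?thesis
        using True by (simp add: p_def q_def B_def)
    qed simp
  qed
  also have "\<dots> = 3 * ((\<integral>\<^sup>+t. p t \<partial>lborel) + (\<Sum>b\<in>B. \<integral>\<^sup>+t. \<integral>\<^sup>+x. q b t x \<partial>lborel \<partial>lborel))"
    using B qm by (simp add: nn_integral_cmult nn_integral_add nn_integral_sum)
  also have "\<dots> \<le> 3 * ((\<integral>\<^sup>+X. h e X \<partial>lborel) + (\<Sum>b\<in>B. \<integral>\<^sup>+X. ennreal (\<bar>X \<bullet> e\<bar> powr lam) * h b X \<partial>lborel))"
  proof (intro mult_left_mono add_mono sum_mono)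
    \<comment> \<open>Integrating the indicators over the levels leaves at most \<open>H e\<close>,
      which is already an integral along \<open>e\<close>; together with the marginal over the other
      directions this is the full integral of \<open>h e\<close>.\<close>
    have "(\<integral>\<^sup>+t. p t \<partial>lborel) = marginal B (\<lambda>Y. \<integral>\<^sup>+t. indicator {0..} t * indicator (F t e) Y \<partial>lborel) 0"
      unfolding p_def by (rule nn_integral_marginal[OF ind_F[OF e] B(1)])
    also have "\<dots> \<le> marginal B (H e) 0"
      by (intro marginal_mono ind_F_le)
    also have "\<dots> = marginal (insert e B) (h e) 0"
      unfolding H_def using B by (intro marginal_insert_inner[symmetric]) auto
    also have "\<dots> = (\<integral>\<^sup>+X. h e X \<partial>lborel)"
      unfolding B by (rule marginal_Basis) simp
    finally show "(\<integral>\<^sup>+t. p t \<partial>lborel) \<le> (\<integral>\<^sup>+X. h e X \<partial>lborel)" .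
  next
    fix b assume b: "b \<in> B"
    then have bB: "b \<in> Basis" "finite (B - {b})" "insert b (B - {b}) = B" "b \<notin> B - {b}"
      using B by (auto simp: B_def)
    note hB(1)[OF b, measurable]
    \<comment> \<open>The same argument in a direction \<open>b\<close> different from
      \<open>e\<close>: the variable \<open>x\<close> is moved outside, the levels and the direction
      \<open>b\<close> are integrated at fixed \<open>x\<close>, and the weight is then pulled into
      the full integral.\<close>
    have "(\<integral>\<^sup>+t. \<integral>\<^sup>+x. q b t x \<partial>lborel \<partial>lborel) = (\<integral>\<^sup>+x. \<integral>\<^sup>+t. q b t x \<partial>lborel \<partial>lborel)"
      using qm[OF b] by (intro lborel_pair.Fubini'[symmetric]) (auto simp: case_prod_beta' measurable_split_conv)
    also have "\<dots> = (\<integral>\<^sup>+x. ennreal (\<bar>x\<bar> powr lam) *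
        (\<integral>\<^sup>+t. marginal (B - {b}) (\<lambda>Y. indicator {0..} t * indicator (F t b) Y) (x *\<^sub>R e) \<partial>lborel) \<partial>lborel)"
    proof (intro nn_integral_cong)
      fix x
      have "(\<lambda>t. marginal (B - {b}) (\<lambda>Y. indicator {0..} t * indicator (F t b) Y) (x *\<^sub>R e)) \<in> borel_measurable borel"
        using measurable_compose[OF _ borel_measurable_marginal_pair[OF ind_F[OF bB(1)] bB(2)], of "\<lambda>t. (t, x *\<^sub>R e)" borel]
        by simp
      then show "(\<integral>\<^sup>+t. q b t x \<partial>lborel) = ennreal (\<bar>x\<bar> powr lam) *
          (\<integral>\<^sup>+t. marginal (B - {b}) (\<lambda>Y. indicator {0..} t * indicator (F t b) Y) (x *\<^sub>R e) \<partial>lborel)"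
        unfolding q_def by (intro nn_integral_cmult) simp
    qed
    also have "\<dots> \<le> (\<integral>\<^sup>+x. ennreal (\<bar>x\<bar> powr lam) * marginal (B - {b}) (H b) (x *\<^sub>R e) \<partial>lborel)"
      unfolding nn_integral_marginal[OF ind_F[OF bB(1)] bB(2)]
      by (intro nn_integral_mono mult_left_mono marginal_mono ind_F_le) auto
    also have "\<dots> = (\<integral>\<^sup>+x. ennreal (\<bar>x\<bar> powr lam) * marginal B (h b) (x *\<^sub>R e) \<partial>lborel)"
      unfolding H_def using marginal_insert_inner[of "h b" "B - {b}" b] bB h[OF bB(1)] by simp
    also have "\<dots> = (\<integral>\<^sup>+x. marginal B (\<lambda>Y. ennreal (\<bar>Y \<bullet> e\<bar> powr lam) * h b Y) (x *\<^sub>R e) \<partial>lborel)"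
      using e by (intro nn_integral_cong marginal_weight[symmetric]) (auto simp: B_def h bB(1))
    also have "\<dots> = marginal (insert e B) (\<lambda>Y. ennreal (\<bar>Y \<bullet> e\<bar> powr lam) * h b Y) 0"
      using B by (subst marginal_insert_outer) simp_all
    also have "\<dots> = (\<integral>\<^sup>+X. ennreal (\<bar>X \<bullet> e\<bar> powr lam) * h b X \<partial>lborel)"
      unfolding B by (rule marginal_Basis) simp
    finally show "(\<integral>\<^sup>+t. \<integral>\<^sup>+x. q b t x \<partial>lborel \<partial>lborel) \<le> (\<integral>\<^sup>+X. ennreal (\<bar>X \<bullet> e\<bar> powr lam) * h b X \<partial>lborel)" .
  qed simp
  finally show ?thesis unfolding B_def .
qed

text \<open>With \<open>q = Q / (Q - 1)\<close> the integral of \<open>w powr q\<close> is that of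
  \<open>q * t powr (q - 1) * M t\<close> over the levels. The function
  \<open>a = M powr (1 / q)\<close> is nonincreasing with integral at most \<open>3 * D\<close>,
  which gives a pointwise bound on \<open>t * a t\<close> and reduces the integrand to a multiple of
  \<open>a\<close>.\<close>

lemma weighted_Sobolev_L1:
  fixes w :: "'a::euclidean_space \<Rightarrow> real" and h :: "'a \<Rightarrow> 'a \<Rightarrow> ennreal" and lam Q D :: real
  assumes e: "e \<in> Basis" and dim: "DIM('a) = Suc m" "m \<ge> 1"
    and lam: "lam \<ge> 0" and Q: "Q = real m + 1 + lam * real m"
    and w [measurable]: "w \<in> borel_measurable borel" and w0: "\<And>X. w X \<ge> 0"
    and h: "\<And>b. b \<in> Basis \<Longrightarrow> h b \<in> borel_measurable borel"
    and le: "\<And>b X. b \<in> Basis \<Longrightarrow> ennreal (w X) \<le> (\<integral>\<^sup>+t. h b (X + t *\<^sub>R b) \<partial>lborel)"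
    and fin: "emeasure lborel {X. w X > 0} < \<infinity>"
    and D: "(\<integral>\<^sup>+X. h e X \<partial>lborel) +
      (\<Sum>b\<in>Basis - {e}. \<integral>\<^sup>+X. ennreal (\<bar>X \<bullet> e\<bar> powr lam) * h b X \<partial>lborel) \<le> ennreal D" "D \<ge> 0"
  shows "(\<integral>\<^sup>+X. ennreal (w X powr (Q / (Q - 1))) \<partial>lborel) \<le> ennreal (Q / (Q - 1) * (3 * D) powr (Q / (Q - 1)))"
proof -
  have Q1: "Q > 1" using lam dim Q by (simp add: add_pos_nonneg)
  define q where "q = Q / (Q - 1)"
  have q: "q > 1" using Q1 by (simp add: q_def)
  define M where "M t = measure lborel {X. w X > t}" for t
  define a where "a t = M t powr (1 / q)" for t
  have M: "emeasure lborel {X. w X > t} = ennreal (M t)" if "t \<ge> 0" for t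
  proof -
    have "emeasure lborel {X. w X > t} \<le> emeasure lborel {X. w X > 0}"
      using that by (intro emeasure_mono) auto
    then show ?thesis
      using fin by (auto simp: M_def intro!: emeasure_eq_ennreal_measure)
  qed
  have M0: "M t \<ge> 0" for t by (simp add: M_def)
  have Mmono: "M t \<le> M s" if "0 \<le> s" "s \<le> t" for s t
  proof -
    have "emeasure lborel {X. w X > t} \<le> emeasure lborel {X. w X > s}"
      using that by (intro emeasure_mono) auto
    then show ?thesis using that M0 by (simp add: M)
  qed
  have int_a: "(\<integral>\<^sup>+t. ennreal (a t) * indicator {0..} t \<partial>lborel) \<le> ennreal (3 * D)"
  proof -
    have "(\<integral>\<^sup>+t. ennreal (a t) * indicator {0..} t \<partial>lborel) \<le> 3 * ennreal D"
      using order_trans[OF weighted_Sobolev_L1_superlevel[OF e dim lam Q w h le fin] mult_left_mono[OF D(1), of 3]]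
      by (simp add: a_def q_def M_def)
    also have "\<dots> = ennreal (3 * D)" using D by (simp add: ennreal_mult)
    finally show ?thesis .
  qed
  \<comment> \<open>By monotonicity \<open>t * a t\<close> is at most the integral of
    \<open>a\<close> over \<open>{0..t}\<close>.\<close>
  have ta: "t * a t \<le> 3 * D" if "t \<ge> 0" for t
  proof -
    have "ennreal (t * a t) = (\<integral>\<^sup>+s. ennreal (a t) * indicator {0..t} s \<partial>lborel)"
      using that by (simp add: nn_integral_cmult_indicator a_def mult.commute[of t] flip: ennreal_mult)
    also have "\<dots> \<le> (\<integral>\<^sup>+t. ennreal (a t) * indicator {0..} t \<partial>lborel)"
      using q M0 Mmono by (intro nn_integral_mono) (auto simp: a_def split: split_indicator intro!: powr_mono2 ennreal_leI)
    also note int_a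
    finally show ?thesis using D by simp
  qed
  have bound: "q * t powr (q - 1) * M t \<le> q * (3 * D) powr (q - 1) * a t" if "t \<ge> 0" for t
  proof -
    \<comment> \<open>Writing \<open>M t\<close> as \<open>a t powr q\<close> collects
      \<open>q - 1\<close> of its factors with those of \<open>t\<close>; the single remaining
      factor \<open>a t\<close> is integrable.\<close>
    have "t powr (q - 1) * M t = t powr (q - 1) * (a t powr (q - 1) * a t powr 1)"
      using q M0[of t] by (simp add: a_def powr_powr powr_add[symmetric] del: powr_one')
        (simp add: divide_simps powr_add[symmetric])
    also have "\<dots> = (t * a t) powr (q - 1) * a t"
      using that by (simp add: powr_mult a_def)
    also have "\<dots> \<le> (3 * D) powr (q - 1) * a t"
      using ta[OF that] that q by (intro mult_right_mono powr_mono2) (auto simp: a_def)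
    finally show ?thesis using q by (simp add: mult.assoc)
  qed
  have layer: "ennreal (w X powr q) = (\<integral>\<^sup>+t. ennreal (q * t powr (q - 1)) * indicator {0..} t * indicator {X. w X > t} X \<partial>lborel)" for X
  proof -
    have "(\<integral>\<^sup>+t. ennreal (q * t powr (q - 1)) * indicator {0..w X} t \<partial>lborel) = ennreal (w X powr q - 0 powr q)"
    proof (rule nn_integral_has_integral_lebesgue'[OF _ fundamental_theorem_of_calculus])
      fix t assume "t \<in> {0..w X}"
      then have "0 \<le> t" by simp
      have "((\<lambda>t. t powr q) has_real_derivative q * t powr (q - 1)) (at t within {0..w X})"
      proof (cases "t = 0")
        case False
        then show ?thesis
          using \<open>0 \<le> t\<close> by (auto intro!: derivative_eq_intros)
      next
        case True
        \<comment> \<open>At the endpoint 0 the difference quotient is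
          \<open>t powr (q - 1)\<close>, which vanishes in the limit because
          \<open>q > 1\<close>.\<close>
        have "((\<lambda>t. t powr (q - 1)) \<longlongrightarrow> 0) (at 0 within {0..w X})"
          using q by (intro tendsto_eq_intros refl) (auto simp: eventually_at_filter)
        then have "((\<lambda>t. (t powr q - 0 powr q) / (t - 0)) \<longlongrightarrow> 0) (at 0 within {0..w X})"
        proof (rule Lim_transform_eventually)
          show "\<forall>\<^sub>F t in at 0 within {0..w X}. t powr (q - 1) = (t powr q - 0 powr q) / (t - 0)"
            by (auto simp: eventually_at_filter powr_diff)
        qed
        then show ?thesis using True by (simp add: has_field_derivative_iff)
      qed
      then show "((\<lambda>t. t powr q) has_vector_derivative q * t powr (q - 1)) (at t within {0..w X})"
        by (simp only: has_real_derivative_iff_has_vector_derivative)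
    qed (use q w0 in auto)
    also have "(\<integral>\<^sup>+t. ennreal (q * t powr (q - 1)) * indicator {0..w X} t \<partial>lborel) =
        (\<integral>\<^sup>+t. ennreal (q * t powr (q - 1)) * indicator {0..} t * indicator {X. w X > t} X \<partial>lborel)"
    \<comment> \<open>The interval is closed while the superlevel set is strict, so the integrands
      may differ at \<open>t = w X\<close> only.\<close>
    proof (intro nn_integral_cong_AE, use AE_lborel_singleton[of "w X"] in eventually_elim)
      case (elim t)
      then show ?case by (auto split: split_indicator)
    qed
    finally show ?thesis by simp
  qed
  have "(\<integral>\<^sup>+X. ennreal (w X powr q) \<partial>lborel) =
      (\<integral>\<^sup>+t. \<integral>\<^sup>+X. ennreal (q * t powr (q - 1)) * indicator {0..} t * indicator {X. w X > t} X \<partial>lborel \<partial>lborel)"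
    unfolding layer by (rule lborel_pair.Fubini') (unfold indicator_def, measurable)
  also have "\<dots> = (\<integral>\<^sup>+t. ennreal (q * t powr (q - 1) * M t) * indicator {0..} t \<partial>lborel)"
  proof (intro nn_integral_cong)
    fix t :: real
    show "(\<integral>\<^sup>+X. ennreal (q * t powr (q - 1)) * indicator {0..} t * indicator {X. w X > t} X \<partial>lborel) =
      ennreal (q * t powr (q - 1) * M t) * indicator {0..} t"
      using q M0[of t] M[of t] by (cases "t \<ge> 0") (simp_all add: nn_integral_cmult ennreal_mult)
  qed
  also have "\<dots> \<le> (\<integral>\<^sup>+t. ennreal (q * (3 * D) powr (q - 1)) * (ennreal (a t) * indicator {0..} t) \<partial>lborel)"
    using bound q by (intro nn_integral_mono) (auto split: split_indicator simp: a_def simp flip: ennreal_mult intro!: ennreal_leI)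
  also have "\<dots> \<le> ennreal (q * (3 * D) powr (q - 1)) * ennreal (3 * D)"
  proof -
    have [measurable]: "M \<in> borel_measurable borel"
    proof -
      have "(\<lambda>t. enn2real (\<integral>\<^sup>+X. indicator {X. w X > t} X \<partial>lborel)) \<in> borel_measurable borel"
        unfolding indicator_def by measurable
      moreover have "{X. w X > t} \<in> sets lborel" for t
        by measurable
      ultimately show ?thesis
        by (simp add: M_def[abs_def] measure_def)
    qed
    have "(\<integral>\<^sup>+t. ennreal (q * (3 * D) powr (q - 1)) * (ennreal (a t) * indicator {0..} t) \<partial>lborel) =
      ennreal (q * (3 * D) powr (q - 1)) * (\<integral>\<^sup>+t. ennreal (a t) * indicator {0..} t \<partial>lborel)"
      by (rule nn_integral_cmult) (simp add: a_def)
    also have "\<dots> \<le> ennreal (q * (3 * D) powr (q - 1)) * ennreal (3 * D)"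
      by (intro mult_left_mono int_a) simp
    finally show ?thesis .
  qed
  also have "\<dots> = ennreal (q * (3 * D) powr q)"
    using D q by (cases "D = 0") (simp_all add: powr_diff flip: ennreal_mult)
  finally show ?thesis unfolding q_def .
qed

section \<open>The L^2 Sobolev inequality for C^1 functions\<close>

lemma has_real_derivative_abs_powr:
  fixes \<gamma> s :: real
  assumes "\<gamma> > 1"
  shows "((\<lambda>s. \<bar>s\<bar> powr \<gamma>) has_real_derivative \<gamma> * \<bar>s\<bar> powr (\<gamma> - 1) * sgn s) (at s)"
proof -
  consider "s > 0" | "s < 0" | "s = 0" by linarith
  then show ?thesis
  proof cases
    case 1
    have "((\<lambda>s. s powr \<gamma>) has_real_derivative \<gamma> * s powr (\<gamma> - 1)) (at s)"
      using 1 by (auto intro!: derivative_eq_intros)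
    then show ?thesis
      using 1 by (subst DERIV_cong_ev[OF refl _ refl, where g="\<lambda>s. s powr \<gamma>"])
        (auto intro!: eventually_mono[OF eventually_nhds_in_open[of "{0<..}"]])
  next
    case 2
    have "((\<lambda>s. (- s) powr \<gamma>) has_real_derivative - (\<gamma> * (- s) powr (\<gamma> - 1))) (at s)"
      using 2 by (auto intro!: derivative_eq_intros)
    then show ?thesis
      using 2 by (subst DERIV_cong_ev[OF refl _ refl, where g="\<lambda>s. (- s) powr \<gamma>"])
        (auto intro!: eventually_mono[OF eventually_nhds_in_open[of "{..<0}"]])
  next
    case 3
    have "((\<lambda>h. \<bar>h\<bar> powr (\<gamma> - 1)) \<longlongrightarrow> 0) (at 0)"
      using assms by (auto intro!: tendsto_eq_intros)
    then have "((\<lambda>h. \<bar>\<bar>h\<bar> powr \<gamma> / h\<bar>) \<longlongrightarrow> 0) (at 0)"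
    proof (rule Lim_transform_eventually)
      show "\<forall>\<^sub>F h in at 0. \<bar>h\<bar> powr (\<gamma> - 1) = \<bar>\<bar>h\<bar> powr \<gamma> / h\<bar>"
        by (auto simp: eventually_at_filter powr_diff abs_divide)
    qed
    then have "((\<lambda>h. \<bar>h\<bar> powr \<gamma> / h) \<longlongrightarrow> 0) (at 0)"
      by (rule tendsto_rabs_zero_cancel)
    then show ?thesis
      using 3 by (simp add: DERIV_def)
  qed
qed

lemma has_derivative_grad:
  assumes "u differentiable (at X)"
  shows "(u has_derivative (\<lambda>Z. grad u X \<bullet> Z)) (at X)"
proof -
  have *: "(u has_derivative frechet_derivative u (at X)) (at X)"
    using assms by (simp add: frechet_derivative_works)
  then have "frechet_derivative u (at X) Z = grad u X \<bullet> Z" for Z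
    unfolding grad_def inner_sum_left
    by (subst euclidean_representation[of Z, symmetric])
      (simp add: linear_sum[OF has_derivative_linear] linear_cmul[OF has_derivative_linear] inner_commute mult.commute)
  then have "frechet_derivative u (at X) = (\<lambda>Z. grad u X \<bullet> Z)" ..
  then show ?thesis using * by simp
qed

text \<open>Fundamental theorem of calculus for \<open>\<bar>v\<bar> powr \<gamma>\<close> along the
  line through \<open>X\<close> in direction \<open>b\<close>, starting outside the support,
  followed by extension of the integral to the whole line. The condition \<open>\<gamma> > 1\<close>
  makes the power differentiable at zeros of \<open>v\<close>.\<close>

lemma powr_le_nn_integral_derivative:
  fixes v :: "'a::euclidean_space \<Rightarrow> real"
  assumes "C1_on UNIV v" and "bounded {X. v X \<noteq> 0}" and b: "b \<in> Basis" and \<gamma>: "\<gamma> > 1"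
  shows "ennreal (\<bar>v X\<bar> powr \<gamma>) \<le>
    (\<integral>\<^sup>+t. ennreal (\<gamma> * \<bar>v (X + t *\<^sub>R b)\<bar> powr (\<gamma> - 1) * \<bar>grad v (X + t *\<^sub>R b) \<bullet> b\<bar>) \<partial>lborel)"
proof -
  from assms have diff: "\<And>X. v differentiable (at X)" and cont: "continuous_on UNIV (grad v)"
    by (auto simp: C1_on_def)
  then have cv: "continuous_on UNIV v"
    by (auto intro!: continuous_at_imp_continuous_on differentiable_imp_continuous_within)
  obtain r where r: "r > 0" "\<And>X. v X \<noteq> 0 \<Longrightarrow> norm X \<le> r"
    using assms(2) by (auto simp: bounded_pos)
  \<comment> \<open>Long enough that \<open>X - T *\<^sub>R b\<close> leaves the ball of radius
    \<open>r\<close> containing the support.\<close>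
  define T where "T = r + norm X + 1"
  have T: "T > 0" using r by (simp add: T_def add_pos_nonneg)
  have "norm (T *\<^sub>R b) = r + norm X + 1"
    using T b by (simp add: T_def)
  then have "norm (X + (- T) *\<^sub>R b) > r"
    using norm_triangle_ineq2[of "T *\<^sub>R b" X] by (simp add: norm_minus_commute)
  then have v0: "v (X + (- T) *\<^sub>R b) = 0"
    using r(2) by force
  define g where "g t = \<bar>v (X + t *\<^sub>R b)\<bar> powr \<gamma>" for t
  define h where "h t = \<gamma> * \<bar>v (X + t *\<^sub>R b)\<bar> powr (\<gamma> - 1) * \<bar>grad v (X + t *\<^sub>R b) \<bullet> b\<bar>" for t
  define g' where "g' t = \<gamma> * \<bar>v (X + t *\<^sub>R b)\<bar> powr (\<gamma> - 1) * sgn (v (X + t *\<^sub>R b)) * (grad v (X + t *\<^sub>R b) \<bullet> b)" for t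
  have hcont: "continuous_on S h" for S
    unfolding h_def using \<gamma>
    by (intro continuous_intros continuous_on_powr' continuous_on_compose2[OF cv] continuous_on_compose2[OF cont]) auto
  have "((\<lambda>t. v (X + t *\<^sub>R b)) has_real_derivative (grad v (X + t *\<^sub>R b) \<bullet> b)) (at t)" for t
  proof -
    have "((\<lambda>t. X + t *\<^sub>R b) has_derivative (\<lambda>t. t *\<^sub>R b)) (at t)"
      by (auto intro!: derivative_eq_intros)
    from has_derivative_compose[OF this has_derivative_grad[OF diff]] show ?thesis
      unfolding has_field_derivative_def by (rule has_derivative_eq_rhs) (simp add: fun_eq_iff)
  qed
  from DERIV_chain2[OF has_real_derivative_abs_powr[OF \<gamma>] this]
  have "(g has_real_derivative g' t) (at t)" for t
    unfolding g_def g'_def by simp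
  then have "(g' has_integral (g 0 - g (- T))) {-T..0}"
    using T by (intro fundamental_theorem_of_calculus)
      (auto simp: has_real_derivative_iff_has_vector_derivative[symmetric] intro: DERIV_subset)
  moreover have "g (- T) = 0"
    unfolding g_def v0 by simp
  ultimately have g0: "(g' has_integral g 0) {-T..0}" by simp
  have hint: "h integrable_on {-T..0}"
    by (intro integrable_continuous_interval hcont)
  have "norm (g' t) \<le> h t" for t
    using \<gamma> by (auto simp: g'_def h_def abs_mult sgn_if)
  then have "norm (integral {-T..0} g') \<le> integral {-T..0} h"
    using g0 hint by (intro integral_norm_bound_integral) auto
  then have "g 0 \<le> integral {-T..0} h"
    using g0 by (simp add: integral_unique g_def)
  then have "ennreal (g 0) \<le> ennreal (integral {-T..0} h)"
    by (rule ennreal_leI)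
  also have "\<dots> = (\<integral>\<^sup>+t. ennreal (h t) * indicator {-T..0} t \<partial>lborel)"
    using \<gamma> by (intro nn_integral_has_integral_lebesgue'[symmetric, OF _ integrable_integral[OF hint]])
      (simp add: h_def)
  also have "\<dots> \<le> (\<integral>\<^sup>+t. ennreal (h t) \<partial>lborel)"
    by (intro nn_integral_mono) (auto split: split_indicator)
  finally show ?thesis by (simp add: g_def h_def)
qed

lemma grushin_A_inner:
  "grushin_A lam X Z \<bullet> W = grushin_sqrtA lam X Z \<bullet> grushin_sqrtA lam X W"
  unfolding grushin_A_def grushin_sqrtA_def by (simp add: inner_prod_def powr_add[symmetric])

text \<open>Let \<open>q = Q / (Q - 1)\<close>, \<open>\<gamma> = 2 * (Q - 1) / (Q - 2)\<close> and
  \<open>K = q * (3 * ((m + 1) * \<gamma>)) powr q\<close>, the constant of the L^1 inequality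
  applied to a \<open>\<gamma>\<close>-th power. The outer exponent is chosen so that the value
  raised to \<open>Q / (Q - 2)\<close> is \<open>K powr \<gamma>\<close>.\<close>

definition Sobolev_const :: "real \<Rightarrow> real \<Rightarrow> real" where
  "Sobolev_const m Q = (Q / (Q - 1) * (3 * ((m + 1) * (2 * (Q - 1) / (Q - 2)))) powr (Q / (Q - 1))) powr (2 * (Q - 1) / Q)"

lemma Sobolev_const_nonneg: "Sobolev_const m Q \<ge> 0"
  by (simp add: Sobolev_const_def)

text \<open>The L^1 inequality is applied to \<open>\<bar>v\<bar> powr \<gamma>\<close>.
  Cauchy-Schwarz splits its gradient into the energy and the critical integral \<open>j\<close>
  itself, so that \<open>j\<close> is at most a constant times \<open>(j * E) powr (q / 2)\<close>;
  since \<open>q < 2\<close>, the power of \<open>j\<close> can be absorbed on the left.\<close>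

lemma grushin_Sobolev:
  fixes v :: "real \<times> (real ^ 'm) \<Rightarrow> real"
  assumes lam: "lam \<ge> 0" and Q: "Q = (real CARD('m) + 1) + lam * real CARD('m)" "Q > 2"
    and v: "C1_on UNIV v" "bounded {X. v X \<noteq> 0}"
    and E: "(\<integral>\<^sup>+X. ennreal ((norm (grushin_sqrtA lam X (grad v X)))\<^sup>2) \<partial>lborel) \<le> ennreal E" "E \<ge> 0"
  shows "(\<integral>\<^sup>+X. ennreal (\<bar>v X\<bar> powr (2 * Q / (Q - 2))) \<partial>lborel) \<le>
    ennreal ((Sobolev_const (real CARD('m)) Q * E) powr (Q / (Q - 2)))"
proof -
  define m where "m = CARD('m)"
  define e :: "real \<times> (real ^ 'm)" where "e = (1, 0)"
  have e: "e \<in> Basis" "X \<bullet> e = fst X" for X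
    by (auto simp: e_def Basis_prod_def inner_prod_def)
  have dim: "DIM(real \<times> (real ^ 'm)) = Suc m" "m \<ge> 1"
    by (auto simp: m_def Suc_le_eq)
  \<comment> \<open>With this choice both \<open>\<gamma> * q\<close>, from the left-hand side, and
    \<open>2 * (\<gamma> - 1)\<close>, from Cauchy-Schwarz, equal the critical exponent
    \<open>2 * Q / (Q - 2)\<close>.\<close>
  define \<gamma> where "\<gamma> = 2 * (Q - 1) / (Q - 2)"
  define q where "q = Q / (Q - 1)"
  have \<gamma>q: "\<gamma> * q = 2 * Q / (Q - 2)"
    unfolding \<gamma>_def q_def times_divide_times_eq using Q(2)
    by (subst frac_eq_eq) (simp, simp, simp add: algebra_simps)
  have \<gamma>: "\<gamma> > 1" "2 * (\<gamma> - 1) = 2 * Q / (Q - 2)"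
    and q: "q > 1" "q < 2"
    using Q(2) by (auto simp: \<gamma>_def q_def field_simps)
  define N where "N X = norm (grushin_sqrtA lam X (grad v X))" for X
  from v have diff: "\<And>X. v differentiable (at X)" and cont: "continuous_on UNIV (grad v)"
    by (auto simp: C1_on_def)
  then have cv: "continuous_on UNIV v"
    by (auto intro!: continuous_at_imp_continuous_on differentiable_imp_continuous_within)
  have [measurable]: "v \<in> borel_measurable borel" "grad v \<in> borel_measurable borel"
    using cv cont by (auto intro: borel_measurable_continuous_onI)
  have [measurable]: "N \<in> borel_measurable borel"
  proof -
    have [measurable]: "(\<lambda>X. fst (grad v X)) \<in> borel_measurable borel" "(\<lambda>X. snd (grad v X)) \<in> borel_measurable borel"
      "fst \<in> borel_measurable (borel :: (real \<times> (real ^ 'm)) measure)"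
      using cont by (auto intro!: borel_measurable_continuous_onI continuous_intros)
    show ?thesis
      unfolding N_def[abs_def] grushin_sqrtA_def norm_Pair by measurable
  qed
  define J where "J = (\<integral>\<^sup>+X. ennreal (\<bar>v X\<bar> powr (2 * Q / (Q - 2))) \<partial>lborel)"
  have compact: "compact (closure {X. v X \<noteq> 0})"
    using v by (simp add: compact_closure)
  \<comment> \<open>Absorbing a power of \<open>J\<close> requires its finiteness, which follows
    from continuity and compact support.\<close>
  have "J < \<infinity>"
  proof -
    have "compact ((\<lambda>X. \<bar>v X\<bar> powr (2 * Q / (Q - 2))) ` closure {X. v X \<noteq> 0})"
      using Q by (intro compact_continuous_image compact continuous_on_powr' continuous_intros
        continuous_on_subset[OF cv]) auto
    then obtain K where K: "K > 0" "\<And>X. X \<in> closure {X. v X \<noteq> 0} \<Longrightarrow> \<bar>v X\<bar> powr (2 * Q / (Q - 2)) \<le> K"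
      by (auto dest!: compact_imp_bounded simp: bounded_pos)
    have "J \<le> (\<integral>\<^sup>+X. ennreal K * indicator (closure {X. v X \<noteq> 0}) X \<partial>lborel)"
      unfolding J_def using K(2) closure_subset[of "{X. v X \<noteq> 0}"]
      by (intro nn_integral_mono) (force split: split_indicator intro!: ennreal_leI)
    also have "\<dots> < \<infinity>"
      using emeasure_compact_finite[OF compact] by (simp add: nn_integral_cmult_indicator ennreal_mult_less_top)
    finally show ?thesis .
  qed
  then obtain j where j: "J = ennreal j" "j \<ge> 0"
    by (cases J) auto
  define h where "h b X = ennreal (\<gamma> * \<bar>v X\<bar> powr (\<gamma> - 1) * \<bar>grad v X \<bullet> b\<bar>)" for b X
  define I where "I = (\<integral>\<^sup>+X. ennreal (\<bar>v X\<bar> powr (\<gamma> - 1)) * ennreal (N X) \<partial>lborel)"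
  have "I\<^sup>2 \<le> (\<integral>\<^sup>+X. (ennreal (\<bar>v X\<bar> powr (\<gamma> - 1)))\<^sup>2 \<partial>lborel) * (\<integral>\<^sup>+X. (ennreal (N X))\<^sup>2 \<partial>lborel)"
    unfolding I_def by (rule Cauchy_Schwarz_nn_integral) measurable
  also have "(\<integral>\<^sup>+X. (ennreal (\<bar>v X\<bar> powr (\<gamma> - 1)))\<^sup>2 \<partial>lborel) = J"
    unfolding J_def \<gamma>(2)[symmetric] unfolding mult_2 powr_add by (simp add: power2_eq_square ennreal_mult)
  also have "J * (\<integral>\<^sup>+X. (ennreal (N X))\<^sup>2 \<partial>lborel) \<le> ennreal j * ennreal E"
    unfolding j using E(1) by (intro mult_left_mono) (simp_all add: N_def ennreal_power)
  also have "\<dots> = (ennreal (sqrt (j * E)))\<^sup>2"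
    using j E by (simp add: ennreal_power flip: ennreal_mult)
  finally have I2: "I\<^sup>2 \<le> (ennreal (sqrt (j * E)))\<^sup>2" .
  have I: "I \<le> ennreal (sqrt (j * E))"
  proof (cases I)
    case (real i)
    then show ?thesis
      using I2 j E by (simp add: ennreal_power real_le_rsqrt)
  qed (use I2 in \<open>simp add: power2_eq_square ennreal_top_mult top_unique ennreal_mult_eq_top_iff\<close>)
  \<comment> \<open>The function \<open>g\<close> stands for the weight of the direction
    \<open>b\<close>: 1 along \<open>e\<close> and \<open>\<bar>x\<bar>\<^sup>\<lambda>\<close>
    along the others. The weighted derivative is then, in absolute value, that of a component of
    \<open>grushin_sqrtA lam X (grad v X)\<close>.\<close>
  have bound: "ennreal (g X) * h b X \<le> ennreal \<gamma> * (ennreal (\<bar>v X\<bar> powr (\<gamma> - 1)) * ennreal (N X))"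
    if "g X \<ge> 0" "g X * \<bar>grad v X \<bullet> b\<bar> \<le> N X" for g :: "real \<times> (real ^ 'm) \<Rightarrow> real" and b X
  proof -
    have "\<gamma> * \<bar>v X\<bar> powr (\<gamma> - 1) * (g X * \<bar>grad v X \<bullet> b\<bar>) \<le> \<gamma> * \<bar>v X\<bar> powr (\<gamma> - 1) * N X"
      using that \<gamma> by (intro mult_left_mono) auto
    then show ?thesis
      using that \<gamma> by (simp add: h_def mult_ac N_def flip: ennreal_mult)
  qed
  have "h e X \<le> ennreal \<gamma> * (ennreal (\<bar>v X\<bar> powr (\<gamma> - 1)) * ennreal (N X))" for X
  proof -
    have "\<bar>fst (grad v X)\<bar> \<le> N X"
      unfolding N_def grushin_sqrtA_def by (metis norm_fst_le real_norm_def)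
    then show ?thesis using bound[of "\<lambda>_. 1"] e by simp
  qed
  then have "(\<integral>\<^sup>+X. h e X \<partial>lborel) \<le> (\<integral>\<^sup>+X. ennreal \<gamma> * (ennreal (\<bar>v X\<bar> powr (\<gamma> - 1)) * ennreal (N X)) \<partial>lborel)"
    by (rule nn_integral_mono)
  also have int: "\<dots> = ennreal \<gamma> * I"
    unfolding I_def by (intro nn_integral_cmult) measurable
  finally have he: "(\<integral>\<^sup>+X. h e X \<partial>lborel) \<le> ennreal \<gamma> * I" .
  have hb: "(\<integral>\<^sup>+X. ennreal (\<bar>X \<bullet> e\<bar> powr lam) * h b X \<partial>lborel) \<le> ennreal \<gamma> * I" if "b \<in> Basis - {e}" for b
  proof -
    from that have "\<exists>j. b = (0, axis j 1)"
      by (auto simp: Basis_prod_def e_def Basis_vec_def)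
    then obtain j where b: "b = (0, axis j 1)" ..
    have "\<bar>X \<bullet> e\<bar> powr lam * \<bar>grad v X \<bullet> b\<bar> \<le> N X" for X
    proof -
      have "\<bar>fst X\<bar> powr lam * \<bar>snd (grad v X) $ j\<bar> = \<bar>snd (grushin_sqrtA lam X (grad v X)) $ j\<bar>"
        by (simp add: grushin_sqrtA_def abs_mult)
      also have "\<dots> \<le> norm (snd (grushin_sqrtA lam X (grad v X)))"
        by (rule component_le_norm_cart)
      also have "\<dots> \<le> N X"
        unfolding N_def by (metis norm_snd_le prod.collapse)
      finally show ?thesis
        unfolding e(2) by (simp add: b inner_prod_def inner_axis)
    qed
    then have "(\<integral>\<^sup>+X. ennreal (\<bar>X \<bullet> e\<bar> powr lam) * h b X \<partial>lborel) \<le> (\<integral>\<^sup>+X. ennreal \<gamma> * (ennreal (\<bar>v X\<bar> powr (\<gamma> - 1)) * ennreal (N X)) \<partial>lborel)"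
      by (intro nn_integral_mono bound) auto
    then show ?thesis by (simp add: int)
  qed
  define D where "D = (real m + 1) * \<gamma> * sqrt (j * E)"
  have D0: "D \<ge> 0" using \<gamma> j E by (simp add: D_def)
  have D: "(\<integral>\<^sup>+X. h e X \<partial>lborel) + (\<Sum>b\<in>Basis - {e}. \<integral>\<^sup>+X. ennreal (\<bar>X \<bullet> e\<bar> powr lam) * h b X \<partial>lborel) \<le> ennreal D"
  proof -
    have "(\<integral>\<^sup>+X. h e X \<partial>lborel) + (\<Sum>b\<in>Basis - {e}. \<integral>\<^sup>+X. ennreal (\<bar>X \<bullet> e\<bar> powr lam) * h b X \<partial>lborel) \<le>
      ennreal \<gamma> * I + (\<Sum>b\<in>Basis - {e}. ennreal \<gamma> * I)"
      by (intro add_mono he sum_mono hb)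
    also have "\<dots> = ennreal (real m + 1) * (ennreal \<gamma> * I)"
    proof -
      have "card (Basis - {e}) = m" using e dim by simp
      then show ?thesis by (simp add: distrib_right ennreal_of_nat_eq_real_of_nat add.commute)
    qed
    also have "\<dots> \<le> ennreal (real m + 1) * (ennreal \<gamma> * ennreal (sqrt (j * E)))"
      by (intro mult_left_mono I) auto
    also have "\<dots> = ennreal D"
      using \<gamma> j E by (simp add: D_def ennreal_mult mult.assoc)
    finally show ?thesis .
  qed
  have "(\<integral>\<^sup>+X. ennreal ((\<bar>v X\<bar> powr \<gamma>) powr (Q / (Q - 1))) \<partial>lborel) \<le> ennreal (Q / (Q - 1) * (3 * D) powr (Q / (Q - 1)))"
  proof (rule weighted_Sobolev_L1[OF e(1) dim lam])
    show "ennreal (\<bar>v X\<bar> powr \<gamma>) \<le> (\<integral>\<^sup>+t. h b (X + t *\<^sub>R b) \<partial>lborel)" if "b \<in> Basis" for b X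
      unfolding h_def using v that \<gamma>(1) by (rule powr_le_nn_integral_derivative)
    have "emeasure lborel {X. \<bar>v X\<bar> powr \<gamma> > 0} \<le> emeasure lborel (closure {X. v X \<noteq> 0})"
      using closure_subset[of "{X. v X \<noteq> 0}"] by (intro emeasure_mono) (auto simp: subset_eq)
    also have "\<dots> < \<infinity>"
      using emeasure_compact_finite[OF compact] by simp
    finally show "emeasure lborel {X. \<bar>v X\<bar> powr \<gamma> > 0} < \<infinity>" .
    show "(\<integral>\<^sup>+X. h e X \<partial>lborel) + (\<Sum>b\<in>Basis - {e}. \<integral>\<^sup>+X. ennreal (\<bar>X \<bullet> e\<bar> powr lam) * h b X \<partial>lborel) \<le> ennreal D"
      by (rule D)
  qed (use Q D0 in \<open>auto simp: m_def h_def\<close>)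
  then have "ennreal j \<le> ennreal (q * (3 * D) powr q)"
    using \<gamma>q by (simp add: powr_powr flip: q_def j(1) J_def)
  then have jle: "j \<le> q * (3 * D) powr q"
    using q by (subst (asm) ennreal_le_iff) auto
  have "j \<le> (Sobolev_const m Q * E) powr (Q / (Q - 2))"
  proof (cases "j = 0")
    case False
    then have "j > 0" using j by simp
    define K where "K = q * (3 * ((real m + 1) * \<gamma>)) powr q"
    have K: "K \<ge> 0" using q by (simp add: K_def)
    have "(3 * D) powr q = (3 * ((real m + 1) * \<gamma>)) powr q * (j powr (q / 2) * E powr (q / 2))"
    proof -
      define c where "c = 3 * ((real m + 1) * \<gamma>)"
      have "3 * D = c * sqrt (j * E)"
        by (simp add: D_def c_def)
      then show ?thesis
        unfolding c_def[symmetric] using j E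
        by (simp add: powr_mult real_sqrt_mult powr_half_sqrt[symmetric] powr_powr)
    qed
    then have "j \<le> K * (j powr (q / 2) * E powr (q / 2))"
      using jle by (simp add: K_def mult_ac)
    then have "j powr (1 - q / 2) \<le> K * E powr (q / 2)"
      using \<open>j > 0\<close> by (simp add: powr_diff divide_le_eq mult_ac)
    then have "(j powr (1 - q / 2)) powr \<gamma> \<le> (K * E powr (q / 2)) powr \<gamma>"
      using \<gamma> by (intro powr_mono2) auto
    \<comment> \<open>Raising to the power \<open>\<gamma>\<close> isolates \<open>j\<close> on the
      left and produces the exponent of \<open>E\<close> in the claim.\<close>
    moreover have exps: "(1 - q / 2) * \<gamma> = 1" "q / 2 * \<gamma> = Q / (Q - 2)"
      using Q(2) by (auto simp: \<gamma>_def q_def divide_simps)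
    ultimately have "j powr 1 \<le> K powr \<gamma> * E powr (Q / (Q - 2))"
      by (simp only: powr_powr powr_mult powr_ge_zero K exps)
    then have "j \<le> K powr \<gamma> * E powr (Q / (Q - 2))"
      using \<open>j > 0\<close> by simp
    moreover have "Sobolev_const m Q powr (Q / (Q - 2)) = K powr \<gamma>"
      using Q by (simp add: Sobolev_const_def K_def \<gamma>_def q_def powr_powr)
    ultimately show ?thesis
      using E Sobolev_const_nonneg[of m Q] by (simp add: powr_mult)
  qed simp
  then show ?thesis
    using j by (simp add: m_def flip: J_def)
qed

section \<open>Function spaces\<close>

text \<open>Young's inequality integrated after both factors have been divided by their norms. If
  one norm vanishes, the product is zero almost everywhere. Young's inequality without normalisation
  gives integrability.\<close>

lemma Holder_integral:
  fixes f g :: "'a \<Rightarrow> real"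
  assumes pq: "p > 1" "q > 1" "1 / p + 1 / q = 1"
    and [measurable]: "f \<in> borel_measurable M" "g \<in> borel_measurable M"
    and f0: "AE x in M. f x \<ge> 0" and g0: "AE x in M. g x \<ge> 0"
    and fp: "integrable M (\<lambda>x. f x powr p)" and gq: "integrable M (\<lambda>x. g x powr q)"
  shows "integrable M (\<lambda>x. f x * g x)"
    and "(LINT x|M. f x * g x) \<le> (LINT x|M. f x powr p) powr (1 / p) * (LINT x|M. g x powr q) powr (1 / q)"
proof -
  have young: "AE x in M. f x / a * (g x / b) \<le> f x powr p / a powr p / p + g x powr q / b powr q / q"
    if "a > 0" "b > 0" for a b
    using f0 g0
  proof eventually_elim
    case (elim x)
    have "f x / a * (g x / b) \<le> (f x / a) powr p / p + (g x / b) powr q / q"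
      using elim that by (intro Youngs_inequality[OF pq]) auto
    then show ?case
      using elim that by (simp add: powr_divide)
  qed
  show int: "integrable M (\<lambda>x. f x * g x)"
  proof (rule Bochner_Integration.integrable_bound)
    show "integrable M (\<lambda>x. f x powr p / p + g x powr q / q)"
      using fp gq by simp
    have "AE x in M. f x * g x \<le> f x powr p / p + g x powr q / q"
      using young[of 1 1] by simp
    then show "AE x in M. norm (f x * g x) \<le> norm (f x powr p / p + g x powr q / q)"
      using f0 g0
    proof eventually_elim
      case (elim x)
      then have "\<bar>f x * g x\<bar> = f x * g x" by (intro abs_of_nonneg mult_nonneg_nonneg)
      with elim(1) show ?case by simp
    qed
  qed simp
  define A B where "A = (LINT x|M. f x powr p)" and "B = (LINT x|M. g x powr q)"
  have AB: "A \<ge> 0" "B \<ge> 0" by (simp_all add: A_def B_def)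
  have zero: "(LINT x|M. f x * g x) \<le> 0" if "A = 0 \<or> B = 0"
  proof -
    have "(AE x in M. f x powr p = 0) \<or> (AE x in M. g x powr q = 0)"
      using that integral_nonneg_eq_0_iff_AE[OF fp] integral_nonneg_eq_0_iff_AE[OF gq]
      unfolding A_def B_def by simp
    then have "AE x in M. f x * g x = 0"
    proof
      assume "AE x in M. f x powr p = 0"
      then show ?thesis by eventually_elim simp
    next
      assume "AE x in M. g x powr q = 0"
      then show ?thesis by eventually_elim simp
    qed
    then show ?thesis
      using integral_cong_AE[of "\<lambda>x. f x * g x" M "\<lambda>_. 0"] by simp
  qed
  have "(LINT x|M. f x * g x) \<le> A powr (1 / p) * B powr (1 / q)"
  proof (cases "A = 0 \<or> B = 0")
    case True
    then show ?thesis by (auto intro!: order_trans[OF zero] mult_nonneg_nonneg)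
  next
    case False
    define a b where "a = A powr (1 / p)" and "b = B powr (1 / q)"
    have ab: "a > 0" "b > 0" "a powr p = A" "b powr q = B"
      using False AB pq(1,2) by (auto simp: a_def b_def powr_powr)
    have "(LINT x|M. f x * g x) / (a * b) = (LINT x|M. f x / a * (g x / b))"
      by simp
    also have "\<dots> \<le> (LINT x|M. f x powr p / A / p + g x powr q / B / q)"
    proof (rule integral_mono_AE)
      show "integrable M (\<lambda>x. f x / a * (g x / b))"
        using int by simp
      show "AE x in M. f x / a * (g x / b) \<le> f x powr p / A / p + g x powr q / B / q"
        using young[OF ab(1,2)] unfolding ab .
    qed (use fp gq in simp)
    also have "\<dots> = 1 / p + 1 / q"
    proof -
      have "(LINT x|M. f x powr p / A / p + g x powr q / B / q) =
          (LINT x|M. f x powr p) / A / p + (LINT x|M. g x powr q) / B / q"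
        using fp gq by simp
      then show ?thesis
        using False unfolding A_def[symmetric] B_def[symmetric] by simp
    qed
    finally have "(LINT x|M. f x * g x) / (a * b) \<le> 1"
      using pq(3) by simp
    then have "(LINT x|M. f x * g x) \<le> a * b"
      using mult_pos_pos[OF ab(1,2)] by (simp only: divide_le_eq_1_pos)
    then show ?thesis by (simp add: a_def b_def)
  qed
  then show "(LINT x|M. f x * g x) \<le> (LINT x|M. f x powr p) powr (1 / p) * (LINT x|M. g x powr q) powr (1 / q)"
    by (simp add: A_def B_def)
qed

lemma norm_powr_2: "norm x powr 2 = (norm x)\<^sup>2"
  by (simp add: powr_numeral)

lemma Lp_on_2: "Lp_on 2 \<Omega> g \<longleftrightarrow> g \<in> borel_measurable (lebesgue_on \<Omega>) \<and> integrable (lebesgue_on \<Omega>) (\<lambda>X. (norm (g X))\<^sup>2)"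
  by (simp add: Lp_on_def norm_powr_2)

lemma Lp_on_2_diff:
  assumes "Lp_on 2 \<Omega> g" "Lp_on 2 \<Omega> h"
  shows "Lp_on 2 \<Omega> (\<lambda>X. g X - h X)"
proof -
  have ineq: "(norm (a - b))\<^sup>2 \<le> 2 * (norm a)\<^sup>2 + 2 * (norm b)\<^sup>2" for a b :: 'b
  proof -
    have "(norm (a - b))\<^sup>2 \<le> (norm a + norm b)\<^sup>2"
      by (intro power_mono norm_triangle_ineq4) simp
    also have "\<dots> \<le> 2 * (norm a)\<^sup>2 + 2 * (norm b)\<^sup>2"
      using sum_squares_bound[of "norm a" "norm b"] unfolding power2_sum by linarith
    finally show ?thesis .
  qed
  have [measurable]: "g \<in> borel_measurable (lebesgue_on \<Omega>)" "h \<in> borel_measurable (lebesgue_on \<Omega>)"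
    and int: "integrable (lebesgue_on \<Omega>) (\<lambda>X. 2 * (norm (g X))\<^sup>2 + 2 * (norm (h X))\<^sup>2)"
    using assms by (simp_all add: Lp_on_2)
  have "integrable (lebesgue_on \<Omega>) (\<lambda>X. (norm (g X - h X))\<^sup>2)"
  proof (rule Bochner_Integration.integrable_bound[OF int])
    show "AE X in lebesgue_on \<Omega>. norm ((norm (g X - h X))\<^sup>2) \<le> norm (2 * (norm (g X))\<^sup>2 + 2 * (norm (h X))\<^sup>2)"
      using ineq by (intro AE_I2) simp
  qed measurable
  then show ?thesis by (simp add: Lp_on_2)
qed

lemma Lp_on_2_scale:
  assumes "Lp_on 2 \<Omega> g" "c \<in> borel_measurable (lebesgue_on \<Omega>)" "\<And>X. \<bar>c X\<bar> \<le> L"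
  shows "Lp_on 2 \<Omega> (\<lambda>X. c X *\<^sub>R g X)"
proof -
  have ineq: "(norm (c X *\<^sub>R g X))\<^sup>2 \<le> L\<^sup>2 * (norm (g X))\<^sup>2" for X
  proof -
    have "(c X)\<^sup>2 \<le> L\<^sup>2"
      using assms(3)[of X] by (intro abs_le_square_iff[THEN iffD1]) simp
    then show ?thesis
      by (simp add: power_mult_distrib mult_right_mono)
  qed
  have [measurable]: "g \<in> borel_measurable (lebesgue_on \<Omega>)" "c \<in> borel_measurable (lebesgue_on \<Omega>)"
    and int: "integrable (lebesgue_on \<Omega>) (\<lambda>X. L\<^sup>2 * (norm (g X))\<^sup>2)"
    using assms by (simp_all add: Lp_on_2)
  have "integrable (lebesgue_on \<Omega>) (\<lambda>X. (norm (c X *\<^sub>R g X))\<^sup>2)"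
  proof (rule Bochner_Integration.integrable_bound[OF int])
    show "AE X in lebesgue_on \<Omega>. norm ((norm (c X *\<^sub>R g X))\<^sup>2) \<le> norm (L\<^sup>2 * (norm (g X))\<^sup>2)"
      using ineq by (intro AE_I2) (simp del: norm_scaleR)
  qed measurable
  then show ?thesis by (simp add: Lp_on_2)
qed

lemma
  assumes "Lp_on 2 \<Omega> g" "Lp_on 2 \<Omega> h"
  shows integrable_norm_mult_norm: "integrable (lebesgue_on \<Omega>) (\<lambda>X. norm (g X) * norm (h X))"
    and Cauchy_Schwarz_L2: "(LINT X|lebesgue_on \<Omega>. norm (g X) * norm (h X)) \<le>
      sqrt (LINT X|lebesgue_on \<Omega>. (norm (g X))\<^sup>2) * sqrt (LINT X|lebesgue_on \<Omega>. (norm (h X))\<^sup>2)"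
proof -
  have [measurable]: "g \<in> borel_measurable (lebesgue_on \<Omega>)" "h \<in> borel_measurable (lebesgue_on \<Omega>)"
    and int: "integrable (lebesgue_on \<Omega>) (\<lambda>X. norm (g X) powr 2)" "integrable (lebesgue_on \<Omega>) (\<lambda>X. norm (h X) powr 2)"
    using assms by (simp_all add: Lp_on_def)
  have g: "(\<lambda>X. norm (g X)) \<in> borel_measurable (lebesgue_on \<Omega>)"
    and h: "(\<lambda>X. norm (h X)) \<in> borel_measurable (lebesgue_on \<Omega>)"
    by measurable
  note * = Holder_integral[OF _ _ _ g h _ _ int, simplified]
  show "integrable (lebesgue_on \<Omega>) (\<lambda>X. norm (g X) * norm (h X))"
    by (rule *(1))
  show "(LINT X|lebesgue_on \<Omega>. norm (g X) * norm (h X)) \<le>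
      sqrt (LINT X|lebesgue_on \<Omega>. (norm (g X))\<^sup>2) * sqrt (LINT X|lebesgue_on \<Omega>. (norm (h X))\<^sup>2)"
    using *(2) by (simp add: norm_powr_2 powr_half_sqrt)
qed

text \<open>The squared distances converge to zero in L^1, hence almost everywhere along a
  subsequence.\<close>

lemma L2_lim_on_AE_subseq:
  assumes "L2_lim_on \<Omega> gs g"
  obtains s where "strict_mono s" "AE X in lebesgue_on \<Omega>. (\<lambda>n. gs (s n) X) \<longlonglongrightarrow> g X"
proof -
  have int: "integrable (lebesgue_on \<Omega>) (\<lambda>X. (norm (gs n X - g X))\<^sup>2)" for n
    using assms Lp_on_2_diff[of \<Omega> "gs n" g] by (auto simp: L2_lim_on_def Lp_on_2)
  have lim: "(\<lambda>n. LINT X|lebesgue_on \<Omega>. norm ((norm (gs n X - g X))\<^sup>2)) \<longlonglongrightarrow> 0"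
    using assms by (simp add: L2_lim_on_def)
  from tendsto_L1_AE_subseq[OF int lim]
  obtain s where s: "strict_mono s" "AE X in lebesgue_on \<Omega>. (\<lambda>n. (norm (gs (s n) X - g X))\<^sup>2) \<longlonglongrightarrow> 0"
    by blast
  have "AE X in lebesgue_on \<Omega>. (\<lambda>n. gs (s n) X) \<longlonglongrightarrow> g X"
    using s(2)
  proof eventually_elim
    case (elim X)
    from tendsto_real_sqrt[OF elim] show ?case
      by (simp add: tendsto_norm_zero_iff LIM_zero_iff)
  qed
  with s(1) that show thesis by blast
qed

lemma L2_lim_on_subseq:
  assumes "L2_lim_on \<Omega> gs g" "strict_mono s"
  shows "L2_lim_on \<Omega> (\<lambda>n. gs (s n)) g"
  using assms LIMSEQ_subseq_LIMSEQ[OF _ assms(2), of "\<lambda>n. LINT X|lebesgue_on \<Omega>. (norm (gs n X - g X))\<^sup>2" 0]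
  by (auto simp: L2_lim_on_def o_def)

section \<open>Calculus in the space of compactly supported C^1 functions\<close>

lemma grad_eqI:
  assumes "(u has_derivative (\<lambda>Z. g \<bullet> Z)) (at X)"
  shows "grad u X = g"
  unfolding grad_def frechet_derivative_at[OF assms, symmetric]
  by (simp add: euclidean_representation)

lemma C1_on_continuous: "C1_on \<Omega> u \<Longrightarrow> continuous_on \<Omega> u"
  by (auto simp: C1_on_def intro!: continuous_at_imp_continuous_on differentiable_imp_continuous_within)

lemma compactly_inside_subset: "compactly_inside A \<Omega> \<Longrightarrow> B \<subseteq> A \<Longrightarrow> compactly_inside B \<Omega>"
  unfolding compactly_inside_def
  by (metis closed_closure closed_Int_compact closure_mono inf.absorb_iff1 order_trans)

lemma compactly_inside_Un: "compactly_inside A \<Omega> \<Longrightarrow> compactly_inside B \<Omega> \<Longrightarrow> compactly_inside (A \<union> B) \<Omega>"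
  by (auto simp: compactly_inside_def closure_Un compact_Un)

lemma C1_0_diff:
  assumes "v \<in> C1_0 \<Omega>" "w \<in> C1_0 \<Omega>"
  shows "(\<lambda>X. v X - w X) \<in> C1_0 \<Omega>"
    and "\<And>X. X \<in> \<Omega> \<Longrightarrow> grad (\<lambda>X. v X - w X) X = grad v X - grad w X"
proof -
  from assms have v: "\<And>X. X \<in> \<Omega> \<Longrightarrow> v differentiable (at X)" "continuous_on \<Omega> (grad v)"
    and w: "\<And>X. X \<in> \<Omega> \<Longrightarrow> w differentiable (at X)" "continuous_on \<Omega> (grad w)"
    by (auto simp: C1_0_def C1_on_def)
  have der: "((\<lambda>X. v X - w X) has_derivative (\<lambda>Z. (grad v X - grad w X) \<bullet> Z)) (at X)" if "X \<in> \<Omega>" for X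
    using has_derivative_diff[OF has_derivative_grad[OF v(1)[OF that]] has_derivative_grad[OF w(1)[OF that]]]
    by (simp add: inner_diff_left)
  then show grad: "grad (\<lambda>X. v X - w X) X = grad v X - grad w X" if "X \<in> \<Omega>" for X
    using that by (intro grad_eqI)
  have "continuous_on \<Omega> (grad (\<lambda>X. v X - w X))"
    using continuous_on_diff[OF v(2) w(2)] by (simp add: grad cong: continuous_on_cong)
  moreover have "compactly_inside {X \<in> \<Omega>. v X - w X \<noteq> 0} \<Omega>"
    using assms compactly_inside_Un[of "{X \<in> \<Omega>. v X \<noteq> 0}" \<Omega> "{X \<in> \<Omega>. w X \<noteq> 0}"]
    by (auto simp: C1_0_def elim!: compactly_inside_subset)
  ultimately show "(\<lambda>X. v X - w X) \<in> C1_0 \<Omega>"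
    using der by (auto simp: C1_0_def C1_on_def differentiable_def)
qed

text \<open>The condition \<open>\<phi> 0 = 0\<close> prevents the support from growing; the
  gradient is given by the chain rule.\<close>

lemma C1_0_compose:
  assumes "v \<in> C1_0 \<Omega>" and \<phi>: "\<And>s. (\<phi> has_real_derivative \<phi>' s) (at s)" "continuous_on UNIV \<phi>'" "\<phi> 0 = 0"
  shows "(\<lambda>X. \<phi> (v X)) \<in> C1_0 \<Omega>"
    and "\<And>X. X \<in> \<Omega> \<Longrightarrow> grad (\<lambda>X. \<phi> (v X)) X = \<phi>' (v X) *\<^sub>R grad v X"
proof -
  from assms have v: "\<And>X. X \<in> \<Omega> \<Longrightarrow> v differentiable (at X)" "continuous_on \<Omega> (grad v)" "continuous_on \<Omega> v"
    by (auto simp: C1_0_def C1_on_continuous) (auto simp: C1_on_def)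
  have der: "((\<lambda>X. \<phi> (v X)) has_derivative (\<lambda>Z. (\<phi>' (v X) *\<^sub>R grad v X) \<bullet> Z)) (at X)" if "X \<in> \<Omega>" for X
    using has_derivative_compose[OF has_derivative_grad[OF v(1)[OF that]] \<phi>(1)[unfolded has_field_derivative_def]]
    by simp
  then show grad: "grad (\<lambda>X. \<phi> (v X)) X = \<phi>' (v X) *\<^sub>R grad v X" if "X \<in> \<Omega>" for X
    using that by (intro grad_eqI)
  have "continuous_on \<Omega> (\<lambda>X. \<phi>' (v X) *\<^sub>R grad v X)"
    by (intro continuous_intros continuous_on_compose2[OF \<phi>(2) v(3)] v(2)) auto
  then have "continuous_on \<Omega> (grad (\<lambda>X. \<phi> (v X)))"
    by (simp add: grad cong: continuous_on_cong)
  moreover have "compactly_inside {X \<in> \<Omega>. \<phi> (v X) \<noteq> 0} \<Omega>"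
    using assms(1) \<phi>(3) by (auto simp: C1_0_def elim!: compactly_inside_subset)
  ultimately show "(\<lambda>X. \<phi> (v X)) \<in> C1_0 \<Omega>"
    using der by (auto simp: C1_0_def C1_on_def differentiable_def)
qed

lemma C1_0_bounded:
  assumes "v \<in> C1_0 \<Omega>"
  obtains K where "K > 0" "\<And>X. X \<in> \<Omega> \<Longrightarrow> \<bar>v X\<bar> \<le> K"
proof -
  have "compact (v ` closure {X \<in> \<Omega>. v X \<noteq> 0})"
    using assms by (auto simp: C1_0_def compactly_inside_def intro!: compact_continuous_image
      intro: continuous_on_subset C1_on_continuous)
  then obtain K where K: "K > 0" "\<And>X. X \<in> closure {X \<in> \<Omega>. v X \<noteq> 0} \<Longrightarrow> \<bar>v X\<bar> \<le> K"
    by (auto dest!: compact_imp_bounded simp: bounded_pos)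
  have "\<bar>v X\<bar> \<le> K" if "X \<in> \<Omega>" for X
    using that K closure_subset[of "{X \<in> \<Omega>. v X \<noteq> 0}"] by (cases "v X = 0") auto
  with K(1) that show thesis by blast
qed

text \<open>The support \<open>K\<close> is a compact subset of \<open>\<Omega>\<close>, so the open
  sets \<open>\<Omega>\<close> and \<open>- K\<close> cover the space. On the first the extension
  agrees with \<open>v\<close>, on the second with 0, and the two gradients glue
  continuously.\<close>

lemma C1_0_extend_zero:
  fixes v :: "'a::euclidean_space \<Rightarrow> real"
  assumes "open \<Omega>" "v \<in> C1_0 \<Omega>" and w_def: "w = (\<lambda>X. if X \<in> \<Omega> then v X else 0)"
  shows "C1_on UNIV w" "bounded {X. w X \<noteq> 0}"
    and "\<And>X. grad w X = (if X \<in> \<Omega> then grad v X else 0)"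
proof -
  define K where "K = closure {X \<in> \<Omega>. v X \<noteq> 0}"
  have K: "compact K" "K \<subseteq> \<Omega>" "closed K"
    using assms(2) by (auto simp: C1_0_def compactly_inside_def K_def)
  have wK: "w X = 0" if "X \<notin> K" for X
    using that closure_subset[of "{X \<in> \<Omega>. v X \<noteq> 0}"] by (auto simp: w_def K_def)
  have v: "\<And>X. X \<in> \<Omega> \<Longrightarrow> v differentiable (at X)" "continuous_on \<Omega> (grad v)"
    using assms(2) by (auto simp: C1_0_def C1_on_def)
  have der1: "(w has_derivative (\<lambda>Z. grad v X \<bullet> Z)) (at X)" if "X \<in> \<Omega>" for X
    using has_derivative_grad[OF v(1)[OF that]] \<open>open \<Omega>\<close> that
    by (rule has_derivative_transform_within_open) (simp add: w_def)
  have der2: "(w has_derivative (\<lambda>Z. 0 \<bullet> Z)) (at X)" if "X \<notin> K" for X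
  proof -
    have "((\<lambda>_. 0) has_derivative (\<lambda>Z. 0 \<bullet> Z)) (at X)" by simp
    then show ?thesis
      by (rule has_derivative_transform_within_open[of _ _ _ _ "- K"]) (use K that wK in auto)
  qed
  have grad1: "grad w X = grad v X" if "X \<in> \<Omega>" for X
    using der1[OF that] by (rule grad_eqI)
  have grad2: "grad w X = 0" if "X \<notin> K" for X
    using der2[OF that] by (rule grad_eqI)
  show "grad w X = (if X \<in> \<Omega> then grad v X else 0)" for X
    using grad1 grad2 K by auto
  have "continuous_on \<Omega> (grad w)"
    using v(2) by (rule continuous_on_eq) (simp add: grad1)
  moreover have "continuous_on (- K) (grad w)"
    using continuous_on_const[of _ 0] by (rule continuous_on_eq) (simp add: grad2)
  ultimately have "continuous_on (\<Omega> \<union> - K) (grad w)"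
    using K \<open>open \<Omega>\<close> by (intro continuous_on_open_Un) auto
  moreover have "\<Omega> \<union> - K = UNIV" using K by auto
  moreover have "w differentiable (at X)" for X
    using der1[of X] der2[of X] K by (auto simp: differentiable_def)
  ultimately show "C1_on UNIV w" by (simp add: C1_on_def)
  show "bounded {X. w X \<noteq> 0}"
    by (rule bounded_subset[OF compact_imp_bounded[OF K(1)]]) (use wK in auto)
qed

lemma nn_integral_lebesgue_on:
  fixes f :: "'a::euclidean_space \<Rightarrow> ennreal"
  assumes "open \<Omega>"
  shows "(\<integral>\<^sup>+X. f X \<partial>lebesgue_on \<Omega>) = (\<integral>\<^sup>+X. f X * indicator \<Omega> X \<partial>lborel)"
  using assms by (simp add: nn_integral_restrict_space nn_integral_completion)

lemma grushin_Sobolev_on: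
  fixes v :: "real \<times> (real ^ 'm) \<Rightarrow> real"
  assumes "lam \<ge> 0" "Q = (real CARD('m) + 1) + lam * real CARD('m)" "Q > 2"
    and \<Omega>: "open \<Omega>" and v: "v \<in> C1_0 \<Omega>"
    and E: "(\<integral>\<^sup>+X. ennreal ((norm (grushin_sqrtA lam X (grad v X)))\<^sup>2) \<partial>lebesgue_on \<Omega>) \<le> ennreal E" "E \<ge> 0"
  shows "(\<integral>\<^sup>+X. ennreal (\<bar>v X\<bar> powr (2 * Q / (Q - 2))) \<partial>lebesgue_on \<Omega>) \<le>
    ennreal ((Sobolev_const (real CARD('m)) Q * E) powr (Q / (Q - 2)))"
proof -
  define w where "w = (\<lambda>X. if X \<in> \<Omega> then v X else 0)"
  note w = C1_0_extend_zero[OF \<Omega> v w_def]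
  have "(\<integral>\<^sup>+X. ennreal ((norm (grushin_sqrtA lam X (grad w X)))\<^sup>2) \<partial>lborel) =
    (\<integral>\<^sup>+X. ennreal ((norm (grushin_sqrtA lam X (grad v X)))\<^sup>2) \<partial>lebesgue_on \<Omega>)"
    unfolding nn_integral_lebesgue_on[OF \<Omega>]
    by (intro nn_integral_cong) (simp add: w(3) grushin_sqrtA_def zero_prod_def[symmetric])
  then have "(\<integral>\<^sup>+X. ennreal (\<bar>w X\<bar> powr (2 * Q / (Q - 2))) \<partial>lborel) \<le>
      ennreal ((Sobolev_const (real CARD('m)) Q * E) powr (Q / (Q - 2)))"
    using E by (intro grushin_Sobolev[OF assms(1-3) w(1,2)]) auto
  also have "(\<integral>\<^sup>+X. ennreal (\<bar>w X\<bar> powr (2 * Q / (Q - 2))) \<partial>lborel) =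
      (\<integral>\<^sup>+X. ennreal (\<bar>v X\<bar> powr (2 * Q / (Q - 2))) \<partial>lebesgue_on \<Omega>)"
    unfolding nn_integral_lebesgue_on[OF \<Omega>]
    by (intro nn_integral_cong) (auto simp: w_def split: split_indicator)
  finally show ?thesis .
qed

section \<open>The energy identity\<close>

text \<open>Fatou's lemma with upper bounds \<open>e n\<close> that vary with \<open>n\<close> and
  pass to their limit.\<close>

lemma nn_integral_Fatou_le:
  fixes h :: "nat \<Rightarrow> 'a \<Rightarrow> real"
  assumes [measurable]: "\<And>n. h n \<in> borel_measurable M"
    and lim: "AE x in M. (\<lambda>n. h n x) \<longlonglongrightarrow> g x"
    and le: "\<And>n. (\<integral>\<^sup>+x. ennreal (h n x) \<partial>M) \<le> ennreal (e n)" and e: "e \<longlonglongrightarrow> E"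
  shows "(\<integral>\<^sup>+x. ennreal (g x) \<partial>M) \<le> ennreal E"
proof -
  have "AE x in M. ennreal (g x) = liminf (\<lambda>n. ennreal (h n x))"
    using lim
  proof eventually_elim
    case (elim x)
    then show ?case
      using lim_imp_Liminf[OF _ tendsto_ennrealI[OF elim]] by simp
  qed
  then have "(\<integral>\<^sup>+x. ennreal (g x) \<partial>M) = (\<integral>\<^sup>+x. liminf (\<lambda>n. ennreal (h n x)) \<partial>M)"
    by (rule nn_integral_cong_AE)
  also have "\<dots> \<le> liminf (\<lambda>n. \<integral>\<^sup>+x. ennreal (h n x) \<partial>M)"
    by (rule nn_integral_liminf) measurable
  also have "\<dots> \<le> liminf (\<lambda>n. ennreal (e n))"
    by (intro Liminf_mono always_eventually allI le)
  also have "\<dots> = ennreal E"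
    using lim_imp_Liminf[OF _ tendsto_ennrealI[OF e]] by simp
  finally show ?thesis .
qed

lemma grushin_sqrtA_diff: "grushin_sqrtA lam X (Z - W) = grushin_sqrtA lam X Z - grushin_sqrtA lam X W"
  by (simp add: grushin_sqrtA_def scaleR_diff_right minus_prod_def)

lemma grushin_sqrtA_scaleR: "grushin_sqrtA lam X (c *\<^sub>R Z) = c *\<^sub>R grushin_sqrtA lam X Z"
  by (simp add: grushin_sqrtA_def scaleR_prod_def mult.commute)

lemma Lp_on_cong: "(\<And>X. X \<in> \<Omega> \<Longrightarrow> g X = h X) \<Longrightarrow> Lp_on p \<Omega> g \<longleftrightarrow> Lp_on p \<Omega> h"
  unfolding Lp_on_def by (intro conj_cong measurable_cong Bochner_Integration.integrable_cong refl) auto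

text \<open>The weak formulation is expressed through \<open>U\<close>, the L^2 limit of the
  degenerate gradients, instead of the quasi-gradient; this avoids the inverse of the square root of
  \<open>A\<close> where \<open>x = 0\<close>. The approximating sequence is taken to converge to
  \<open>u\<close> almost everywhere.\<close>

locale grushin_energy =
  fixes lam Q :: real and \<Omega> :: "(real \<times> (real ^ 'm)) set" and f u :: "real \<times> (real ^ 'm) \<Rightarrow> real"
    and us :: "nat \<Rightarrow> real \<times> (real ^ 'm) \<Rightarrow> real" and U :: "real \<times> (real ^ 'm) \<Rightarrow> real \<times> (real ^ 'm)"
  assumes lam: "lam \<ge> 0" and Q: "Q = (real CARD('m) + 1) + lam * real CARD('m)" "Q > 2"
    and \<Omega>: "open \<Omega>"
    and f_integrable: "integrable (lebesgue_on \<Omega>) f" and f_nonneg: "AE X in lebesgue_on \<Omega>. 0 \<le> f X"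
    and us: "\<And>n. us n \<in> C1_0 \<Omega>"
    and u_measurable [measurable]: "u \<in> borel_measurable (lebesgue_on \<Omega>)"
    and us_lim: "AE X in lebesgue_on \<Omega>. (\<lambda>n. us n X) \<longlonglongrightarrow> u X"
    and grad_lim: "L2_lim_on \<Omega> (\<lambda>n X. grushin_sqrtA lam X (grad (us n) X)) U"
    and u_lower: "\<And>\<Omega>'. compactly_inside \<Omega>' \<Omega> \<Longrightarrow> \<exists>C>0. AE X in lebesgue_on \<Omega>. X \<in> \<Omega>' \<longrightarrow> C \<le> u X"
    and weak: "\<And>v. v \<in> C1_0 \<Omega> \<Longrightarrow> (LINT X|lebesgue_on \<Omega>. U X \<bullet> grushin_sqrtA lam X (grad v X)) =
      (LINT X|lebesgue_on \<Omega>. f X * v X / u X)"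
begin

abbreviation M :: "(real \<times> (real ^ 'm)) measure" where "M \<equiv> lebesgue_on \<Omega>"

abbreviation W :: "(real \<times> (real ^ 'm) \<Rightarrow> real) \<Rightarrow> real \<times> (real ^ 'm) \<Rightarrow> real \<times> (real ^ 'm)" where
  "W v X \<equiv> grushin_sqrtA lam X (grad v X)"

lemma f_measurable [measurable]: "f \<in> borel_measurable M"
  using f_integrable by simp

lemma U_L2: "Lp_on 2 \<Omega> U" and W_us_L2: "Lp_on 2 \<Omega> (W (us n))"
  using grad_lim by (auto simp: L2_lim_on_def)

lemma U_measurable [measurable]: "U \<in> borel_measurable M"
  using U_L2 by (simp add: Lp_on_def)

lemma W_us_measurable [measurable]: "W (us n) \<in> borel_measurable M"
  using W_us_L2 by (simp add: Lp_on_def)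

lemma C1_0_measurable: "v \<in> C1_0 \<Omega> \<Longrightarrow> v \<in> borel_measurable M"
  using \<Omega> by (auto simp: C1_0_def intro!: continuous_imp_measurable_on_sets_lebesgue C1_on_continuous)

lemma us_measurable [measurable]: "us n \<in> borel_measurable M"
  by (rule C1_0_measurable[OF us])

text \<open>The open set \<open>\<Omega>\<close> is a countable union of compact subsets, and on
  each of them \<open>u\<close> has a positive lower bound almost everywhere.\<close>

lemma u_pos: "AE X in M. u X > 0"
proof -
  have "\<exists>K :: nat \<Rightarrow> _. (\<forall>n. compact (K n)) \<and> (\<forall>n. K n \<subseteq> \<Omega>) \<and> \<Union> (range K) = \<Omega>"
  proof (rule open_Union_compact_subsets[OF \<Omega>])
    fix C :: "nat \<Rightarrow> (real \<times> (real ^ 'm)) set"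
    assume "\<And>n. compact (C n)" "\<And>n. C n \<subseteq> \<Omega>" "\<Union> (range C) = \<Omega>"
    then show "\<exists>K :: nat \<Rightarrow> _. (\<forall>n. compact (K n)) \<and> (\<forall>n. K n \<subseteq> \<Omega>) \<and> \<Union> (range K) = \<Omega>"
      by (intro exI[of _ C]) simp
  qed
  then obtain K :: "nat \<Rightarrow> (real \<times> (real ^ 'm)) set"
    where K: "\<And>n. compact (K n)" "\<And>n. K n \<subseteq> \<Omega>" "\<Union> (range K) = \<Omega>" by metis
  have "AE X in M. X \<in> K n \<longrightarrow> u X > 0" for n
  proof -
    have "compactly_inside (K n) \<Omega>"
      using K(1)[of n] K(2)[of n] by (simp add: compactly_inside_def compact_imp_closed)
    from u_lower[OF this] obtain C where "C > 0" "AE X in M. X \<in> K n \<longrightarrow> C \<le> u X" by blast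
    then show ?thesis by (auto elim!: eventually_mono)
  qed
  then have "AE X in M. \<forall>n. X \<in> K n \<longrightarrow> u X > 0"
    by (simp only: AE_all_countable simp_thms)
  moreover have "AE X in M. X \<in> \<Omega>" by (rule AE_I2) simp
  ultimately show ?thesis
  proof eventually_elim
    case (elim X)
    then show ?case using K(3) by blast
  qed
qed

text \<open>On the support of \<open>v\<close> the solution stays above some \<open>C > 0\<close>,
  and \<open>v\<close> is bounded by some \<open>K\<close>, so the quotient is dominated by
  \<open>K / C * f\<close>.\<close>

lemma integrable_source:
  assumes v: "v \<in> C1_0 \<Omega>"
  shows "integrable M (\<lambda>X. f X * v X / u X)"
proof -
  note C1_0_measurable[OF v, measurable]
  obtain K where K: "K > 0" "\<And>X. X \<in> \<Omega> \<Longrightarrow> \<bar>v X\<bar> \<le> K"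
    using C1_0_bounded[OF v] by blast
  obtain C where C: "C > 0" "AE X in M. X \<in> {X \<in> \<Omega>. v X \<noteq> 0} \<longrightarrow> C \<le> u X"
    using u_lower[of "{X \<in> \<Omega>. v X \<noteq> 0}"] v by (auto simp: C1_0_def)
  have int: "integrable M (\<lambda>X. K / C * f X)"
    using f_integrable by simp
  show ?thesis
  proof (rule Bochner_Integration.integrable_bound[OF int])
    have "AE X in M. X \<in> \<Omega>" by (rule AE_I2) simp
    with C(2) show "AE X in M. norm (f X * v X / u X) \<le> norm (K / C * f X)"
    proof eventually_elim
      case (elim X)
      show ?case
      proof (cases "v X = 0")
        case False
        then have "C \<le> u X" using elim by simp
        then have "\<bar>v X\<bar> / u X \<le> K / C"
          using K elim C by (intro frac_le) auto
        then have "\<bar>f X\<bar> * (\<bar>v X\<bar> / u X) \<le> \<bar>f X\<bar> * (K / C)"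
          by (rule mult_left_mono) simp
        then show ?thesis
          using K C \<open>C \<le> u X\<close> by (simp add: abs_mult mult.commute)
      qed simp
    qed
  qed measurable
qed

text \<open>Testing with smooth approximations of \<open>\<bar>v\<bar>\<close> shows that \<open>v \<mapsto> f v / u\<close> is continuous from the
  energy norm to \<open>L\<^sup>1\<close>, although \<open>1 / u\<close> is unbounded near the boundary.\<close>

lemma source_abs_le:
  assumes v: "v \<in> C1_0 \<Omega>" and Wv: "Lp_on 2 \<Omega> (W v)"
  shows "(LINT X|M. f X * \<bar>v X\<bar> / u X) \<le> (LINT X|M. norm (U X) * norm (W v X))"
proof -
  note C1_0_measurable[OF v, measurable]
  define \<epsilon> where "\<epsilon> n = 1 / real (Suc n)" for n
  \<comment> \<open>A smooth approximation of the absolute value with \<open>\<phi> n 0 = 0\<close>,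
    derivative bounded by 1 and values between 0 and \<open>\<bar>s\<bar>\<close>. Subtracting
    \<open>\<epsilon> n\<close> is what makes it vanish at 0, so that the composition keeps compact
    support.\<close>
  define \<phi> where "\<phi> n s = sqrt (s\<^sup>2 + (\<epsilon> n)\<^sup>2) - \<epsilon> n" for n s
  define \<phi>' where "\<phi>' n s = s / sqrt (s\<^sup>2 + (\<epsilon> n)\<^sup>2)" for n s
  have \<epsilon>: "\<epsilon> n > 0" for n by (simp add: \<epsilon>_def)
  have pos: "s\<^sup>2 + (\<epsilon> n)\<^sup>2 > 0" for s n
    using \<epsilon>[of n] by (simp add: add_nonneg_pos)
  have der: "(\<phi> n has_real_derivative \<phi>' n s) (at s)" for n s
    unfolding \<phi>_def[abs_def] \<phi>'_def using pos[of s n]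
    by (auto intro!: derivative_eq_intros simp: divide_simps)
  have cont: "continuous_on UNIV (\<phi>' n)" for n
    unfolding \<phi>'_def[abs_def] using \<epsilon>[of n] by (intro continuous_intros) (auto simp: sum_power2_eq_zero_iff)
  have \<phi>0: "\<phi> n 0 = 0" for n
    using \<epsilon>[of n] by (simp add: \<phi>_def)
  have \<phi>'1: "\<bar>\<phi>' n s\<bar> \<le> 1" for n s
  proof -
    have "\<bar>s\<bar> \<le> sqrt (s\<^sup>2 + (\<epsilon> n)\<^sup>2)" by (rule real_le_rsqrt) simp
    then show ?thesis using pos[of s n] by (simp add: \<phi>'_def abs_divide)
  qed
  have \<phi>_nonneg: "\<phi> n s \<ge> 0" for n s
    unfolding \<phi>_def using \<epsilon>[of n] by (simp add: real_le_rsqrt)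
  have \<phi>_le: "\<phi> n s \<le> \<bar>s\<bar>" for n s
    unfolding \<phi>_def using sqrt_sum_squares_le_sum_abs[of s "\<epsilon> n"] \<epsilon>[of n] by simp
  have lim: "(\<lambda>n. \<phi> n s) \<longlonglongrightarrow> \<bar>s\<bar>" for s
  proof -
    have "\<epsilon> \<longlonglongrightarrow> 0" unfolding \<epsilon>_def by (rule lim_1_over_n[THEN LIMSEQ_Suc, unfolded o_def])
    then have "(\<lambda>n. \<phi> n s) \<longlonglongrightarrow> sqrt (s\<^sup>2 + 0\<^sup>2) - 0"
      unfolding \<phi>_def by (intro tendsto_intros)
    then show ?thesis by simp
  qed
  have int: "integrable M (\<lambda>X. f X * v X / u X)" by (rule integrable_source[OF v])
  have le: "(LINT X|M. f X * \<phi> n (v X) / u X) \<le> (LINT X|M. norm (U X) * norm (W v X))" for n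
  proof -
    note comp = C1_0_compose[OF v, of "\<phi> n" "\<phi>' n", OF der cont \<phi>0]
    have [measurable]: "\<phi>' n \<in> borel_measurable borel"
      using cont by (rule borel_measurable_continuous_onI)
    have [measurable]: "W v \<in> borel_measurable M" using Wv by (simp add: Lp_on_def)
    have intUW: "integrable M (\<lambda>X. norm (U X) * norm (W v X))"
      by (rule integrable_norm_mult_norm[OF U_L2 Wv])
    have bound: "norm (U X \<bullet> (\<phi>' n (v X) *\<^sub>R W v X)) \<le> norm (U X) * norm (W v X)" for X
    proof -
      have "norm (U X \<bullet> (\<phi>' n (v X) *\<^sub>R W v X)) \<le> norm (U X) * (\<bar>\<phi>' n (v X)\<bar> * norm (W v X))"
        using Cauchy_Schwarz_ineq2[of "U X" "\<phi>' n (v X) *\<^sub>R W v X"] by simp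
      also have "\<dots> \<le> norm (U X) * (1 * norm (W v X))"
        by (intro mult_left_mono mult_right_mono \<phi>'1) auto
      finally show ?thesis by simp
    qed
    have "(LINT X|M. f X * \<phi> n (v X) / u X) = (LINT X|M. U X \<bullet> W (\<lambda>X. \<phi> n (v X)) X)"
      by (rule weak[OF comp(1), symmetric])
    also have "\<dots> = (LINT X|M. U X \<bullet> (\<phi>' n (v X) *\<^sub>R W v X))"
      by (intro Bochner_Integration.integral_cong refl) (simp add: comp(2) grushin_sqrtA_scaleR)
    also have "\<dots> \<le> (LINT X|M. norm (U X) * norm (W v X))"
    proof (rule integral_mono)
      show "integrable M (\<lambda>X. U X \<bullet> (\<phi>' n (v X) *\<^sub>R W v X))"
        by (rule Bochner_Integration.integrable_bound[OF intUW]) (use bound in auto)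
      show "U X \<bullet> (\<phi>' n (v X) *\<^sub>R W v X) \<le> norm (U X) * norm (W v X)" for X
        using bound[of X] by simp
    qed (rule intUW)
    finally show ?thesis .
  qed
  have "(\<lambda>n. LINT X|M. f X * \<phi> n (v X) / u X) \<longlonglongrightarrow> (LINT X|M. f X * \<bar>v X\<bar> / u X)"
  \<comment> \<open>The dominating function is integrable because \<open>v\<close> itself is an
    admissible test function.\<close>
  proof (rule integral_dominated_convergence[where w="\<lambda>X. \<bar>f X * v X / u X\<bar>"])
    have [measurable]: "\<phi> n \<in> borel_measurable borel" for n
      unfolding \<phi>_def[abs_def] by measurable
    show "(\<lambda>X. f X * \<phi> n (v X) / u X) \<in> borel_measurable M" for n by measurable
    show "integrable M (\<lambda>X. \<bar>f X * v X / u X\<bar>)" using int by (rule integrable_abs)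
    show "AE X in M. (\<lambda>n. f X * \<phi> n (v X) / u X) \<longlonglongrightarrow> f X * \<bar>v X\<bar> / u X"
      using u_pos by eventually_elim (intro tendsto_intros lim, simp)
    show "AE X in M. norm (f X * \<phi> n (v X) / u X) \<le> \<bar>f X * v X / u X\<bar>" for n
      using \<phi>_nonneg \<phi>_le by (intro AE_I2) (simp add: abs_mult divide_right_mono mult_left_mono)
  qed measurable
  then show ?thesis
    by (rule LIMSEQ_le_const2) (use le in blast)
qed

lemma U_W_tendsto: "(\<lambda>n. LINT X|M. norm (U X) * norm (W (us n) X - U X)) \<longlonglongrightarrow> 0"
proof (rule tendsto_sandwich[OF always_eventually always_eventually tendsto_const])
  show "\<forall>n. 0 \<le> (LINT X|M. norm (U X) * norm (W (us n) X - U X))"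
    by simp
  show "\<forall>n. (LINT X|M. norm (U X) * norm (W (us n) X - U X)) \<le>
      sqrt (LINT X|M. (norm (U X))\<^sup>2) * sqrt (LINT X|M. (norm (W (us n) X - U X))\<^sup>2)"
    by (intro allI Cauchy_Schwarz_L2 U_L2 Lp_on_2_diff W_us_L2)
  have "(\<lambda>n. sqrt (LINT X|M. (norm (W (us n) X - U X))\<^sup>2)) \<longlonglongrightarrow> sqrt 0"
    using grad_lim by (intro tendsto_real_sqrt) (simp add: L2_lim_on_def)
  from tendsto_mult_left[OF this] show "(\<lambda>n. sqrt (LINT X|M. (norm (U X))\<^sup>2) *
      sqrt (LINT X|M. (norm (W (us n) X - U X))\<^sup>2)) \<longlonglongrightarrow> 0"
    by fastforce
qed

text \<open>Dominated convergence: \<open>g\<close> is continuous and bounded by \<open>L\<close>,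
  so \<open>2 * L * (norm (U X))\<^sup>2\<close> dominates for all \<open>n\<close>.\<close>

lemma
  fixes g :: "real \<Rightarrow> real"
  assumes g: "continuous_on UNIV g" "\<And>s. \<bar>g s\<bar> \<le> L"
  shows integrable_compose_energy: "integrable M (\<lambda>X. \<bar>g (us n X) - g (u X)\<bar> * (norm (U X))\<^sup>2)"
    and compose_energy_tendsto: "(\<lambda>n. LINT X|M. \<bar>g (us n X) - g (u X)\<bar> * (norm (U X))\<^sup>2) \<longlonglongrightarrow> 0"
proof -
  have [measurable]: "g \<in> borel_measurable borel"
    using g(1) by (rule borel_measurable_continuous_onI)
  have w: "integrable M (\<lambda>X. 2 * L * (norm (U X))\<^sup>2)"
    using U_L2 by (simp add: Lp_on_2)
  have bound: "norm (\<bar>g (us n X) - g (u X)\<bar> * (norm (U X))\<^sup>2) \<le> 2 * L * (norm (U X))\<^sup>2" for n X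
    using g(2)[of "us n X"] g(2)[of "u X"] by (simp add: abs_mult) (intro mult_right_mono; simp)
  show "integrable M (\<lambda>X. \<bar>g (us n X) - g (u X)\<bar> * (norm (U X))\<^sup>2)"
  proof (rule Bochner_Integration.integrable_bound[OF w])
    show "AE X in M. norm (\<bar>g (us n X) - g (u X)\<bar> * (norm (U X))\<^sup>2) \<le> norm (2 * L * (norm (U X))\<^sup>2)"
      by (intro AE_I2 order_trans[OF bound]) simp
  qed measurable
  have "(\<lambda>n. LINT X|M. \<bar>g (us n X) - g (u X)\<bar> * (norm (U X))\<^sup>2) \<longlonglongrightarrow> (LINT X|M. 0)"
  proof (rule integral_dominated_convergence[OF _ _ w])
    show "AE X in M. (\<lambda>n. \<bar>g (us n X) - g (u X)\<bar> * (norm (U X))\<^sup>2) \<longlonglongrightarrow> 0"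
      using us_lim
    proof eventually_elim
      case (elim X)
      have "(\<lambda>n. g (us n X)) \<longlonglongrightarrow> g (u X)"
        using continuous_on_tendsto_compose[OF g(1) elim] by simp
      then have "(\<lambda>n. \<bar>g (us n X) - g (u X)\<bar> * (norm (U X))\<^sup>2) \<longlonglongrightarrow> \<bar>g (u X) - g (u X)\<bar> * (norm (U X))\<^sup>2"
        by (intro tendsto_intros)
      then show ?case by simp
    qed
    show "AE X in M. norm (\<bar>g (us n X) - g (u X)\<bar> * (norm (U X))\<^sup>2) \<le> 2 * L * (norm (U X))\<^sup>2" for n
      by (intro AE_I2 bound)
  qed measurable
  then show "(\<lambda>n. LINT X|M. \<bar>g (us n X) - g (u X)\<bar> * (norm (U X))\<^sup>2) \<longlonglongrightarrow> 0" by simp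
qed

section \<open>Nonlinear functions of the solution as test functions\<close>

context
  fixes \<phi> \<phi>' :: "real \<Rightarrow> real" and L :: real
  assumes der: "\<And>s. (\<phi> has_real_derivative \<phi>' s) (at s)" and cont: "continuous_on UNIV \<phi>'"
    and \<phi>0: "\<phi> 0 = 0" and L: "\<And>s. \<bar>\<phi>' s\<bar> \<le> L"
begin

lemma \<phi>'_measurable [measurable]: "\<phi>' \<in> borel_measurable borel"
  using cont by (rule borel_measurable_continuous_onI)

lemma \<phi>_cont: "continuous_on UNIV \<phi>"
  using der DERIV_isCont by (auto intro!: continuous_at_imp_continuous_on)

lemma \<phi>_measurable [measurable]: "\<phi> \<in> borel_measurable borel"
  using \<phi>_cont by (rule borel_measurable_continuous_onI)

lemma L_nonneg: "L \<ge> 0"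
  using L[of 0] by linarith

lemma W_compose: "X \<in> \<Omega> \<Longrightarrow> W (\<lambda>X. \<phi> (us n X)) X = \<phi>' (us n X) *\<^sub>R W (us n) X"
  by (simp add: C1_0_compose(2)[OF us der cont \<phi>0] grushin_sqrtA_scaleR)

lemma compose_L2: "Lp_on 2 \<Omega> (\<lambda>X. \<phi>' (us n X) *\<^sub>R W (us n) X)" "Lp_on 2 \<Omega> (\<lambda>X. \<phi>' (u X) *\<^sub>R U X)"
  by (intro Lp_on_2_scale[OF _ _ L] W_us_L2 U_L2; measurable)+

text \<open>The distance between the degenerate gradients of \<open>\<phi> (us n)\<close> and
  \<open>\<phi> (u)\<close>, weighted by the norm of \<open>U\<close>. It controls the errors on
  both sides of the weak formulation at once.\<close>

definition defect :: "nat \<Rightarrow> real" where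
  "defect n = (LINT X|M. norm (U X) * norm (\<phi>' (us n X) *\<^sub>R W (us n) X - \<phi>' (u X) *\<^sub>R U X))"

lemma integrable_defect:
  "integrable M (\<lambda>X. norm (U X) * norm (\<phi>' (us n X) *\<^sub>R W (us n) X - \<phi>' (u X) *\<^sub>R U X))"
  by (intro integrable_norm_mult_norm U_L2 Lp_on_2_diff compose_L2)

text \<open>The difference of the two products is split into \<open>\<phi>' (us n X)\<close> times
  \<open>W (us n) X - U X\<close>, small by L^2 convergence and the bound \<open>L\<close>, and the
  variation of \<open>\<phi>'\<close> times \<open>U X\<close>, small by dominated
  convergence.\<close>

lemma defect_tendsto: "defect \<longlonglongrightarrow> 0"
proof (rule tendsto_sandwich[OF always_eventually always_eventually tendsto_const])
  show "\<forall>n. 0 \<le> defect n" by (simp add: defect_def)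
  have int1: "integrable M (\<lambda>X. norm (U X) * norm (W (us n) X - U X))" for n
    by (intro integrable_norm_mult_norm U_L2 Lp_on_2_diff W_us_L2)
  note int2 = integrable_compose_energy[OF cont L]
  show "\<forall>n. defect n \<le> L * (LINT X|M. norm (U X) * norm (W (us n) X - U X)) +
      (LINT X|M. \<bar>\<phi>' (us n X) - \<phi>' (u X)\<bar> * (norm (U X))\<^sup>2)"
  proof
    fix n
    have "defect n \<le> (LINT X|M. L * (norm (U X) * norm (W (us n) X - U X)) +
        \<bar>\<phi>' (us n X) - \<phi>' (u X)\<bar> * (norm (U X))\<^sup>2)"
      unfolding defect_def
    proof (rule integral_mono[OF integrable_defect])
      show "integrable M (\<lambda>X. L * (norm (U X) * norm (W (us n) X - U X)) +
        \<bar>\<phi>' (us n X) - \<phi>' (u X)\<bar> * (norm (U X))\<^sup>2)"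
        using int1 int2 by (intro Bochner_Integration.integrable_add integrable_mult_right)
      fix X
      have "\<phi>' (us n X) *\<^sub>R W (us n) X - \<phi>' (u X) *\<^sub>R U X =
          \<phi>' (us n X) *\<^sub>R (W (us n) X - U X) + (\<phi>' (us n X) - \<phi>' (u X)) *\<^sub>R U X"
        by (simp add: algebra_simps)
      then have "norm (\<phi>' (us n X) *\<^sub>R W (us n) X - \<phi>' (u X) *\<^sub>R U X) \<le>
          \<bar>\<phi>' (us n X)\<bar> * norm (W (us n) X - U X) + \<bar>\<phi>' (us n X) - \<phi>' (u X)\<bar> * norm (U X)"
        by (metis norm_triangle_ineq norm_scaleR)
      also have "\<dots> \<le> L * norm (W (us n) X - U X) + \<bar>\<phi>' (us n X) - \<phi>' (u X)\<bar> * norm (U X)"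
        by (intro add_right_mono mult_right_mono L) simp
      finally have "norm (U X) * norm (\<phi>' (us n X) *\<^sub>R W (us n) X - \<phi>' (u X) *\<^sub>R U X) \<le>
          norm (U X) * (L * norm (W (us n) X - U X) + \<bar>\<phi>' (us n X) - \<phi>' (u X)\<bar> * norm (U X))"
        by (rule mult_left_mono) simp
      then show "norm (U X) * norm (\<phi>' (us n X) *\<^sub>R W (us n) X - \<phi>' (u X) *\<^sub>R U X) \<le>
          L * (norm (U X) * norm (W (us n) X - U X)) + \<bar>\<phi>' (us n X) - \<phi>' (u X)\<bar> * (norm (U X))\<^sup>2"
        by (simp add: power2_eq_square algebra_simps)
    qed
    also have "\<dots> = L * (LINT X|M. norm (U X) * norm (W (us n) X - U X)) +
        (LINT X|M. \<bar>\<phi>' (us n X) - \<phi>' (u X)\<bar> * (norm (U X))\<^sup>2)"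
      using int1 int2 by (subst Bochner_Integration.integral_add) auto
    finally show "defect n \<le> \<dots>" .
  qed
  have "(\<lambda>n. L * (LINT X|M. norm (U X) * norm (W (us n) X - U X)) +
      (LINT X|M. \<bar>\<phi>' (us n X) - \<phi>' (u X)\<bar> * (norm (U X))\<^sup>2)) \<longlonglongrightarrow> L * 0 + 0"
    by (intro tendsto_intros U_W_tendsto compose_energy_tendsto[OF cont L])
  then show "(\<lambda>n. L * (LINT X|M. norm (U X) * norm (W (us n) X - U X)) +
      (LINT X|M. \<bar>\<phi>' (us n X) - \<phi>' (u X)\<bar> * (norm (U X))\<^sup>2)) \<longlonglongrightarrow> 0" by simp
qed

text \<open>The bound \<open>source_abs_le\<close> for the difference of two approximations, with
  the triangle inequality through the common limit
  \<open>\<phi>' (u X) *\<^sub>R U X\<close>.\<close>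

lemma source_Cauchy:
  "(\<integral>\<^sup>+X. ennreal (f X * \<bar>\<phi> (us n X) - \<phi> (us k X)\<bar> / u X) \<partial>M) \<le> ennreal (defect n + defect k)"
proof -
  define v where "v X = \<phi> (us n X) - \<phi> (us k X)" for X
  note c = C1_0_compose[OF us der cont \<phi>0]
  have v: "v \<in> C1_0 \<Omega>"
    unfolding v_def[abs_def] by (rule C1_0_diff(1)[OF c(1) c(1)])
  let ?D = "\<lambda>X. \<phi>' (us n X) *\<^sub>R W (us n) X - \<phi>' (us k X) *\<^sub>R W (us k) X"
  have Wv: "W v X = ?D X" if "X \<in> \<Omega>" for X
    unfolding v_def[abs_def] C1_0_diff(2)[OF c(1) c(1) that] grushin_sqrtA_diff W_compose[OF that] ..
  have D: "Lp_on 2 \<Omega> ?D"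
    by (intro Lp_on_2_diff compose_L2)
  have "Lp_on 2 \<Omega> (W v)"
    using Lp_on_cong[of \<Omega> "W v" ?D] Wv D by blast
  from source_abs_le[OF v this]
  have "(LINT X|M. f X * \<bar>v X\<bar> / u X) \<le> (LINT X|M. norm (U X) * norm (W v X))" .
  also have "\<dots> = (LINT X|M. norm (U X) * norm (?D X))"
    by (intro Bochner_Integration.integral_cong refl) (simp add: Wv)
  also have "\<dots> \<le> (LINT X|M. norm (U X) * norm (\<phi>' (us n X) *\<^sub>R W (us n) X - \<phi>' (u X) *\<^sub>R U X) +
      norm (U X) * norm (\<phi>' (us k X) *\<^sub>R W (us k) X - \<phi>' (u X) *\<^sub>R U X))"
  proof (rule integral_mono)
    show "norm (U X) * norm (?D X) \<le> norm (U X) * norm (\<phi>' (us n X) *\<^sub>R W (us n) X - \<phi>' (u X) *\<^sub>R U X) +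
      norm (U X) * norm (\<phi>' (us k X) *\<^sub>R W (us k) X - \<phi>' (u X) *\<^sub>R U X)" for X
      unfolding distrib_left[symmetric] by (intro mult_left_mono norm_diff_triangle_le norm_ge_zero)
        (auto simp: norm_minus_commute)
  qed (intro integrable_norm_mult_norm U_L2 D Bochner_Integration.integrable_add integrable_defect)+
  also have "\<dots> = defect n + defect k"
    unfolding defect_def by (intro Bochner_Integration.integral_add integrable_defect)
  finally have "(LINT X|M. f X * \<bar>v X\<bar> / u X) \<le> defect n + defect k" .
  moreover have "(\<integral>\<^sup>+X. ennreal (f X * \<bar>v X\<bar> / u X) \<partial>M) = ennreal (LINT X|M. f X * \<bar>v X\<bar> / u X)"
  proof (rule nn_integral_eq_integral)
    have nn: "AE X in M. f X * \<bar>v X\<bar> / u X = \<bar>f X * v X / u X\<bar>"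
      using f_nonneg u_pos by eventually_elim (simp add: abs_mult)
    then show "AE X in M. 0 \<le> f X * \<bar>v X\<bar> / u X"
      by eventually_elim simp
    note C1_0_measurable[OF v, measurable]
    show "integrable M (\<lambda>X. f X * \<bar>v X\<bar> / u X)"
      using integrable_abs[OF integrable_source[OF v]] nn by (subst integrable_cong_AE[OF _ _ nn]) auto
  qed
  ultimately show ?thesis
    by (simp add: v_def ennreal_leI)
qed

text \<open>Letting \<open>k\<close> tend to infinity in \<open>source_Cauchy\<close>, Fatou's lemma
  bounds the L^1 distance between the sources of \<open>\<phi> (us n)\<close> and
  \<open>\<phi> (u)\<close> by \<open>defect n\<close>. Testing the equation with
  \<open>\<phi> (us n)\<close> then carries over to the limit, although \<open>\<phi> (u)\<close>
  need not have compact support.\<close>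

lemma
  shows integrable_source_compose: "integrable M (\<lambda>X. f X * \<phi> (u X) / u X)"
    and energy_identity: "(LINT X|M. f X * \<phi> (u X) / u X) = (LINT X|M. \<phi>' (u X) * (norm (U X))\<^sup>2)"
proof -
  note c = C1_0_compose[OF us der cont \<phi>0]
  have lim: "AE X in M. (\<lambda>k. f X * \<bar>\<phi> (us n X) - \<phi> (us k X)\<bar> / u X) \<longlonglongrightarrow> f X * \<bar>\<phi> (us n X) - \<phi> (u X)\<bar> / u X" for n
    using us_lim u_pos
  proof eventually_elim
    case (elim X)
    have "(\<lambda>k. \<phi> (us k X)) \<longlonglongrightarrow> \<phi> (u X)"
      using continuous_on_tendsto_compose[OF \<phi>_cont elim(1)] by simp
    then show ?case
      using elim by (intro tendsto_intros) auto
  qed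
  have le: "(\<integral>\<^sup>+X. ennreal (f X * \<bar>\<phi> (us n X) - \<phi> (u X)\<bar> / u X) \<partial>M) \<le> ennreal (defect n)" for n
  proof (rule nn_integral_Fatou_le[OF _ lim source_Cauchy])
    show "(\<lambda>k. defect n + defect k) \<longlonglongrightarrow> defect n"
      using tendsto_add[OF tendsto_const defect_tendsto, of "defect n"] by simp
  qed measurable
  have nn: "AE X in M. f X * \<bar>\<phi> (us n X) - \<phi> (u X)\<bar> / u X = norm (f X * \<phi> (us n X) / u X - f X * \<phi> (u X) / u X)" for n
    using f_nonneg u_pos
  proof eventually_elim
    case (elim X)
    have "f X * \<phi> (us n X) / u X - f X * \<phi> (u X) / u X = f X * (\<phi> (us n X) - \<phi> (u X)) / u X"
      by (simp add: algebra_simps diff_divide_distrib)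
    then show ?case using elim by (simp add: abs_mult)
  qed
  have le': "(\<integral>\<^sup>+X. ennreal (norm (f X * \<phi> (us n X) / u X - f X * \<phi> (u X) / u X)) \<partial>M) \<le> ennreal (defect n)" for n
    using le[of n] nn[of n] by (subst (asm) nn_integral_cong_AE[where v="\<lambda>X. ennreal (norm (f X * \<phi> (us n X) / u X - f X * \<phi> (u X) / u X))"])
      (auto elim!: eventually_mono)
  have int_n: "integrable M (\<lambda>X. f X * \<phi> (us n X) / u X)" for n
    by (rule integrable_source[OF c(1)])
  have int_d: "integrable M (\<lambda>X. f X * \<phi> (us n X) / u X - f X * \<phi> (u X) / u X)" for n
    by (rule integrableI_bounded) (use le'[of n] in \<open>auto intro: le_less_trans\<close>)
  \<comment> \<open>The limit source is an integrable approximation, here the one with index 0,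
    minus an integrable difference.\<close>
  show int: "integrable M (\<lambda>X. f X * \<phi> (u X) / u X)"
    using Bochner_Integration.integrable_diff[OF int_n int_d, of 0 0] by simp
  define A where "A = (LINT X|M. f X * \<phi> (u X) / u X)"
  define B where "B = (LINT X|M. \<phi>' (u X) * (norm (U X))\<^sup>2)"
  have inner_bound: "norm (U X \<bullet> Z) \<le> norm (U X) * norm Z" for X Z
    using Cauchy_Schwarz_ineq2[of "U X" Z] by simp
  have inner_int: "integrable M (\<lambda>X. U X \<bullet> Z X)" if "Lp_on 2 \<Omega> Z" for Z :: "real \<times> (real ^ 'm) \<Rightarrow> real \<times> (real ^ 'm)"
  proof (rule Bochner_Integration.integrable_bound[OF integrable_norm_mult_norm[OF U_L2 that]])
    show "AE X in M. norm (U X \<bullet> Z X) \<le> norm (norm (U X) * norm (Z X))"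
      by (intro AE_I2 order_trans[OF inner_bound]) simp
    have [measurable]: "Z \<in> borel_measurable M" using that by (simp add: Lp_on_def)
    show "(\<lambda>X. U X \<bullet> Z X) \<in> borel_measurable M" by measurable
  qed
  \<comment> \<open>By the weak formulation the value \<open>?I\<close> is also a pairing with
    \<open>U\<close>. Seen as a source it lies within \<open>defect n\<close> of \<open>A\<close>,
    seen as a pairing within \<open>defect n\<close> of \<open>B\<close>.\<close>
  have AB: "\<bar>A - B\<bar> \<le> 2 * defect n" for n
  proof -
    let ?I = "LINT X|M. f X * \<phi> (us n X) / u X"
    have "\<bar>?I - A\<bar> = \<bar>LINT X|M. f X * \<phi> (us n X) / u X - f X * \<phi> (u X) / u X\<bar>"
      unfolding A_def using int_n int by simp
    also have "\<dots> \<le> (LINT X|M. norm (f X * \<phi> (us n X) / u X - f X * \<phi> (u X) / u X))"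
      using integral_norm_bound[of M "\<lambda>X. f X * \<phi> (us n X) / u X - f X * \<phi> (u X) / u X"] by simp
    also have "\<dots> \<le> defect n"
    proof -
      have "ennreal (LINT X|M. norm (f X * \<phi> (us n X) / u X - f X * \<phi> (u X) / u X)) \<le> ennreal (defect n)"
        using le'[of n] nn_integral_eq_integral[OF integrable_norm[OF int_d[of n]]] by simp
      then show ?thesis
        by (subst (asm) ennreal_le_iff) (simp_all add: defect_def)
    qed
    finally have 1: "\<bar>?I - A\<bar> \<le> defect n" .
    have "?I = (LINT X|M. U X \<bullet> W (\<lambda>X. \<phi> (us n X)) X)"
      by (rule weak[OF c(1), symmetric])
    also have "\<dots> = (LINT X|M. U X \<bullet> (\<phi>' (us n X) *\<^sub>R W (us n) X))"
      by (intro Bochner_Integration.integral_cong refl) (simp add: W_compose)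
    finally have "?I - B = (LINT X|M. U X \<bullet> (\<phi>' (us n X) *\<^sub>R W (us n) X)) - (LINT X|M. U X \<bullet> (\<phi>' (u X) *\<^sub>R U X))"
      by (simp add: B_def dot_square_norm)
    also have "\<dots> = (LINT X|M. U X \<bullet> (\<phi>' (us n X) *\<^sub>R W (us n) X) - U X \<bullet> (\<phi>' (u X) *\<^sub>R U X))"
      by (intro Bochner_Integration.integral_diff[symmetric] inner_int compose_L2)
    finally have "\<bar>?I - B\<bar> \<le> (LINT X|M. norm (U X \<bullet> (\<phi>' (us n X) *\<^sub>R W (us n) X) - U X \<bullet> (\<phi>' (u X) *\<^sub>R U X)))"
      using integral_norm_bound[of M "\<lambda>X. U X \<bullet> (\<phi>' (us n X) *\<^sub>R W (us n) X) - U X \<bullet> (\<phi>' (u X) *\<^sub>R U X)"] by simp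
    also have "\<dots> \<le> defect n"
      unfolding defect_def inner_diff_right[symmetric]
      by (intro integral_mono integrable_defect inner_bound integrable_norm inner_int Lp_on_2_diff compose_L2)
    finally show ?thesis using 1 by linarith
  qed
  have "(\<lambda>n. 2 * defect n) \<longlonglongrightarrow> 0"
    using tendsto_mult_left[OF defect_tendsto, of 2] by simp
  then have "\<bar>A - B\<bar> \<le> 0"
    by (rule LIMSEQ_le_const) (use AB in blast)
  then show "(LINT X|M. f X * \<phi> (u X) / u X) = (LINT X|M. \<phi>' (u X) * (norm (U X))\<^sup>2)"
    by (simp add: A_def B_def)
qed

text \<open>The Sobolev inequality for the compactly supported functions
  \<open>\<phi> (us n)\<close>, followed by Fatou's lemma on the left and convergence of the energy
  bounds on the right.\<close>

lemma Sobolev_compose: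
  "(\<integral>\<^sup>+X. ennreal (\<bar>\<phi> (u X)\<bar> powr (2 * Q / (Q - 2))) \<partial>M) \<le>
    ennreal ((Sobolev_const (real CARD('m)) Q * (LINT X|M. (\<phi>' (u X))\<^sup>2 * (norm (U X))\<^sup>2)) powr (Q / (Q - 2)))"
proof -
  note c = C1_0_compose[OF us der cont \<phi>0]
  define g where "g s = (\<phi>' s)\<^sup>2" for s
  have g: "continuous_on UNIV g" "\<bar>g s\<bar> \<le> L\<^sup>2" for s
    using L[of s] L_nonneg by (auto simp: g_def abs_le_square_iff[symmetric] intro!: continuous_intros cont)
  have [measurable]: "g \<in> borel_measurable borel"
    using g(1) by (rule borel_measurable_continuous_onI)
  define E where "E = (LINT X|M. g (u X) * (norm (U X))\<^sup>2)"
  define a where "a n = (LINT X|M. (norm (W (us n) X - U X))\<^sup>2)" for n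
  define b where "b n = (LINT X|M. norm (U X) * norm (W (us n) X - U X))" for n
  define d where "d n = (LINT X|M. \<bar>g (us n X) - g (u X)\<bar> * (norm (U X))\<^sup>2)" for n
  \<comment> \<open>An upper bound for the energy of \<open>\<phi> (us n)\<close>: expand the square
    of \<open>norm (U X) + norm (W (us n) X - U X)\<close>, compare \<open>g (us n X)\<close> with
    \<open>g (u X)\<close> in the main term and bound it by \<open>L\<^sup>2\<close> in the others.
    All terms but \<open>E\<close> vanish in the limit.\<close>
  define e where "e n = E + d n + L\<^sup>2 * a n + 2 * L\<^sup>2 * b n" for n
  have ia: "integrable M (\<lambda>X. (norm (W (us n) X - U X))\<^sup>2)" for n
    using Lp_on_2_diff[OF W_us_L2 U_L2] by (simp add: Lp_on_2)
  have ib: "integrable M (\<lambda>X. norm (U X) * norm (W (us n) X - U X))" for n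
    by (intro integrable_norm_mult_norm U_L2 Lp_on_2_diff W_us_L2)
  note id = integrable_compose_energy[OF g]
  have iE: "integrable M (\<lambda>X. g (u X) * (norm (U X))\<^sup>2)"
    using compose_L2(2) by (simp add: Lp_on_2 power_mult_distrib g_def)
  have in1: "integrable M (\<lambda>X. (norm (\<phi>' (us n X) *\<^sub>R W (us n) X))\<^sup>2)" for n
    using compose_L2(1) unfolding Lp_on_2 by blast
  have le: "(LINT X|M. (norm (\<phi>' (us n X) *\<^sub>R W (us n) X))\<^sup>2) \<le> e n" for n
  proof -
    have "(LINT X|M. (norm (\<phi>' (us n X) *\<^sub>R W (us n) X))\<^sup>2) \<le>
      (LINT X|M. g (u X) * (norm (U X))\<^sup>2 + \<bar>g (us n X) - g (u X)\<bar> * (norm (U X))\<^sup>2 +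
        L\<^sup>2 * (norm (W (us n) X - U X))\<^sup>2 + 2 * L\<^sup>2 * (norm (U X) * norm (W (us n) X - U X)))"
    proof (rule integral_mono[OF in1])
      show "integrable M (\<lambda>X. g (u X) * (norm (U X))\<^sup>2 + \<bar>g (us n X) - g (u X)\<bar> * (norm (U X))\<^sup>2 +
        L\<^sup>2 * (norm (W (us n) X - U X))\<^sup>2 + 2 * L\<^sup>2 * (norm (U X) * norm (W (us n) X - U X)))"
        by (intro Bochner_Integration.integrable_add integrable_mult_right iE id ia ib)
      fix X
      define x y z where "x = norm (U X)" and "y = norm (W (us n) X - U X)" and "z = norm (W (us n) X)"
      have "z \<le> x + y"
        unfolding x_def y_def z_def using norm_triangle_ineq[of "U X" "W (us n) X - U X"] by simp
      then have "z\<^sup>2 \<le> (x + y)\<^sup>2"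
        by (intro power_mono) (auto simp: z_def)
      then have "g (us n X) * z\<^sup>2 \<le> g (us n X) * (x\<^sup>2 + (y\<^sup>2 + 2 * (x * y)))"
        by (intro mult_left_mono) (auto simp: g_def power2_sum algebra_simps)
      also have "\<dots> = g (us n X) * x\<^sup>2 + g (us n X) * (y\<^sup>2 + 2 * (x * y))"
        by (rule distrib_left)
      also have "\<dots> \<le> (g (u X) + \<bar>g (us n X) - g (u X)\<bar>) * x\<^sup>2 + L\<^sup>2 * (y\<^sup>2 + 2 * (x * y))"
        using g(2)[of "us n X"] by (intro add_mono mult_right_mono) (auto simp: x_def y_def)
      finally show "(norm (\<phi>' (us n X) *\<^sub>R W (us n) X))\<^sup>2 \<le>
        g (u X) * (norm (U X))\<^sup>2 + \<bar>g (us n X) - g (u X)\<bar> * (norm (U X))\<^sup>2 +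
        L\<^sup>2 * (norm (W (us n) X - U X))\<^sup>2 + 2 * L\<^sup>2 * (norm (U X) * norm (W (us n) X - U X))"
        unfolding x_def[symmetric] y_def[symmetric] norm_scaleR z_def[symmetric] power_mult_distrib power2_abs g_def[symmetric]
        by (simp add: algebra_simps)
    qed
    also have "\<dots> = e n"
      unfolding e_def E_def a_def b_def d_def using iE id ia ib by simp
    finally show ?thesis .
  qed
  have e0: "e n \<ge> 0" for n
    using le[of n] by (rule order_trans[rotated]) simp
  have "(\<lambda>n. e n) \<longlonglongrightarrow> E + 0 + L\<^sup>2 * 0 + 2 * L\<^sup>2 * 0"
    unfolding e_def b_def d_def a_def using grad_lim
    by (intro tendsto_intros U_W_tendsto compose_energy_tendsto[OF g]) (simp add: L2_lim_on_def)
  then have e_lim: "e \<longlonglongrightarrow> E" by simp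
  have "(\<integral>\<^sup>+X. ennreal (\<bar>\<phi> (u X)\<bar> powr (2 * Q / (Q - 2))) \<partial>M) \<le>
    ennreal ((Sobolev_const (real CARD('m)) Q * E) powr (Q / (Q - 2)))"
  proof (rule nn_integral_Fatou_le)
    show "(\<lambda>X. \<bar>\<phi> (us n X)\<bar> powr (2 * Q / (Q - 2))) \<in> borel_measurable M" for n by measurable
    show "AE X in M. (\<lambda>n. \<bar>\<phi> (us n X)\<bar> powr (2 * Q / (Q - 2))) \<longlonglongrightarrow> \<bar>\<phi> (u X)\<bar> powr (2 * Q / (Q - 2))"
      using us_lim
    proof eventually_elim
      case (elim X)
      have "(\<lambda>k. \<phi> (us k X)) \<longlonglongrightarrow> \<phi> (u X)"
        using continuous_on_tendsto_compose[OF \<phi>_cont elim] by simp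
      then show ?case
        using Q(2) by (intro tendsto_powr2 tendsto_rabs tendsto_const) auto
    qed
    show "(\<integral>\<^sup>+X. ennreal (\<bar>\<phi> (us n X)\<bar> powr (2 * Q / (Q - 2))) \<partial>M) \<le>
      ennreal ((Sobolev_const (real CARD('m)) Q * e n) powr (Q / (Q - 2)))" for n
    proof (rule grushin_Sobolev_on[OF lam Q \<Omega> c(1) _ e0])
      have "(\<integral>\<^sup>+X. ennreal ((norm (W (\<lambda>X. \<phi> (us n X)) X))\<^sup>2) \<partial>M) =
        (\<integral>\<^sup>+X. ennreal ((norm (\<phi>' (us n X) *\<^sub>R W (us n) X))\<^sup>2) \<partial>M)"
        by (intro nn_integral_cong) (simp add: W_compose)
      also have "\<dots> = ennreal (LINT X|M. (norm (\<phi>' (us n X) *\<^sub>R W (us n) X))\<^sup>2)"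
        by (rule nn_integral_eq_integral[OF in1]) simp
      also have "\<dots> \<le> ennreal (e n)"
        by (rule ennreal_leI[OF le])
      finally show "(\<integral>\<^sup>+X. ennreal ((norm (W (\<lambda>X. \<phi> (us n X)) X))\<^sup>2) \<partial>M) \<le> ennreal (e n)" .
    qed
    show "(\<lambda>n. (Sobolev_const (real CARD('m)) Q * e n) powr (Q / (Q - 2))) \<longlonglongrightarrow>
      (Sobolev_const (real CARD('m)) Q * E) powr (Q / (Q - 2))"
      using Q(2) e0 Sobolev_const_nonneg
      by (intro tendsto_powr2 tendsto_mult_left e_lim tendsto_const always_eventually allI mult_nonneg_nonneg) auto
  qed
  then show ?thesis by (simp add: E_def g_def)
qed

end

text \<open>Since the derivative of \<open>\<phi>\<close> is the square of that of
  \<open>\<psi>\<close>, the energy of \<open>\<psi> (u)\<close> is exactly what the energy identity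
  for \<open>\<phi>\<close> expresses through the source.\<close>

lemma energy_Sobolev:
  assumes "\<And>s. (\<psi> has_real_derivative h s) (at s)" "\<And>s. (\<phi> has_real_derivative (h s)\<^sup>2) (at s)"
    and h: "continuous_on UNIV h" "\<And>s. \<bar>h s\<bar> \<le> L" and "\<psi> 0 = 0" "\<phi> 0 = 0"
  shows "integrable M (\<lambda>X. f X * \<phi> (u X) / u X)"
    and "(\<integral>\<^sup>+X. ennreal (\<bar>\<psi> (u X)\<bar> powr (2 * Q / (Q - 2))) \<partial>M) \<le>
      ennreal ((Sobolev_const (real CARD('m)) Q * (LINT X|M. f X * \<phi> (u X) / u X)) powr (Q / (Q - 2)))"
proof -
  have "L \<ge> 0" using h(2)[of 0] by linarith
  then have h2: "continuous_on UNIV (\<lambda>s. (h s)\<^sup>2)" "\<bar>(h s)\<^sup>2\<bar> \<le> L\<^sup>2" for s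
    using h by (auto simp: abs_le_square_iff[symmetric] intro!: continuous_intros)
  show "integrable M (\<lambda>X. f X * \<phi> (u X) / u X)"
    by (rule integrable_source_compose[OF assms(2) h2(1) assms(6) h2(2)])
  show "(\<integral>\<^sup>+X. ennreal (\<bar>\<psi> (u X)\<bar> powr (2 * Q / (Q - 2))) \<partial>M) \<le>
      ennreal ((Sobolev_const (real CARD('m)) Q * (LINT X|M. f X * \<phi> (u X) / u X)) powr (Q / (Q - 2)))"
    using Sobolev_compose[OF assms(1) h(1) assms(5) h(2)]
    unfolding energy_identity[OF assms(2) h2(1) assms(6) h2(2)] .
qed

end

section \<open>Summability of the solution\<close>

lemma continuous_antiderivative:
  fixes h :: "real \<Rightarrow> real"
  assumes "continuous_on UNIV h"
  obtains F where "\<And>s. (F has_real_derivative h s) (at s)" "F 0 = 0"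
proof -
  have "\<exists>F. \<forall>x. - \<infinity> < ereal x \<longrightarrow> ereal x < \<infinity> \<longrightarrow> (F has_vector_derivative h x) (at x)"
    using assms by (intro einterval_antiderivative) (simp_all add: continuous_on_eq_continuous_at)
  then obtain F where F: "\<And>s. (F has_real_derivative h s) (at s)"
    by (auto simp: has_real_derivative_iff_has_vector_derivative)
  show thesis
  proof (rule that)
    show "((\<lambda>s. F s - F 0) has_real_derivative h s) (at s)" for s
      using DERIV_diff[OF F[of s] DERIV_const[of "F 0"]] by simp
  qed simp
qed

lemma DERIV_le_imp_diff_le:
  fixes F G :: "real \<Rightarrow> real"
  assumes "a \<le> b" "\<And>s. (F has_real_derivative f s) (at s)" "\<And>s. (G has_real_derivative g s) (at s)"
    and "\<And>s. a \<le> s \<Longrightarrow> s \<le> b \<Longrightarrow> f s \<le> g s"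
  shows "F b - F a \<le> G b - G a"
proof -
  have "G a - F a \<le> G b - F b"
  proof (rule DERIV_nonneg_imp_nondecreasing[OF assms(1)])
    fix s assume "a \<le> s" "s \<le> b"
    with assms(4) show "\<exists>y. ((\<lambda>s. G s - F s) has_real_derivative y) (at s) \<and> 0 \<le> y"
      by (intro exI[of _ "g s - f s"] conjI DERIV_diff assms) auto
  qed
  then show ?thesis by simp
qed

text \<open>Along levels increasing to \<open>d\<close> with gaps halved at each step,
  \<open>A\<close> decays geometrically: as \<open>\<beta> > 1\<close>, the superlinear gain on the
  right compensates for the shrinking gaps. By monotonicity \<open>A d\<close> lies below all these
  values.\<close>

lemma Stampacchia:
  fixes A :: "real \<Rightarrow> real"
  assumes nonneg: "\<And>k. A k \<ge> 0" and mono: "\<And>k h. 0 \<le> k \<Longrightarrow> k \<le> h \<Longrightarrow> A h \<le> A k"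
    and step: "\<And>k h. 0 \<le> k \<Longrightarrow> k < h \<Longrightarrow> (h - k) powr \<alpha> * A h \<le> K * A k powr \<beta>"
    and "\<alpha> > 0" "\<beta> > 1" "K > 0"
  obtains d where "d \<ge> 0" "A d = 0"
proof (cases "A 0 = 0")
  case False
  then have A0: "A 0 > 0" using nonneg[of 0] by simp
  \<comment> \<open>The decay rate for which \<open>\<mu> * \<beta> = \<mu> + \<alpha>\<close>: the
    gain from the power \<open>\<beta>\<close> pays for the factor lost with the gap and preserves
    the rate.\<close>
  define \<mu> where "\<mu> = \<alpha> / (\<beta> - 1)"
  have \<mu>: "\<mu> > 0" "\<mu> * \<beta> = \<mu> + \<alpha>"
    using \<open>\<alpha> > 0\<close> \<open>\<beta> > 1\<close> by (auto simp: \<mu>_def field_simps)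
  \<comment> \<open>Solved from the requirement that the induction step of \<open>bound\<close>
    closes with exactly the constant \<open>A 0\<close>.\<close>
  define d where "d = (K * A 0 powr (\<beta> - 1) * 2 powr (\<alpha> + \<mu>)) powr (1 / \<alpha>)"
  have d: "d > 0" "d powr \<alpha> = K * A 0 powr (\<beta> - 1) * 2 powr (\<alpha> + \<mu>)"
    using A0 \<open>K > 0\<close> \<open>\<alpha> > 0\<close> by (auto simp: d_def powr_powr)
  define k where "k n = d * (1 - 2 powr (- real n))" for n
  have k: "0 \<le> k n" "k n \<le> d" "k n < k (Suc n)" "k (Suc n) - k n = d * 2 powr (- real (Suc n))" for n
  proof -
    have "2 powr (- real n) = 2 * (2::real) powr (- real (Suc n))"
      using powr_add[of "2::real" 1 "- real (Suc n)"] by simp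
    moreover have "2 powr (- real n) \<le> (2::real) powr 0" by (intro powr_mono) auto
    ultimately show "0 \<le> k n" "k n \<le> d" "k n < k (Suc n)" "k (Suc n) - k n = d * 2 powr (- real (Suc n))"
      using d(1) unfolding k_def by (auto simp: algebra_simps)
  qed
  have bound: "A (k n) \<le> A 0 * 2 powr (- \<mu> * real n)" for n
  proof (induction n)
    case (Suc n)
    define x :: real where "x = 2 powr (- real (Suc n))"
    have "(d * x) powr \<alpha> * A (k (Suc n)) \<le> K * A (k n) powr \<beta>"
      using step[OF k(1) k(3), of n] k(4)[of n] by (simp add: x_def)
    also have "\<dots> \<le> K * (A 0 * 2 powr (- \<mu> * real n)) powr \<beta>"
      using Suc nonneg \<open>K > 0\<close> \<open>\<beta> > 1\<close> by (intro mult_left_mono powr_mono2) auto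
    also have "\<dots> = K * (A 0 powr (\<beta> - 1) * A 0 powr 1) * 2 powr (- (\<mu> * \<beta>) * real n)"
      unfolding powr_add[symmetric] using A0 by (simp add: powr_mult powr_powr mult_ac)
    also have "\<dots> = d powr \<alpha> * 2 powr (- (\<alpha> + \<mu>)) * A 0 * 2 powr (- (\<mu> * \<beta>) * real n)"
    proof -
      have "2 powr (\<alpha> + \<mu>) * 2 powr (- (\<alpha> + \<mu>)) = (1 :: real)"
        unfolding powr_add[symmetric] by simp
      then show ?thesis
        unfolding d(2) using A0 by simp
    qed
    also have "\<dots> = d powr \<alpha> * (A 0 * (2 powr (- (\<alpha> + \<mu>)) * 2 powr (- (\<mu> * \<beta>) * real n)))"
      by simp
    also have "(2::real) powr (- (\<alpha> + \<mu>)) * 2 powr (- (\<mu> * \<beta>) * real n) = x powr \<alpha> * 2 powr (- \<mu> * real (Suc n))"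
      unfolding \<mu>(2) x_def powr_powr powr_add[symmetric] by (simp add: algebra_simps)
    finally have "(d powr \<alpha> * x powr \<alpha>) * A (k (Suc n)) \<le> (d powr \<alpha> * x powr \<alpha>) * (A 0 * 2 powr (- \<mu> * real (Suc n)))"
      using d(1) by (simp add: powr_mult x_def mult_ac)
    then show ?case
      by (rule mult_left_le_imp_le) (use d(1) in \<open>simp add: x_def\<close>)
  qed (simp add: k_def)
  have "(\<lambda>n. A 0 * (2 powr (- \<mu>)) ^ n) \<longlonglongrightarrow> A 0 * 0"
    using \<mu>(1) by (intro tendsto_mult_left LIMSEQ_power_zero) (simp add: powr_less_one)
  moreover have "A d \<le> A 0 * (2 powr (- \<mu>)) ^ n" for n
  proof -
    have "A d \<le> A (k n)" by (rule mono[OF k(1,2)])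
    also note bound[of n]
    also have "(2::real) powr (- \<mu> * real n) = (2 powr (- \<mu>)) ^ n"
      by (subst powr_realpow[symmetric]) (simp_all add: powr_powr)
    finally show ?thesis .
  qed
  ultimately have "A d \<le> 0"
    by (intro LIMSEQ_le_const[of _ 0 "A d"]) auto
  with nonneg[of d] d(1) that[of d] show thesis by simp
qed (use that in auto)

section \<open>Boundedness and integrability of the solution\<close>

context grushin_energy
begin

text \<open>Stampacchia's lemma for the measures \<open>A k\<close> of the level sets. The exponent
  \<open>\<beta>\<close> combines Hoelder's inequality for \<open>f\<close> on a level set with the
  Sobolev exponent, and \<open>\<beta> > 1\<close> is equivalent to
  \<open>r > Q / 2\<close>.\<close>

lemma Linfty_bound:
  assumes bnd: "bounded \<Omega>" and r: "r > Q / 2" and fr: "integrable M (\<lambda>X. \<bar>f X\<bar> powr r)"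
  shows "\<exists>C. AE X in M. \<bar>u X\<bar> \<le> C"
proof -
  interpret M: finite_measure M
    using bnd \<Omega> by (intro finite_measure_lebesgue_on bounded_set_imp_lmeasurable) auto
  have r1: "r > 1" using r Q(2) by simp
  define r' where "r' = r / (r - 1)"
  have r': "r' > 1" "1 / r + 1 / r' = 1" "1 / r' = 1 - 1 / r"
    using r1 by (auto simp: r'_def field_simps)
  define S where "S k = {X \<in> \<Omega>. u X > k}" for k
  have S [measurable]: "S k \<in> sets M" for k
    using measurable_sets[OF u_measurable, of "{k<..}"] by (simp add: S_def vimage_def Int_def conj_commute)
  define A where "A k = measure M (S k)" for k
  define \<alpha> \<beta> where "\<alpha> = 2 * Q / (Q - 2)" and "\<beta> = (1 - 1 / r) * (Q / (Q - 2))"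
  have \<alpha>: "\<alpha> > 0" using Q(2) by (simp add: \<alpha>_def)
  have \<beta>: "\<beta> > 1" using r r1 Q(2) by (simp add: \<beta>_def field_simps)
  define C where "C = Sobolev_const (real CARD('m)) Q"
  have C: "C \<ge> 0" by (simp add: C_def Sobolev_const_nonneg)
  define N where "N = (LINT X|M. \<bar>f X\<bar> powr r) powr (1 / r)"
  have N: "N \<ge> 0" by (simp add: N_def)
  have f_level: "integrable M (\<lambda>X. \<bar>f X\<bar> * indicator (S k) X)"
      "(LINT X|M. \<bar>f X\<bar> * indicator (S k) X) \<le> N * A k powr (1 - 1 / r)" for k
  proof -
    have ind: "(\<lambda>X. indicator (S k) X powr r' :: real) = indicator (S k)"
      by (auto simp: indicator_def)
    have "integrable M (indicator (S k) :: _ \<Rightarrow> real)"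
      by (intro integrable_real_indicator S) (simp add: M.emeasure_eq_measure)
    then have ii: "integrable M (\<lambda>X. indicator (S k) X powr r' :: real)"
      unfolding ind .
    note H = Holder_integral[OF r1 r'(1,2) _ _ _ _ fr ii]
    show "integrable M (\<lambda>X. \<bar>f X\<bar> * indicator (S k) X)"
      by (rule H) auto
    have "(LINT X|M. \<bar>f X\<bar> * indicator (S k) X) \<le>
        (LINT X|M. \<bar>f X\<bar> powr r) powr (1 / r) * (LINT X|M. indicator (S k) X powr r') powr (1 / r')"
      by (rule H) auto
    also have "(LINT X|M. indicator (S k) X powr r') = A k"
    proof -
      have "S k \<inter> \<Omega> = S k" by (auto simp: S_def)
      then show ?thesis
        unfolding ind A_def using S[of k] by simp
    qed
    finally show "(LINT X|M. \<bar>f X\<bar> * indicator (S k) X) \<le> N * A k powr (1 - 1 / r)"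
      by (simp add: N_def r'(3))
  qed
  \<comment> \<open>The added 1 makes the constant positive, as the iteration lemma demands, even if
    \<open>C * N\<close> is zero.\<close>
  have step: "(h - k) powr \<alpha> * A h \<le> (2 powr \<alpha> * (C * N) powr (Q / (Q - 2)) + 1) * A k powr \<beta>"
    if "0 \<le> k" "k < h" for k h
  proof -
    define l where "l = (k + h) / 2"
    have l: "k < l" "l < h" "h - l = (h - k) / 2" using that by (auto simp: l_def field_simps)
    \<comment> \<open>A continuous ramp from 0 at \<open>k\<close> to 1 at the midpoint
      \<open>l\<close>, in place of the jump in the derivative of \<open>(s - k)\<^sup>+\<close>.
      Between \<open>l\<close> and \<open>h\<close> the antiderivative still gains
      \<open>(h - k) / 2\<close>.\<close>
    define g where "g s = min 1 (max 0 ((s - k) / (l - k)))" for s :: real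
    have g: "continuous_on UNIV g" "0 \<le> g s" "g s \<le> 1" "s \<le> k \<Longrightarrow> g s = 0" "l \<le> s \<Longrightarrow> g s = 1" for s
      using l unfolding g_def[abs_def] by (auto intro!: continuous_intros simp: field_simps divide_le_0_iff)
    have g2: "continuous_on UNIV (\<lambda>s. (g s)\<^sup>2)" "(g s)\<^sup>2 \<le> 1" "\<bar>g s\<bar> \<le> 1" for s
      using g by (auto intro!: continuous_intros power_le_one)
    obtain \<psi> where \<psi>: "\<And>s. (\<psi> has_real_derivative g s) (at s)" "\<psi> 0 = 0"
      using continuous_antiderivative[OF g(1)] by blast
    obtain \<phi> where \<phi>: "\<And>s. (\<phi> has_real_derivative (g s)\<^sup>2) (at s)" "\<phi> 0 = 0"
      using continuous_antiderivative[OF g2(1)] by blast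
    note ES = energy_Sobolev[OF \<psi>(1) \<phi>(1) g(1) g2(3) \<psi>(2) \<phi>(2), folded C_def]
    \<comment> \<open>The bound by \<open>s\<close> cancels the singular factor
      \<open>1 / u\<close>, and the vanishing below \<open>k\<close> localises the source to the
      level set.\<close>
    have \<phi>_le: "\<phi> s \<le> (if s > k then s else 0)" if "s > 0" for s
    proof (cases "s > k")
      case True
      have "\<phi> s - \<phi> 0 \<le> s - 0"
        by (rule DERIV_le_imp_diff_le[OF _ \<phi>(1) DERIV_ident]) (use that g2 in auto)
      then show ?thesis using True \<phi>(2) by simp
    next
      case False
      have "\<phi> s - \<phi> 0 \<le> 0 - 0"
        by (rule DERIV_le_imp_diff_le[OF _ \<phi>(1) DERIV_const[of 0]]) (use that g(4) False in auto)
      then show ?thesis using False \<phi>(2) by simp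
    qed
    have \<psi>_ge: "\<psi> s \<ge> (h - k) / 2" if "s > h" for s
    proof -
      have "0 - 0 \<le> \<psi> l - \<psi> 0"
        by (rule DERIV_le_imp_diff_le[OF _ DERIV_const[of 0] \<psi>(1)]) (use l \<open>0 \<le> k\<close> g in auto)
      moreover have "s - l \<le> \<psi> s - \<psi> l"
        by (rule DERIV_le_imp_diff_le[OF _ DERIV_ident \<psi>(1)]) (use l that g(5) in auto)
      ultimately show ?thesis using l that \<psi>(2) by simp
    qed
    have "(LINT X|M. f X * \<phi> (u X) / u X) \<le> (LINT X|M. \<bar>f X\<bar> * indicator (S k) X)"
    proof (rule integral_mono_AE[OF ES(1) f_level(1)])
      have "AE X in M. X \<in> \<Omega>" by (rule AE_I2) simp
      with f_nonneg u_pos show "AE X in M. f X * \<phi> (u X) / u X \<le> \<bar>f X\<bar> * indicator (S k) X"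
      proof eventually_elim
        case (elim X)
        have "\<phi> (u X) / u X \<le> indicator (S k) X"
          using \<phi>_le[OF elim(2)] elim by (auto simp: S_def divide_le_eq split: split_indicator if_splits)
        from mult_left_mono[OF this elim(1)] elim show ?case by simp
      qed
    qed
    also note f_level(2)
    finally have le: "C * (LINT X|M. f X * \<phi> (u X) / u X) \<le> C * (N * A k powr (1 - 1 / r))"
      using C by (rule mult_left_mono)
    have pos: "0 \<le> (LINT X|M. f X * \<phi> (u X) / u X)"
    proof (rule integral_nonneg_AE, use f_nonneg u_pos in eventually_elim)
      case (elim X)
      have "0 - 0 \<le> \<phi> (u X) - \<phi> 0"
        by (rule DERIV_le_imp_diff_le[OF _ DERIV_const[of 0] \<phi>(1)]) (use elim in auto)
      then show ?case using elim \<phi>(2) by simp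
    qed
    have "ennreal (((h - k) / 2) powr \<alpha> * A h) = (\<integral>\<^sup>+X. ennreal (((h - k) / 2) powr \<alpha>) * indicator (S h) X \<partial>M)"
      using S[of h] by (simp add: nn_integral_cmult_indicator A_def M.emeasure_eq_measure ennreal_mult)
    also have "\<dots> \<le> (\<integral>\<^sup>+X. ennreal (\<bar>\<psi> (u X)\<bar> powr \<alpha>) \<partial>M)"
    proof (rule nn_integral_mono)
      fix X
      show "ennreal (((h - k) / 2) powr \<alpha>) * indicator (S h) X \<le> ennreal (\<bar>\<psi> (u X)\<bar> powr \<alpha>)"
      proof (cases "X \<in> S h")
        case True
        then have "(h - k) / 2 \<le> \<psi> (u X)" by (intro \<psi>_ge) (simp add: S_def)
        then show ?thesis
          using True that \<alpha> by (auto intro!: ennreal_leI powr_mono2)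
      qed simp
    qed
    also have "\<dots> \<le> ennreal ((C * (LINT X|M. f X * \<phi> (u X) / u X)) powr (Q / (Q - 2)))"
      unfolding \<alpha>_def by (rule ES(2))
    also have "\<dots> \<le> ennreal ((C * (N * A k powr (1 - 1 / r))) powr (Q / (Q - 2)))"
      using le C pos Q(2) by (intro ennreal_leI powr_mono2) auto
    finally have "((h - k) / 2) powr \<alpha> * A h \<le> (C * (N * A k powr (1 - 1 / r))) powr (Q / (Q - 2))"
      by (subst (asm) ennreal_le_iff) auto
    also have "\<dots> = (C * N) powr (Q / (Q - 2)) * A k powr \<beta>"
      using C N by (simp add: powr_mult powr_powr \<beta>_def)
    \<comment> \<open>The factor \<open>2 powr \<alpha>\<close> undoes the halving of
      \<open>h - k\<close>.\<close>
    finally have "2 powr \<alpha> * (((h - k) / 2) powr \<alpha> * A h) \<le> 2 powr \<alpha> * ((C * N) powr (Q / (Q - 2)) * A k powr \<beta>)"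
      by (rule mult_left_mono) simp
    moreover have "2 powr \<alpha> * (((h - k) / 2) powr \<alpha> * A h) = (h - k) powr \<alpha> * A h"
      using that by (simp add: powr_divide)
    ultimately show ?thesis
      by (simp add: distrib_right add_increasing2 mult.assoc)
  qed
  obtain d where d: "d \<ge> 0" "A d = 0"
  proof (rule Stampacchia[OF _ _ step \<alpha> \<beta>])
    show "A h \<le> A k" if "0 \<le> k" "k \<le> h" for k h
      unfolding A_def using that S by (intro M.finite_measure_mono) (auto simp: S_def)
    show "0 < 2 powr \<alpha> * (C * N) powr (Q / (Q - 2)) + 1"
      by (intro add_nonneg_pos) auto
  qed (auto simp: A_def)
  have "AE X in M. X \<notin> S d"
    using d(2) S[of d] by (intro AE_not_in) (simp add: null_sets_def A_def M.emeasure_eq_measure)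
  moreover have "AE X in M. X \<in> \<Omega>" by (rule AE_I2) simp
  ultimately have "AE X in M. \<bar>u X\<bar> \<le> d"
    using u_pos
  proof eventually_elim
    case (elim X)
    then show ?case by (auto simp: S_def)
  qed
  then show ?thesis by blast
qed

text \<open>With a truncated power as \<open>\<psi>\<close>, Hoelder's inequality bounds the source
  by a power of the same integral \<open>I\<close> that the Sobolev inequality bounds from above.
  This gives \<open>I \<le> K * I powr \<theta>\<close> with \<open>\<theta> < 1\<close> because
  \<open>r < Q / 2\<close>. The resulting bound does not depend on the truncation, which Fatou's
  lemma then removes.\<close>

lemma Lp_bound:
  assumes bnd: "bounded \<Omega>" and r: "r \<ge> 1" "r < Q / 2" and fr: "integrable M (\<lambda>X. \<bar>f X\<bar> powr r)"
  shows "integrable M (\<lambda>X. \<bar>u X\<bar> powr (2 * Q * r / (Q - 2 * r)))"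
proof -
  interpret M: finite_measure M
    using bnd \<Omega> by (intro finite_measure_lebesgue_on bounded_set_imp_lmeasurable) auto
  define C where "C = Sobolev_const (real CARD('m)) Q"
  have C: "C \<ge> 0" by (simp add: C_def Sobolev_const_nonneg)
  define s where "s = 2 * Q * r / (Q - 2 * r)"
  have s0: "s > 0" using r Q(2) by (simp add: s_def)
  have "\<exists>B. (\<integral>\<^sup>+X. ennreal (\<bar>u X\<bar> powr s) \<partial>M) \<le> ennreal B"
  \<comment> \<open>For \<open>r = 1\<close> there is no finite conjugate exponent. The identity
    serves as \<open>\<phi>\<close> and \<open>\<psi>\<close>: the source reduces to
    \<open>f\<close>, and \<open>s\<close> is the critical Sobolev exponent.\<close>
  proof (cases "r = 1")
    case True
    have "(\<integral>\<^sup>+X. ennreal (\<bar>u X\<bar> powr (2 * Q / (Q - 2))) \<partial>M) \<le>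
        ennreal ((C * (LINT X|M. f X * u X / u X)) powr (Q / (Q - 2)))"
      unfolding C_def by (rule energy_Sobolev(2)[of "\<lambda>s. s" "\<lambda>_. 1" "\<lambda>s. s" 1]) (auto intro!: derivative_eq_intros)
    then show ?thesis using True by (auto simp: s_def)
  next
    case False
    then have r1: "r > 1" using r by simp
    define r' where "r' = r / (r - 1)"
    have r': "r' > 1" "1 / r + 1 / r' = 1" "1 / r' = 1 - 1 / r"
      using r1 by (auto simp: r'_def field_simps)
    \<comment> \<open>The power for which the Sobolev exponent
      \<open>\<gamma> * (2 * Q / (Q - 2))\<close> and the Hoelder exponent
      \<open>(2 * \<gamma> - 2) * r'\<close> coincide; their common value is
      \<open>s\<close>.\<close>
    define \<gamma> where "\<gamma> = r * (Q - 2) / (Q - 2 * r)"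
    have \<gamma>: "\<gamma> > 1"
      using r r1 Q(2) by (simp add: \<gamma>_def field_simps)
    have \<gamma>s: "\<gamma> * (2 * Q / (Q - 2)) = s"
      using r Q(2) unfolding \<gamma>_def s_def times_divide_times_eq
      by (subst frac_eq_eq) (simp, simp, simp add: algebra_simps)
    have \<gamma>r: "(2 * \<gamma> - 2) * r' = s"
    proof -
      have "2 * \<gamma> - 2 = 2 * Q * (r - 1) / (Q - 2 * r)"
        using r by (simp add: \<gamma>_def field_simps)
      then show ?thesis using r1 by (simp add: r'_def s_def)
    qed
    define N where "N = (LINT X|M. \<bar>f X\<bar> powr r) powr (1 / r)"
    have N: "N \<ge> 0" by (simp add: N_def)
    define \<theta> where "\<theta> = (1 - 1 / r) * (Q / (Q - 2))"
    have \<theta>: "\<theta> < 1" using r r1 Q(2) by (simp add: \<theta>_def field_simps)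
    define K where "K = (C * (\<gamma>\<^sup>2 * N)) powr (Q / (Q - 2))"
    have trunc: "(\<integral>\<^sup>+X. ennreal ((min \<bar>u X\<bar> k) powr s) \<partial>M) \<le> ennreal (K powr (1 / (1 - \<theta>)))" if "k > 0" for k
    proof -
      define T where "T X = min \<bar>u X\<bar> k" for X
      have T: "0 \<le> T X" "T X \<le> k" for X using that by (auto simp: T_def)
      have [measurable]: "T \<in> borel_measurable M"
        unfolding T_def[abs_def] by measurable
      \<comment> \<open>Truncation on a set of finite measure makes \<open>I\<close> finite, so that
        a power of \<open>I\<close> may later be divided out.\<close>
      have iT: "integrable M (\<lambda>X. T X powr p)" if "p \<ge> 0" for p
        by (rule M.integrable_const_bound[of _ "k powr p"]) (use T that in \<open>auto intro!: powr_mono2\<close>)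
      define I where "I = (LINT X|M. T X powr s)"
      have I: "I \<ge> 0" by (simp add: I_def)
      \<comment> \<open>The derivative of the power \<open>\<gamma>\<close> up to \<open>k\<close>,
        frozen from there on: it remains continuous and bounded, so its antiderivative is admissible
        and dominates the truncated power on positive arguments.\<close>
      define g where "g t = \<gamma> * (min \<bar>t\<bar> k) powr (\<gamma> - 1)" for t
      have g: "continuous_on UNIV g" "\<bar>g t\<bar> \<le> \<gamma> * k powr (\<gamma> - 1)" for t
        unfolding g_def[abs_def] using \<gamma> that
        by (auto intro!: continuous_intros continuous_on_powr' powr_mono2 simp: abs_mult)
      have g0: "g t \<ge> 0" for t using \<gamma> by (simp add: g_def)
      have g2: "continuous_on UNIV (\<lambda>t. (g t)\<^sup>2)" by (intro continuous_intros g)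
      obtain \<psi> where \<psi>: "\<And>s. (\<psi> has_real_derivative g s) (at s)" "\<psi> 0 = 0"
        using continuous_antiderivative[OF g(1)] by blast
      obtain \<phi> where \<phi>: "\<And>s. (\<phi> has_real_derivative (g s)\<^sup>2) (at s)" "\<phi> 0 = 0"
        using continuous_antiderivative[OF g2] by blast
      note ES = energy_Sobolev[OF \<psi>(1) \<phi>(1) g(1) g(2) \<psi>(2) \<phi>(2), folded C_def]
      have \<psi>_ge: "(min \<bar>t\<bar> k) powr \<gamma> \<le> \<psi> t" if "t > 0" for t
      proof -
        define a where "a = min t k"
        have a: "0 \<le> a" "a \<le> t" "a \<le> k" using that \<open>k > 0\<close> by (auto simp: a_def)
        have "\<bar>a\<bar> powr \<gamma> - \<bar>0\<bar> powr \<gamma> \<le> \<psi> a - \<psi> 0"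
        proof (rule DERIV_le_imp_diff_le[OF a(1) has_real_derivative_abs_powr[OF \<gamma>] \<psi>(1)])
          fix y assume "0 \<le> y" "y \<le> a"
          then show "\<gamma> * \<bar>y\<bar> powr (\<gamma> - 1) * sgn y \<le> g y"
            using a \<gamma> by (cases "y = 0") (auto simp: g_def)
        qed
        moreover have "0 - 0 \<le> \<psi> t - \<psi> a"
          by (rule DERIV_le_imp_diff_le[OF a(2) DERIV_const[of 0] \<psi>(1)]) (rule g0)
        ultimately show ?thesis using \<psi>(2) that a by (simp add: a_def)
      qed
      \<comment> \<open>On positive arguments \<open>g\<close> is nondecreasing, so the integral of
        its square is at most the length times the final value. The factor \<open>t\<close> cancels
        against \<open>1 / u\<close>.\<close>
      have \<phi>_le: "\<phi> t \<le> t * (g t)\<^sup>2" if "t > 0" for t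
      proof -
        have "\<phi> t - \<phi> 0 \<le> t * (g t)\<^sup>2 - 0 * (g t)\<^sup>2"
        proof (rule DERIV_le_imp_diff_le[OF _ \<phi>(1) DERIV_cmult_right[OF DERIV_ident]])
          fix y assume "0 \<le> y" "y \<le> t"
          then have "g y \<le> g t"
            using \<gamma> \<open>k > 0\<close> unfolding g_def by (intro mult_left_mono powr_mono2) auto
          then show "(g y)\<^sup>2 \<le> 1 * (g t)\<^sup>2"
            using g0 by (simp add: power_mono)
        qed (use that in simp)
        then show ?thesis using \<phi>(2) by simp
      qed
      have "AE X in M. 0 \<le> \<bar>f X\<bar>" "AE X in M. 0 \<le> T X powr (2 * \<gamma> - 2)" by auto
      note H = Holder_integral[OF r1 r'(1,2) _ _ this fr]
      have Tr: "(T X powr (2 * \<gamma> - 2)) powr r' = T X powr s" for X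
        by (simp add: powr_powr \<gamma>r)
      have iH: "integrable M (\<lambda>X. \<bar>f X\<bar> * T X powr (2 * \<gamma> - 2))"
        by (rule H(1)) (use iT[of s] s0 in \<open>auto simp: Tr\<close>)
      have "(LINT X|M. \<bar>f X\<bar> * T X powr (2 * \<gamma> - 2)) \<le>
          (LINT X|M. \<bar>f X\<bar> powr r) powr (1 / r) * (LINT X|M. (T X powr (2 * \<gamma> - 2)) powr r') powr (1 / r')"
        by (rule H(2)) (use iT[of s] s0 in \<open>auto simp: Tr\<close>)
      then have Hle: "(LINT X|M. \<bar>f X\<bar> * T X powr (2 * \<gamma> - 2)) \<le> N * I powr (1 - 1 / r)"
        unfolding Tr by (simp add: N_def I_def r'(3))
      have "(LINT X|M. f X * \<phi> (u X) / u X) \<le> (LINT X|M. \<gamma>\<^sup>2 * (\<bar>f X\<bar> * T X powr (2 * \<gamma> - 2)))"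
      proof (rule integral_mono_AE[OF ES(1)])
        show "AE X in M. f X * \<phi> (u X) / u X \<le> \<gamma>\<^sup>2 * (\<bar>f X\<bar> * T X powr (2 * \<gamma> - 2))"
          using f_nonneg u_pos
        proof eventually_elim
          case (elim X)
          have "(g (u X))\<^sup>2 = \<gamma>\<^sup>2 * (T X powr (\<gamma> - 1) * T X powr (\<gamma> - 1))"
            by (simp add: g_def T_def power2_eq_square)
          also have "\<dots> = \<gamma>\<^sup>2 * T X powr (2 * \<gamma> - 2)"
            unfolding powr_add[symmetric] by simp
          finally have "\<phi> (u X) / u X \<le> \<gamma>\<^sup>2 * T X powr (2 * \<gamma> - 2)"
            using \<phi>_le[OF elim(2)] elim by (simp add: divide_le_eq mult.commute)
          from mult_left_mono[OF this elim(1)] elim show ?case by (simp add: mult_ac)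
        qed
      qed (use iH in simp)
      also have "\<dots> = \<gamma>\<^sup>2 * (LINT X|M. \<bar>f X\<bar> * T X powr (2 * \<gamma> - 2))" by simp
      also have "\<dots> \<le> \<gamma>\<^sup>2 * (N * I powr (1 - 1 / r))"
        by (intro mult_left_mono Hle) simp
      finally have le: "C * (LINT X|M. f X * \<phi> (u X) / u X) \<le> C * (\<gamma>\<^sup>2 * (N * I powr (1 - 1 / r)))"
        using C by (rule mult_left_mono)
      have pos: "0 \<le> (LINT X|M. f X * \<phi> (u X) / u X)"
      proof (rule integral_nonneg_AE, use f_nonneg u_pos in eventually_elim)
        case (elim X)
        have "0 - 0 \<le> \<phi> (u X) - \<phi> 0"
          by (rule DERIV_le_imp_diff_le[OF _ DERIV_const[of 0] \<phi>(1)]) (use elim in auto)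
        then show ?case using elim \<phi>(2) by simp
      qed
      have nnI: "(\<integral>\<^sup>+X. ennreal (T X powr s) \<partial>M) = ennreal I"
        unfolding I_def using iT[of s] s0 by (intro nn_integral_eq_integral) auto
      also have "ennreal I \<le> (\<integral>\<^sup>+X. ennreal (\<bar>\<psi> (u X)\<bar> powr (2 * Q / (Q - 2))) \<partial>M)"
        unfolding nnI[symmetric]
      proof (rule nn_integral_mono_AE, use u_pos in eventually_elim)
        case (elim X)
        have "T X powr \<gamma> \<le> \<bar>\<psi> (u X)\<bar>"
          using \<psi>_ge[OF elim] by (simp add: T_def)
        then have "(T X powr \<gamma>) powr (2 * Q / (Q - 2)) \<le> \<bar>\<psi> (u X)\<bar> powr (2 * Q / (Q - 2))"
          using Q(2) by (intro powr_mono2) auto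
        then show ?case
          unfolding powr_powr \<gamma>s by (rule ennreal_leI)
      qed
      also have "\<dots> \<le> ennreal ((C * (LINT X|M. f X * \<phi> (u X) / u X)) powr (Q / (Q - 2)))"
        by (rule ES(2))
      also have "\<dots> \<le> ennreal ((C * (\<gamma>\<^sup>2 * (N * I powr (1 - 1 / r)))) powr (Q / (Q - 2)))"
        using le C pos Q(2) by (intro ennreal_leI powr_mono2) auto
      finally have "ennreal I \<le> ennreal ((C * (\<gamma>\<^sup>2 * (N * I powr (1 - 1 / r)))) powr (Q / (Q - 2)))"
        unfolding nnI .
      then have "I \<le> (C * (\<gamma>\<^sup>2 * (N * I powr (1 - 1 / r)))) powr (Q / (Q - 2))"
        by (subst (asm) ennreal_le_iff) auto
      also have "\<dots> = K * I powr \<theta>"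
        using C N by (simp add: powr_mult powr_powr \<theta>_def K_def)
      finally have IK: "I \<le> K * I powr \<theta>" .
      have "I \<le> K powr (1 / (1 - \<theta>))"
      proof (cases "I = 0")
        case False
        then have "I > 0" using I by simp
        then have "I powr (1 - \<theta>) \<le> K"
          using IK by (simp add: powr_diff divide_le_eq)
        then have "(I powr (1 - \<theta>)) powr (1 / (1 - \<theta>)) \<le> K powr (1 / (1 - \<theta>))"
          using \<theta> by (intro powr_mono2) auto
        then show ?thesis using \<theta> \<open>I > 0\<close> by (simp add: powr_powr)
      qed simp
      then show ?thesis
        using nnI by (simp add: T_def ennreal_leI)
    qed
    have "(\<integral>\<^sup>+X. ennreal (\<bar>u X\<bar> powr s) \<partial>M) \<le> ennreal (K powr (1 / (1 - \<theta>)))"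
    proof (rule nn_integral_Fatou_le[OF _ _ trunc tendsto_const])
      show "AE X in M. (\<lambda>n. (min \<bar>u X\<bar> (real (Suc n))) powr s) \<longlonglongrightarrow> \<bar>u X\<bar> powr s"
      proof (rule AE_I2)
        fix X
        obtain n0 where "\<bar>u X\<bar> \<le> real n0" using real_arch_simple by blast
        then have "(min \<bar>u X\<bar> (real (Suc n))) powr s = \<bar>u X\<bar> powr s" if "n \<ge> n0" for n
          using that by (simp add: min_absorb1)
        then show "(\<lambda>n. (min \<bar>u X\<bar> (real (Suc n))) powr s) \<longlonglongrightarrow> \<bar>u X\<bar> powr s"
          by (intro tendsto_eventually eventually_sequentiallyI[of n0])
      qed
    qed auto
    then show ?thesis by blast
  qed
  then obtain B where "(\<integral>\<^sup>+X. ennreal (\<bar>u X\<bar> powr s) \<partial>M) \<le> ennreal B" by blast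
  then have "(\<integral>\<^sup>+X. ennreal (norm (\<bar>u X\<bar> powr s)) \<partial>M) < \<infinity>"
    by (simp add: le_less_trans)
  then have "integrable M (\<lambda>X. \<bar>u X\<bar> powr s)"
    by (intro integrableI_bounded) auto
  then show ?thesis by (simp add: s_def)
qed

end

section \<open>From the weak solution to the energy setting\<close>

text \<open>Completeness of Lebesgue measure, after extension by zero. It supplies measurability of
  the integrand containing the quasi-gradient \<open>G\<close>, which is specified only almost
  everywhere.\<close>

lemma borel_measurable_AE_lebesgue_on:
  fixes g h :: "'a::euclidean_space \<Rightarrow> 'b::euclidean_space"
  assumes g: "g \<in> borel_measurable (lebesgue_on \<Omega>)" and \<Omega>: "\<Omega> \<in> sets lebesgue"
    and AE: "AE X in lebesgue_on \<Omega>. g X = h X"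
  shows "h \<in> borel_measurable (lebesgue_on \<Omega>)"
proof -
  have "(\<lambda>X. if X \<in> \<Omega> then h X else 0) \<in> borel_measurable lebesgue"
  proof (rule borel_measurable_AE)
    show "(\<lambda>X. if X \<in> \<Omega> then g X else 0) \<in> borel_measurable lebesgue"
      using g \<Omega> by (simp add: borel_measurable_if)
    have "AE X in lebesgue. X \<in> \<Omega> \<longrightarrow> g X = h X"
      using AE \<Omega> by (simp add: AE_restrict_space_iff)
    then show "AE X in lebesgue. (if X \<in> \<Omega> then g X else 0) = (if X \<in> \<Omega> then h X else 0)"
      by eventually_elim simp
  qed
  then show ?thesis using \<Omega> by (simp add: borel_measurable_if)
qed

theorem theorem3p2:
  fixes \<Omega> :: "(real \<times> (real ^ 'm)) set"
    and f u :: "real \<times> (real ^ 'm) \<Rightarrow> real"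
    and lam r Q :: real
  assumes "lam \<ge> 1"
    and "Q = (real CARD('m) + 1) + lam * real CARD('m)"
    and "open \<Omega>" and "bounded \<Omega>" and "Lambda_connected lam \<Omega>"
    and "r \<ge> 1" and "Lp_on r \<Omega> f"
    and "AE X in lebesgue_on \<Omega>. f X \<ge> 0"
    and "\<not> (AE X in lebesgue_on \<Omega>. f X = 0)"
    and "weak_solution lam \<Omega> f u"
  shows "(r > Q / 2 \<longrightarrow> Linfty_on \<Omega> u) \<and>
         (r < Q / 2 \<longrightarrow> Lp_on (2 * Q * r / (Q - 2 * r)) \<Omega> u)"
proof -
  have Q2: "Q > 2"
  proof -
    have m: "real CARD('m) \<ge> 1" by (simp add: Suc_le_eq)
    then have "1 * 1 \<le> lam * real CARD('m)"
      using \<open>lam \<ge> 1\<close> by (intro mult_mono) auto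
    then show ?thesis using m unfolding assms(2) by linarith
  qed
  interpret M: finite_measure "lebesgue_on \<Omega>"
    using \<open>bounded \<Omega>\<close> \<open>open \<Omega>\<close> by (intro finite_measure_lebesgue_on bounded_set_imp_lmeasurable) auto
  have f_meas [measurable]: "f \<in> borel_measurable (lebesgue_on \<Omega>)"
    and fr: "integrable (lebesgue_on \<Omega>) (\<lambda>X. \<bar>f X\<bar> powr r)"
    using \<open>Lp_on r \<Omega> f\<close> by (auto simp: Lp_on_def)
  \<comment> \<open>Boundedness of \<open>\<Omega>\<close> makes the constant 1 integrable, and
    \<open>\<bar>f X\<bar>\<close> is at most \<open>1 + \<bar>f X\<bar> powr r\<close>.\<close>
  have f1: "integrable (lebesgue_on \<Omega>) f"
  proof (rule Bochner_Integration.integrable_bound)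
    show "integrable (lebesgue_on \<Omega>) (\<lambda>X. 1 + \<bar>f X\<bar> powr r)"
      using fr by simp
    have "\<bar>f X\<bar> \<le> 1 + \<bar>f X\<bar> powr r" for X
    proof (cases "\<bar>f X\<bar> \<le> 1")
      case False
      then have "\<bar>f X\<bar> powr 1 \<le> \<bar>f X\<bar> powr r"
        using \<open>r \<ge> 1\<close> by (intro powr_mono) auto
      then show ?thesis using False by simp
    qed (simp add: add_increasing2)
    then show "AE X in lebesgue_on \<Omega>. norm (f X) \<le> norm (1 + \<bar>f X\<bar> powr r)"
      by (intro AE_I2) (simp add: abs_of_nonneg add_nonneg_nonneg)
  qed measurable
  obtain G where qg: "quasi_gradient lam \<Omega> u G"
    and weak: "\<forall>v\<in>C1_0 \<Omega>. (LINT X|lebesgue_on \<Omega>. grushin_A lam X (G X) \<bullet> grad v X) =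
      (LINT X|lebesgue_on \<Omega>. f X * v X / u X)"
    using \<open>weak_solution lam \<Omega> f u\<close> unfolding weak_solution_def by blast
  obtain us0 U where us0: "H10_represents lam \<Omega> us0 u"
    and U: "L2_lim_on \<Omega> (\<lambda>n X. grushin_sqrtA lam X (grad (us0 n) X)) U"
    and G: "AE X in lebesgue_on \<Omega>. G X = grushin_sqrtA_inv lam X (U X)"
    using qg unfolding quasi_gradient_def by blast
  have L2: "L2_lim_on \<Omega> us0 u" and C1: "\<And>n. us0 n \<in> C1_0 \<Omega>"
    using us0 by (auto simp: H10_represents_def)
  then have u_meas: "u \<in> borel_measurable (lebesgue_on \<Omega>)"
    by (simp add: L2_lim_on_def Lp_on_def)
  obtain s where s: "strict_mono s" "AE X in lebesgue_on \<Omega>. (\<lambda>n. us0 (s n) X) \<longlonglongrightarrow> u X"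
    using L2_lim_on_AE_subseq[OF L2] by blast
  \<comment> \<open>The degenerate set \<open>x = 0\<close> is a hyperplane, hence null. Off it
    \<open>grushin_sqrtA\<close> and \<open>grushin_sqrtA_inv\<close> are inverse to each other,
    which turns the equation for \<open>G\<close> into one for \<open>U\<close>.\<close>
  have fst_nonzero: "AE X in lebesgue_on \<Omega>. fst X \<noteq> 0"
  proof -
    have "{X :: real \<times> (real ^ 'm). fst X = 0} = {X. (1, 0) \<bullet> X = 0}"
      by (auto simp: inner_prod_def)
    then have "negligible {X :: real \<times> (real ^ 'm). fst X = 0}"
      using negligible_hyperplane[of "(1, 0) :: real \<times> (real ^ 'm)" 0] by (simp add: zero_prod_def)
    then have "AE X in (lebesgue :: (real \<times> (real ^ 'm)) measure). X \<notin> {X. fst X = 0}"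
      by (intro AE_not_in) (simp add: negligible_iff_null_sets)
    then show ?thesis
      using \<open>open \<Omega>\<close> by (subst AE_restrict_space_iff) (auto elim!: eventually_mono)
  qed
  \<comment> \<open>Passing to the subsequence \<open>s\<close> provides convergence almost
    everywhere and leaves the L^2 limit \<open>U\<close> of the gradients unchanged.\<close>
  interpret grushin_energy lam Q \<Omega> f u "\<lambda>n. us0 (s n)" U
  proof
    show "(LINT X|lebesgue_on \<Omega>. U X \<bullet> grushin_sqrtA lam X (grad v X)) =
        (LINT X|lebesgue_on \<Omega>. f X * v X / u X)" if "v \<in> C1_0 \<Omega>" for v
    proof -
      have "AE X in lebesgue_on \<Omega>. U X \<bullet> grushin_sqrtA lam X (grad v X) = grushin_A lam X (G X) \<bullet> grad v X"
        using G fst_nonzero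
      proof eventually_elim
        case (elim X)
        then have "grushin_sqrtA lam X (G X) = U X"
          by (simp add: grushin_sqrtA_def grushin_sqrtA_inv_def)
        then show ?case by (simp add: grushin_A_inner)
      qed
      note AE = this
      have "continuous_on \<Omega> (\<lambda>X. grushin_sqrtA lam X (grad v X))"
        unfolding grushin_sqrtA_def using \<open>v \<in> C1_0 \<Omega>\<close> \<open>lam \<ge> 1\<close>
        by (intro continuous_intros continuous_on_powr') (auto simp: C1_0_def C1_on_def)
      then have [measurable]: "(\<lambda>X. grushin_sqrtA lam X (grad v X)) \<in> borel_measurable (lebesgue_on \<Omega>)"
        using \<open>open \<Omega>\<close> by (intro continuous_imp_measurable_on_sets_lebesgue) auto
      have [measurable]: "U \<in> borel_measurable (lebesgue_on \<Omega>)"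
        using U by (simp add: L2_lim_on_def Lp_on_def)
      have meas: "(\<lambda>X. U X \<bullet> grushin_sqrtA lam X (grad v X)) \<in> borel_measurable (lebesgue_on \<Omega>)"
        by measurable
      have "(LINT X|lebesgue_on \<Omega>. U X \<bullet> grushin_sqrtA lam X (grad v X)) =
          (LINT X|lebesgue_on \<Omega>. grushin_A lam X (G X) \<bullet> grad v X)"
        using borel_measurable_AE_lebesgue_on[OF meas _ AE] \<open>open \<Omega>\<close>
        by (intro integral_cong_AE meas AE) auto
      also have "\<dots> = (LINT X|lebesgue_on \<Omega>. f X * v X / u X)"
        using weak that by blast
      finally show ?thesis .
    qed
    show "\<exists>C>0. AE X in lebesgue_on \<Omega>. X \<in> \<Omega>' \<longrightarrow> C \<le> u X" if "compactly_inside \<Omega>' \<Omega>" for \<Omega>'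
      using \<open>weak_solution lam \<Omega> f u\<close> that by (simp add: weak_solution_def)
    show "L2_lim_on \<Omega> (\<lambda>n X. grushin_sqrtA lam X (grad (us0 (s n)) X)) U"
      by (rule L2_lim_on_subseq[OF U s(1)])
    show "0 \<le> lam" using \<open>lam \<ge> 1\<close> by simp
  qed (fact assms(2,3,8) Q2 f1 C1 s(2) u_meas)+
  show ?thesis
  proof (intro conjI impI)
    assume "r > Q / 2"
    from Linfty_bound[OF \<open>bounded \<Omega>\<close> this fr] u_meas show "Linfty_on \<Omega> u"
      by (simp add: Linfty_on_def)
  next
    assume "r < Q / 2"
    from Lp_bound[OF \<open>bounded \<Omega>\<close> \<open>r \<ge> 1\<close> this fr] u_meas show "Lp_on (2 * Q * r / (Q - 2 * r)) \<Omega> u"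
      by (simp add: Lp_on_def)
  qed
qed

end
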